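(* Let $m \ge 18$ and $n \ge m^2 - m + 1$ be integers, and let $UC_n$ be any connected graph on $n$ vertices containing exactly one cycle (equivalently, a connected graph with $n$ vertices and $n$ edges). Then $R(UC_n, F_m) = 2n - 1$.
   Context: All graphs are finite and simple. For graphs $H$ and $K$, the Ramsey number $R(H,K)$ is the smallest positive integer $N$ such that for every graph $G$ on $N$ vertices, either $G$ contains $H$ as a subgraph or the complement $\overline{G}$ contains $K$ as a subgraph. The fan $F_m$ is the graph on $2m+1$ vertices consisting of $m$ triangles sharing one common vertex (equivalently, a vertex joined to every vertex of a matching with $m$ edges). *)

theory Defs
  imports Main
begin

text \<open>A finite simple graph is a pair (V, E) of a finite vertex set and a set of
  edges, each edge being a 2-element subset of V.\<close>

type_synonym 'a graph = "'a set \<times> 'a set set"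

definition is_graph :: "'a graph \<Rightarrow> bool" where
  "is_graph G \<longleftrightarrow> finite (fst G) \<and>
     (\<forall>e\<in>snd G. \<exists>u v. e = {u, v} \<and> u \<noteq> v \<and> u \<in> fst G \<and> v \<in> fst G)"

text \<open>Complement: same vertices, exactly the non-edges as edges.\<close>
definition complement :: "'a graph \<Rightarrow> 'a graph" where
  "complement G = (fst G, {{u, v} | u v. u \<in> fst G \<and> v \<in> fst G \<and> u \<noteq> v} - snd G)"

text \<open>H is a subgraph of G (up to isomorphism): an injective vertex map sending edges to edges.\<close>
definition contains_subgraph :: "'b graph \<Rightarrow> 'a graph \<Rightarrow> bool" where
  "contains_subgraph H G \<longleftrightarrow>
     (\<exists>f. inj_on f (fst H) \<and> f ` fst H \<subseteq> fst G \<and> (\<forall>e\<in>snd H. f ` e \<in> snd G))"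

text \<open>Every graph on N vertices (w.l.o.g. vertex set {0..<N}) contains H or its complement contains K.\<close>
definition ramsey_prop :: "'a graph \<Rightarrow> 'b graph \<Rightarrow> nat \<Rightarrow> bool" where
  "ramsey_prop H K N \<longleftrightarrow>
     (\<forall>E. is_graph ({0..<N}, E) \<longrightarrow>
        contains_subgraph H ({0..<N}, E) \<or> contains_subgraph K (complement ({0..<N}, E)))"

definition ramsey_number :: "'a graph \<Rightarrow> 'b graph \<Rightarrow> nat" where
  "ramsey_number H K = (LEAST N. 0 < N \<and> ramsey_prop H K N)"

text \<open>Fan F_m: centre 0 joined to 1..2m, plus the matching {2i-1,2i}, i = 1..m.\<close>
definition fan :: "nat \<Rightarrow> nat graph" where
  "fan m = ({0..2*m},
            {{0, i} | i. 1 \<le> i \<and> i \<le> 2*m} \<union> {{2*i - 1, 2*i} | i. 1 \<le> i \<and> i \<le> m})"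

definition connected_graph :: "'a graph \<Rightarrow> bool" where
  "connected_graph G \<longleftrightarrow>
     (\<forall>u\<in>fst G. \<forall>v\<in>fst G. (u, v) \<in> {(x, y). {x, y} \<in> snd G}\<^sup>*)"

text \<open>Unicyclic graph on n vertices: connected, n vertices, n edges
  (the paper's stated equivalent of "connected with exactly one cycle").\<close>
definition unicyclic :: "'a graph \<Rightarrow> nat \<Rightarrow> bool" where
  "unicyclic G n \<longleftrightarrow> is_graph G \<and> connected_graph G \<and> card (fst G) = n \<and> card (snd G) = n"

end

theory Submission
  imports Defs
begin

text \<open>Call the edges of the host graph on 2n - 1 vertices red and the non-edges blue. Without a blue
  fan, no blue neighbourhood contains a blue matching of size m, so a set of s vertices in a blue
  neighbourhood contains a red clique of size s - 2m + 2, and two large sets with almost only blue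
  edges between them force every vertex to have fewer than m, or a little more, blue neighbours
  in one of them.

  If all blue degrees are below n, the unicyclic graph embeds greedily as soon as its cycle does, and
  failure to find the cycle leaves two red cliques of size about n with only blue edges between them.
  Otherwise there is a red clique A with at least n - 2m + 2 vertices, and only few vertices are missing. The
  unicyclic graph can be spread over A and some outside vertices by putting low degree vertices
  outside; if it has few leaves there are enough such vertices of degree two that are far apart, and
  otherwise leaves are used. When this fails, there is again a second clique, and the host splits into
  two nearly red parts one of which has n vertices. The tight case is a hub with at least 2m - 2 leaves:
  then all red degrees are at most n - 2, and counting over the other part produces a fan.\<close>

section \<open>Matchings and blue neighbourhoods\<close>

text \<open>A blue neighbourhood of at least \<open>n\<close> vertices yields a red clique that
  lacks at most \<open>2 * m - 2\<close> vertices. The same number separates the cases by leaves: a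
  clique vertex of red degree at least \<open>n - 1\<close> has as many red neighbours outside the
  clique as vertices are lacking, so leaves attached to it can fill the gap. The bound
  \<open>m * m + 1 \<le> n + m\<close> is used up by a part \<open>S\<close> with at least
  \<open>n\<close> vertices when all red degrees are at most \<open>n - 2\<close>. Each vertex of
  the other part then sees in red an end of every blue matching of size \<open>m\<close> in
  \<open>S\<close>, while a vertex of \<open>S\<close> has fewer red neighbours across than blue
  ones inside. Since the latter number at most \<open>m - 1\<close>, the crude count bounds the
  other part only by \<open>2 * m * (m - 2)\<close>; the obstacle is to save a factor of about two,
  which is the purpose of \<open>light_matching\<close>. The bound \<open>18 \<le> m\<close> comes
  from the case of few leaves: \<open>nonleafy_absurd\<close> needs
  \<open>18 * m \<le> n + 26\<close> to find distant vertices and \<open>18 * m < n + 22\<close> to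
  exclude a large matching. For \<open>n = m * m - m + 1\<close> both hold at 18 and fail at
  17.\<close>

lemma greedy_transversal:
  assumes "finite J" and "\<And>j. j \<in> J \<Longrightarrow> finite (S j) \<and> card J \<le> card (S j)"
  shows "\<exists>g. inj_on g J \<and> (\<forall>j\<in>J. g j \<in> S j)"
  using assms
proof (induction J rule: finite_induct)
  case empty
  then show ?case by simp
next
  case (insert x J)
  then obtain g where g: "inj_on g J" "\<forall>j\<in>J. g j \<in> S j"
    by (metis card_insert_disjoint insertI2 Suc_leD)
  have "card (g ` J) < card (S x)"
    using insert.prems[of x] insert.hyps card_image_le[OF insert.hyps(1), of g] by simp
  then obtain y where y: "y \<in> S x" "y \<notin> g ` J"
    by (metis card_mono finite_imageI insert.hyps(1) leD subsetI)
  have "inj_on (g(x := y)) (insert x J)" "\<forall>j\<in>insert x J. (g(x := y)) j \<in> S j"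
    using g y insert.hyps by (auto simp: inj_on_def)
  then show ?case by blast
qed

lemma inj_extension:
  assumes "finite W" "finite A" "N \<subseteq> W" "inj_on g N" "g ` N \<subseteq> A" "card W \<le> card A"
  shows "\<exists>h. inj_on h W \<and> h ` W \<subseteq> A \<and> (\<forall>x\<in>N. h x = g x)"
proof -
  have fN: "finite N" using assms finite_subset by blast
  have "card (W - N) = card W - card N" using assms fN by (simp add: card_Diff_subset)
  moreover have "card (A - g ` N) = card A - card N"
    using assms fN by (simp add: card_Diff_subset card_image)
  ultimately have "card (W - N) \<le> card (A - g ` N)" using assms by linarith
  then obtain k where k: "k ` (W - N) \<subseteq> A - g ` N" "inj_on k (W - N)"
    using card_le_inj[of "W - N" "A - g ` N"] assms(1,2) by blast
  let ?h = "\<lambda>x. if x \<in> N then g x else k x"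
  have "inj_on ?h W"
  proof (rule inj_onI)
    fix x y assume xy: "x \<in> W" "y \<in> W" "?h x = ?h y"
    have "k z \<noteq> g w" if "z \<in> W - N" "w \<in> N" for z w using k(1) that by blast
    then show "x = y" using xy inj_onD[OF assms(4)] inj_onD[OF k(2)]
      by (cases "x \<in> N"; cases "y \<in> N") (auto, metis)
  qed
  moreover have "?h ` W \<subseteq> A" using assms(5) k(1) by auto
  ultimately show ?thesis by (intro exI[of _ ?h]) auto
qed

text \<open>Edges are ordered pairs, so that \<open>fst\<close> and \<open>snd\<close> name the ends
  and a sum over end points splits into two sums over edges. Disjointness of the two projections
  also keeps the ends of each edge distinct.\<close>

definition matching :: "('v \<Rightarrow> 'v \<Rightarrow> bool) \<Rightarrow> ('v \<times> 'v) set \<Rightarrow> bool" where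
  "matching r M \<longleftrightarrow> finite M \<and> (\<forall>p\<in>M. r (fst p) (snd p)) \<and>
     inj_on fst M \<and> inj_on snd M \<and> fst ` M \<inter> snd ` M = {}"

definition verts :: "('v \<times> 'v) set \<Rightarrow> 'v set" where
  "verts M = fst ` M \<union> snd ` M"

lemma matching_subset:
  assumes "matching r M" "N \<subseteq> M"
  shows "matching r N"
proof -
  have "fst ` N \<inter> snd ` N \<subseteq> fst ` M \<inter> snd ` M" using assms(2) by blast
  then show ?thesis
    using assms unfolding matching_def by (auto intro: finite_subset inj_on_subset)
qed

lemma verts_mono: "N \<subseteq> M \<Longrightarrow> verts N \<subseteq> verts M"
  unfolding verts_def by blast

lemma finite_verts: "matching r M \<Longrightarrow> finite (verts M)"
  unfolding matching_def verts_def by simp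

lemma card_verts: "matching r M \<Longrightarrow> card (verts M) = 2 * card M"
  unfolding matching_def verts_def by (simp add: card_Un_disjoint card_image)

lemma matching_empty: "matching r {}"
  by (simp add: matching_def)

lemma verts_empty [simp]: "verts {} = {}"
  by (simp add: verts_def)

lemma verts_insert: "verts (insert p M) = insert (fst p) (insert (snd p) (verts M))"
  by (auto simp: verts_def)

lemma matching_insert:
  assumes "matching r M" "r x y" "x \<noteq> y" "x \<notin> verts M" "y \<notin> verts M"
  shows "matching r (insert (x, y) M)"
  using assms unfolding matching_def verts_def by (auto simp: inj_on_def)

lemma matching_submatching:
  assumes "matching r M" "k \<le> card M"
  obtains N where "N \<subseteq> M" "matching r N" "card N = k"
  using assms matching_subset by (meson obtain_subset_with_card_n)

lemma max_matching:
  assumes "finite U"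
  obtains M where "matching r M" "verts M \<subseteq> U"
    "\<And>N. matching r N \<Longrightarrow> verts N \<subseteq> U \<Longrightarrow> card N \<le> card M"
proof -
  let ?P = "\<lambda>M. matching r M \<and> verts M \<subseteq> U"
  have bound: "card M \<le> card U" if "?P M" for M
    using card_mono[OF assms, of "verts M"] card_verts[of r M] that by linarith
  have "card ` {M. ?P M} \<subseteq> {..card U}"
    unfolding image_subset_iff atMost_iff using bound by blast
  then have fin: "finite (card ` {M. ?P M})" by (rule finite_subset) simp
  obtain M where M: "?P M" "card M = Max (card ` {M. ?P M})"
  proof -
    have "{} \<in> {M. ?P M}" by (simp add: matching_empty)
    then have "card ` {M. ?P M} \<noteq> {}" by blast
    then have "Max (card ` {M. ?P M}) \<in> card ` {M. ?P M}" by (rule Max_in[OF fin])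
    then obtain M where "?P M" "Max (card ` {M. ?P M}) = card M" by blast
    then show thesis using that[of M] by simp
  qed
  moreover have "card N \<le> card M" if "matching r N" "verts N \<subseteq> U" for N
    unfolding M(2) using that by (intro Max_ge[OF fin]) blast
  ultimately show thesis using that[of M] by simp
qed

lemma matching_free_rest:
  assumes M: "matching r M" "verts M \<subseteq> U"
    and max: "\<And>N. matching r N \<Longrightarrow> verts N \<subseteq> U \<Longrightarrow> card N \<le> card M"
    and xy: "x \<in> U - verts M" "y \<in> U - verts M" "x \<noteq> y"
  shows "\<not> r x y"
proof
  assume "r x y"
  then have "matching r (insert (x, y) M)" using matching_insert[OF M(1)] xy by blast
  moreover have "verts (insert (x, y) M) \<subseteq> U" using M xy by (simp add: verts_insert)
  moreover have "(x, y) \<notin> M" using xy unfolding verts_def by force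
  ultimately show False using max[of "insert (x, y) M"] M(1) by (simp add: matching_def)
qed

text \<open>The vertices that a maximum matching leaves uncovered span no \<open>r\<close>-edge, and
  at most \<open>2 * k\<close> vertices are covered.\<close>

lemma matching_bound_clique:
  assumes "finite U"
    and "\<And>M. matching r M \<Longrightarrow> verts M \<subseteq> U \<Longrightarrow> card M \<le> k"
  obtains C where "C \<subseteq> U" "card U \<le> card C + 2 * k"
    "\<And>x y. x \<in> C \<Longrightarrow> y \<in> C \<Longrightarrow> x \<noteq> y \<Longrightarrow> \<not> r x y"
proof -
  obtain M where M: "matching r M" "verts M \<subseteq> U"
    "\<And>N. matching r N \<Longrightarrow> verts N \<subseteq> U \<Longrightarrow> card N \<le> card M"
    using max_matching[OF assms(1)] by blast
  have "card (U - verts M) = card U - 2 * card M"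
    using card_Diff_subset[OF finite_verts[OF M(1)] M(2)] card_verts[OF M(1)] by simp
  then have "card U \<le> card (U - verts M) + 2 * k" using assms(2)[OF M(1,2)] by linarith
  then show thesis using that[of "U - verts M"] matching_free_rest[OF M] by blast
qed

definition clique :: "('v \<Rightarrow> 'v \<Rightarrow> bool) \<Rightarrow> 'v set \<Rightarrow> bool" where
  "clique r C \<longleftrightarrow> (\<forall>x\<in>C. \<forall>y\<in>C. x \<noteq> y \<longrightarrow> r x y)"

lemma clique_subset: "clique r C \<Longrightarrow> D \<subseteq> C \<Longrightarrow> clique r D"
  unfolding clique_def by blast

section \<open>Two-coloured hosts without a blue fan\<close>

locale host =
  fixes V :: "'v set" and R :: "'v \<Rightarrow> 'v \<Rightarrow> bool" and m :: nat
  assumes finV: "finite V"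
    and R_sym: "R x y \<Longrightarrow> R y x"
    and R_irrefl: "\<not> R x x"
    and R_V: "R x y \<Longrightarrow> x \<in> V \<and> y \<in> V"
    and no_fan: "\<And>x M. x \<in> V \<Longrightarrow>
      matching (\<lambda>y z. y \<in> V \<and> z \<in> V \<and> y \<noteq> z \<and> \<not> R y z) M \<Longrightarrow>
      verts M \<subseteq> {y \<in> V. y \<noteq> x \<and> \<not> R x y} \<Longrightarrow> card M < m"
begin

definition blue :: "'v \<Rightarrow> 'v \<Rightarrow> bool" where
  "blue x y \<longleftrightarrow> x \<in> V \<and> y \<in> V \<and> x \<noteq> y \<and> \<not> R x y"

definition rn :: "'v \<Rightarrow> 'v set" where "rn x = {y. R x y}"
definition bn :: "'v \<Rightarrow> 'v set" where "bn x = {y. blue x y}"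

lemma blue_sym: "blue x y \<Longrightarrow> blue y x"
  unfolding blue_def using R_sym by blast

lemma rn_V: "rn x \<subseteq> V" and bn_V: "bn x \<subseteq> V"
  unfolding rn_def bn_def blue_def using R_V by auto

lemma finite_rn [simp]: "finite (rn x)" and finite_bn [simp]: "finite (bn x)"
  by (rule finite_subset[OF rn_V finV], rule finite_subset[OF bn_V finV])

lemma mem_rn: "y \<in> rn x \<longleftrightarrow> R x y" and mem_bn: "y \<in> bn x \<longleftrightarrow> blue x y"
  by (auto simp: rn_def bn_def)

lemma bn_sym: "y \<in> bn x \<longleftrightarrow> x \<in> bn y"
  using blue_sym by (auto simp: mem_bn)

lemma rn_bn_disjoint: "rn x \<inter> bn x = {}" and not_self: "x \<notin> rn x" "x \<notin> bn x"
  using R_irrefl by (auto simp: mem_rn mem_bn blue_def)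

lemma bn_eq: "x \<in> V \<Longrightarrow> bn x = {y \<in> V. y \<noteq> x \<and> \<not> R x y}"
  by (auto simp: bn_def blue_def)

lemma split_card:
  assumes "x \<in> V" "S \<subseteq> V"
  shows "card (S - {x}) = card (rn x \<inter> S) + card (bn x \<inter> S)"
proof -
  have "S - {x} = (rn x \<inter> S) \<union> (bn x \<inter> S)"
    using assms not_self[of x] by (auto simp: mem_rn mem_bn blue_def)
  moreover have "(rn x \<inter> S) \<inter> (bn x \<inter> S) = {}" using rn_bn_disjoint by blast
  moreover have "finite S" using assms finV finite_subset by blast
  ultimately show ?thesis by (simp add: card_Un_disjoint)
qed

lemma split_card_notin:
  assumes "x \<in> V" "S \<subseteq> V" "x \<notin> S"
  shows "card S = card (rn x \<inter> S) + card (bn x \<inter> S)"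
  using split_card[OF assms(1,2)] assms(3) by simp

lemma split_card_in:
  assumes "x \<in> V" "S \<subseteq> V" "x \<in> S"
  shows "card S = card (rn x \<inter> S) + card (bn x \<inter> S) + 1"
proof -
  have "finite S" using assms finV finite_subset by blast
  then show ?thesis
    using split_card[OF assms(1,2)] assms(3) by (metis Suc_eq_plus1 card_Suc_Diff1)
qed

lemma degree_sum:
  assumes "x \<in> V" shows "card V = card (rn x) + card (bn x) + 1"
  using split_card_in[OF assms subset_refl assms] rn_V[of x] bn_V[of x] by (simp add: Int_absorb2)

lemma no_blue_matching:
  assumes "x \<in> V" "matching blue M" "verts M \<subseteq> bn x"
  shows "card M < m"
  using no_fan[OF assms(1), of M] assms(2,3) bn_eq[OF assms(1)]
  by (simp add: blue_def[abs_def])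

lemma red_clique:
  assumes "x \<in> V" "U \<subseteq> bn x"
  obtains C where "C \<subseteq> U" "card U \<le> card C + 2 * (m - 1)" "clique R C"
proof -
  have "finite U" using assms finite_subset finite_bn by blast
  moreover have "card M \<le> m - 1" if "matching blue M" "verts M \<subseteq> U" for M
    using no_blue_matching[OF assms(1) that(1)] that(2) assms(2) by fastforce
  ultimately obtain C where "C \<subseteq> U" "card U \<le> card C + 2 * (m - 1)"
    "\<And>x y. x \<in> C \<Longrightarrow> y \<in> C \<Longrightarrow> x \<noteq> y \<Longrightarrow> \<not> blue x y"
    using matching_bound_clique[of U blue "m - 1"] by blast
  moreover have "C \<subseteq> V" using calculation assms bn_V by blast
  ultimately show thesis using that[of C] by (auto simp: clique_def blue_def)
qed

text \<open>Greedily, \<open>m\<close> vertices of \<open>Y\<close> get distinct blue partners in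
  \<open>Z\<close>, which are the blades of a fan with centre \<open>x\<close>. Hence two sets with
  almost only blue edges between them cannot both contain many blue neighbours of one
  vertex.\<close>

lemma no_blue_bipartite:
  assumes "x \<in> V" "Y \<subseteq> bn x" "Z \<subseteq> bn x" "Y \<inter> Z = {}" "m \<le> card Y"
    and deg: "\<And>y. y \<in> Y \<Longrightarrow> m \<le> card (bn y \<inter> Z)"
  shows False
proof -
  obtain Y' where Y': "Y' \<subseteq> Y" "card Y' = m" "finite Y'"
    using assms(5) obtain_subset_with_card_n by metis
  obtain g where g: "inj_on g Y'" "\<forall>y\<in>Y'. g y \<in> bn y \<inter> Z"
    using greedy_transversal[OF Y'(3), of "\<lambda>y. bn y \<inter> Z"] Y' deg by (metis finite_Int finite_bn subsetD)
  let ?M = "(\<lambda>y. (y, g y)) ` Y'"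
  have "matching blue ?M"
    unfolding matching_def using g Y' assms(4) by (auto simp: inj_on_def mem_bn)
  moreover have "verts ?M \<subseteq> bn x"
    unfolding verts_def using g Y' assms(2,3) by auto
  moreover have "card ?M = m" using Y' by (simp add: card_image inj_on_def)
  ultimately show False using no_blue_matching[OF assms(1)] by blast
qed

end

section \<open>Unicyclic graphs\<close>

locale simple_graph =
  fixes W :: "'a set" and E :: "'a set set"
  assumes gr: "is_graph (W, E)"
begin

definition nb :: "'a \<Rightarrow> 'a set" where "nb u = {v. {u, v} \<in> E}"
definition deg :: "'a \<Rightarrow> nat" where "deg u = card (nb u)"

lemma finW: "finite W" using gr by (simp add: is_graph_def)

lemma nb_sym: "v \<in> nb u \<longleftrightarrow> u \<in> nb v"
  by (simp add: nb_def insert_commute)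

lemma edge_W: assumes "{u, v} \<in> E" shows "u \<in> W" "v \<in> W" "u \<noteq> v"
  using gr assms unfolding is_graph_def by (fastforce simp: doubleton_eq_iff)+

lemma nb_W: "nb u \<subseteq> W" and nb_self: "u \<notin> nb u"
  using edge_W(2) edge_W(3)[of u u] by (auto simp: nb_def)

lemma nb_in_W: "v \<in> nb u \<Longrightarrow> u \<in> W"
  using edge_W by (auto simp: nb_def)

lemma finite_nb [simp]: "finite (nb u)"
  by (rule finite_subset[OF nb_W finW])

lemma E_edge: assumes "e \<in> E" obtains u v where "e = {u, v}" "u \<noteq> v" "u \<in> W" "v \<in> W"
  using gr assms unfolding is_graph_def by auto

lemma finite_E: "finite E"
  by (rule finite_subset[of _ "Pow W"]) (use finW in \<open>auto elim: E_edge\<close>)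

lemma handshake: "(\<Sum>u\<in>W. deg u) = 2 * card E"
proof -
  have "deg u = card {e \<in> E. u \<in> e}" for u
  proof -
    have "inj_on (\<lambda>v. {u, v}) (nb u)" by (auto simp: inj_on_def doubleton_eq_iff)
    moreover have "(\<lambda>v. {u, v}) ` nb u = {e \<in> E. u \<in> e}"
    proof
      show "{e \<in> E. u \<in> e} \<subseteq> (\<lambda>v. {u, v}) ` nb u"
      proof
        fix e assume e: "e \<in> {e \<in> E. u \<in> e}"
        then obtain a b where ab: "e = {a, b}" using E_edge by blast
        then consider "e = {u, a}" | "e = {u, b}" using e by blast
        then show "e \<in> (\<lambda>v. {u, v}) ` nb u" using e by cases (auto simp: nb_def)
      qed
    qed (auto simp: nb_def)
    ultimately have "bij_betw (\<lambda>v. {u, v}) (nb u) {e \<in> E. u \<in> e}" by (simp add: bij_betw_def)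
    then show ?thesis by (simp add: deg_def bij_betw_same_card)
  qed
  moreover have "card {u \<in> W. u \<in> e} = 2" if e: "e \<in> E" for e
  proof -
    obtain u v where "e = {u, v}" "u \<noteq> v" "u \<in> W" "v \<in> W" using E_edge[OF e] .
    then have "{u \<in> W. u \<in> e} = {u, v}" by auto
    then show ?thesis using \<open>u \<noteq> v\<close> by simp
  qed
  ultimately show ?thesis
    using sum_multicount[of W E "\<lambda>u e. u \<in> e" 2] finW finite_E by simp
qed

end

locale unicyclic_graph = simple_graph +
  fixes n :: nat
  assumes conn: "connected_graph (W, E)" and cardW: "card W = n" and cardE: "card E = n"
    and npos: "0 < n"
begin

lemma n_ge_3: "3 \<le> n"
proof (rule ccontr)
  assume "\<not> 3 \<le> n"
  then consider "n = 1" | "n = 2" using npos by linarith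
  then show False
  proof cases
    case 1
    then obtain e where "e \<in> E" using cardE by (metis card.empty equals0I zero_neq_one)
    then obtain u v where "u \<noteq> v" "u \<in> W" "v \<in> W" by (rule E_edge)
    then show False using 1 cardW by (auto simp: card_1_singleton_iff)
  next
    case 2
    then obtain a b where W: "W = {a, b}" using cardW by (auto simp: card_2_iff)
    have "E \<subseteq> {{a, b}}" using W by (auto elim!: E_edge)
    then show False using 2 cardE by (metis card_mono card.empty card_insert_disjoint empty_iff finite.emptyI finite.insertI numeral_le_one_iff semiring_norm(69) One_nat_def)
  qed
qed

lemma reach: "u \<in> W \<Longrightarrow> v \<in> W \<Longrightarrow> (u, v) \<in> {(x, y). {x, y} \<in> E}\<^sup>*"
  using conn by (simp add: connected_graph_def)

lemma deg_pos: assumes "u \<in> W" shows "1 \<le> deg u"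
proof -
  obtain v where v: "v \<in> W" "v \<noteq> u"
    using n_ge_3 cardW by (metis assms card_1_singleton_iff is_singletonI' is_singleton_altdef
        One_nat_def numeral_le_one_iff semiring_norm(70) empty_iff)
  then have "nb u \<noteq> {}"
    using reach[OF assms v(1)] by (auto simp: nb_def elim: converse_rtranclE)
  then show ?thesis by (simp add: deg_def Suc_leI card_gt_0_iff)
qed

definition leaves :: "'a set" where "leaves = {u \<in> W. deg u = 1}"
definition branch :: "'a set" where "branch = {u \<in> W. 3 \<le> deg u}"

lemma finite_leaves [simp]: "finite leaves" and finite_branch [simp]: "finite branch"
  using finW by (auto simp: leaves_def branch_def)

text \<open>With as many edges as vertices the average degree is two, so the deficit of one at each
  leaf balances the excess over two at the branch vertices.\<close>

lemma branch_sum: "(\<Sum>u\<in>branch. deg u) = card leaves + 2 * card branch"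
proof -
  let ?T = "{u \<in> W. deg u = 2}"
  have W: "W = (leaves \<union> ?T) \<union> branch"
    using deg_pos by (force simp: leaves_def branch_def)
  have "(\<Sum>u\<in>W. deg u) = (\<Sum>u\<in>leaves. deg u) + (\<Sum>u\<in>?T. deg u) + (\<Sum>u\<in>branch. deg u)"
    using finW by (subst W, subst sum.union_disjoint, simp, simp, force simp: leaves_def branch_def,
       subst sum.union_disjoint, simp, simp, force simp: leaves_def, simp)
  moreover have "card W = card leaves + card ?T + card branch"
    using finW by (subst W, subst card_Un_disjoint, simp, simp, force simp: leaves_def branch_def,
       subst card_Un_disjoint, simp, simp, force simp: leaves_def, simp)
  moreover have "(\<Sum>u\<in>leaves. deg u) = card leaves" by (simp add: leaves_def)
  moreover have "(\<Sum>u\<in>?T. deg u) = 2 * card ?T" by simp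
  ultimately show ?thesis using handshake cardW cardE by linarith
qed

text \<open>The parity of the distance from a root alternates along the edges of a breadth-first
  tree. The tree has \<open>n - 1\<close> of the \<open>n\<close> edges, so at most one edge is
  monochromatic, and \<open>Q\<close> holds an end of it.\<close>

lemma two_colouring:
  "\<exists>(c :: 'a \<Rightarrow> bool) Q. finite Q \<and> card Q \<le> 1 \<and>
     (\<forall>u v. v \<in> nb u \<longrightarrow> c u = c v \<longrightarrow> u \<in> Q \<or> v \<in> Q)"
proof -
  let ?A = "{(x, y). {x, y} \<in> E}"
  obtain r where r: "r \<in> W" using cardW npos by fastforce
  define d where "d v = (LEAST k. (r, v) \<in> ?A ^^ k)" for v
  have ex: "\<exists>k. (r, v) \<in> ?A ^^ k" if "v \<in> W" for v
    using reach[OF r that] by (simp add: rtrancl_power)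
  have dk: "(r, v) \<in> ?A ^^ d v" if "v \<in> W" for v
    unfolding d_def using ex[OF that] by (rule LeastI_ex)
  have dle: "d v \<le> k" if "(r, v) \<in> ?A ^^ k" for v k
    unfolding d_def using that by (rule Least_le)
  have step: "d v \<le> Suc (d u)" if "v \<in> nb u" for u v
    using dk[OF nb_in_W[OF that]] that by (intro dle) (auto simp: nb_def)
  have "\<exists>u. v \<in> nb u \<and> d v = Suc (d u)" if v: "v \<in> W" "v \<noteq> r" for v
  proof (cases "d v")
    case 0
    then show ?thesis using dk[OF v(1)] v(2) by simp
  next
    case (Suc k)
    then obtain u where u: "(r, u) \<in> ?A ^^ k" "{u, v} \<in> E" using dk[OF v(1)] by auto
    then have "v \<in> nb u" by (simp add: nb_def)
    then show ?thesis using dle[OF u(1)] step[of v u] Suc by auto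
  qed
  then obtain p where p: "\<And>v. v \<in> W \<Longrightarrow> v \<noteq> r \<Longrightarrow> v \<in> nb (p v) \<and> d v = Suc (d (p v))"
    by metis
  define c where "c v = even (d v)" for v
  define F where "F = (\<lambda>v. {v, p v}) ` (W - {r})"
  \<comment> \<open>A repeated tree edge would make two vertices parents of each other, each farther
    from the root than the other.\<close>
  have inj: "inj_on (\<lambda>v. {v, p v}) (W - {r})"
  proof (rule inj_onI)
    fix v w assume vw: "v \<in> W - {r}" "w \<in> W - {r}" "{v, p v} = {w, p w}"
    show "v = w"
    proof (rule ccontr)
      assume "v \<noteq> w"
      then have "v = p w" "w = p v" using vw(3) by (auto simp: doubleton_eq_iff)
      then show False using p[of v] p[of w] vw by fastforce
    qed
  qed
  have cF: "card F = n - 1" unfolding F_def using card_image[OF inj] r cardW finW by simp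
  have FE: "F \<subseteq> E" unfolding F_def using p by (auto simp: nb_def insert_commute)
  have cEF: "card (E - F) \<le> 1" using card_Diff_subset[OF finite_subset[OF FE finite_E] FE] cF cardE by simp
  have mono: "{u, v} \<in> E - F" if uv: "v \<in> nb u" "c u = c v" for u v
  proof -
    have "{u, v} \<notin> F"
    proof
      assume "{u, v} \<in> F"
      then obtain w where w: "w \<in> W" "w \<noteq> r" "{u, v} = {w, p w}" by (auto simp: F_def)
      then have "c w = c (p w)" using uv(2) by (auto simp: doubleton_eq_iff)
      then show False using p[OF w(1,2)] by (simp add: c_def)
    qed
    then show ?thesis using uv(1) by (simp add: nb_def)
  qed
  show ?thesis
  proof (cases "E - F = {}")
    case True
    then show ?thesis using mono by (intro exI[of _ c] exI[of _ "{}"]) auto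
  next
    case False
    then obtain e where e: "E - F = {e}"
      using cEF finite_E by (metis card_0_eq card_1_singletonE finite_Diff le_antisym less_one not_le)
    then have "e \<in> E" by blast
    then obtain u v where uv: "e = {u, v}" by (rule E_edge)
    have "\<And>a b. b \<in> nb a \<Longrightarrow> c a = c b \<Longrightarrow> a \<in> {u} \<or> b \<in> {u}"
      using mono e uv by (metis doubleton_eq_iff singletonD singletonI)
    then show ?thesis by (intro exI[of _ c] exI[of _ "{u}"]) auto
  qed
qed

text \<open>Since deg - 2 sums over the branch vertices to the number of leaves, deleting the branch
  vertices and all but three neighbours of each of them costs exactly that number.\<close>
lemma sparse_independent_set:
  obtains I where "I \<subseteq> W" "\<And>u. u \<in> I \<Longrightarrow> deg u \<le> 2" "\<And>u v. u \<in> I \<Longrightarrow> v \<in> I \<Longrightarrow> v \<notin> nb u"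
    "\<And>w. card (nb w \<inter> I) \<le> 3" "n \<le> 2 * card I + card leaves + 1"
proof -
  obtain c :: "'a \<Rightarrow> bool" and Q where cQ: "finite Q" "card Q \<le> 1"
    "\<And>u v. v \<in> nb u \<Longrightarrow> c u = c v \<Longrightarrow> u \<in> Q \<or> v \<in> Q"
    using two_colouring by auto
  have "\<exists>D. D \<subseteq> nb w \<and> card D = deg w - 3" for w
    using obtain_subset_with_card_n[of "deg w - 3" "nb w"] by (metis deg_def diff_le_self)
  then have "\<exists>D. \<forall>w. D w \<subseteq> nb w \<and> card (D w) = deg w - 3" by (intro choice) blast
  then obtain D where "\<forall>w. D w \<subseteq> nb w \<and> card (D w) = deg w - 3" ..
  then have D: "\<And>w. D w \<subseteq> nb w" "\<And>w. card (D w) = deg w - 3" by auto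
  have fD: "finite (D w)" for w by (rule finite_subset[OF D(1) finite_nb])
  define T where "T = W - branch - (\<Union>w\<in>W. D w) - Q"
  have "card (W - (branch \<union> (\<Union>w\<in>W. D w) \<union> Q)) \<ge> card W - card (branch \<union> (\<Union>w\<in>W. D w) \<union> Q)"
    by (rule diff_card_le_card_Diff) (use fD finW cQ(1) in auto)
  moreover have "card T = card (W - (branch \<union> (\<Union>w\<in>W. D w) \<union> Q))"
    unfolding T_def by (rule arg_cong[where f = card]) blast
  moreover have "card (branch \<union> (\<Union>w\<in>W. D w) \<union> Q) \<le> card branch + card (\<Union>w\<in>W. D w) + card Q"
    by (meson add_le_mono1 card_Un_le order_trans)
  moreover have "card (\<Union>w\<in>W. D w) \<le> (\<Sum>w\<in>W. deg w - 3)"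
    using card_UN_le[OF finW, of D] D(2) by simp
  moreover have "card branch + (\<Sum>w\<in>W. deg w - 3) = card leaves"
  proof -
    have "(\<Sum>w\<in>W. deg w - 3) = (\<Sum>w\<in>branch. deg w - 3)"
      by (rule sum.mono_neutral_right) (use finW in \<open>auto simp: branch_def\<close>)
    moreover have "(\<Sum>w\<in>branch. deg w) = (\<Sum>w\<in>branch. (deg w - 3) + 3)"
      by (rule sum.cong) (auto simp: branch_def)
    ultimately show ?thesis using branch_sum by (simp only: sum.distrib) simp
  qed
  ultimately have cT: "n \<le> card T + card leaves + 1" using cQ(2) cardW by linarith
  have fT: "finite T" using finW by (simp add: T_def)
  have "card T = card {u \<in> T. c u} + card {u \<in> T. \<not> c u}"
    using fT by (subst card_Un_disjoint[symmetric]) (auto intro: arg_cong[where f = card])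
  then obtain b where b: "card T \<le> 2 * card {u \<in> T. c u = b}"
    by (cases "card {u \<in> T. c u} \<ge> card {u \<in> T. \<not> c u}")
      (force intro: that[of True] that[of False])+
  show thesis
  proof (rule that[of "{u \<in> T. c u = b}"])
    show "deg u \<le> 2" if "u \<in> {u \<in> T. c u = b}" for u using that by (auto simp: T_def branch_def)
    show "v \<notin> nb u" if "u \<in> {u \<in> T. c u = b}" "v \<in> {u \<in> T. c u = b}" for u v
      using that cQ(3)[of v u] by (auto simp: T_def)
    show "card (nb w \<inter> {u \<in> T. c u = b}) \<le> 3" for w
    proof -
      have "nb w \<inter> {u \<in> T. c u = b} \<subseteq> nb w - D w"
      proof (cases "w \<in> W")
        case False
        then show ?thesis using nb_in_W by blast
      qed (auto simp: T_def)
      then have "card (nb w \<inter> {u \<in> T. c u = b}) \<le> card (nb w - D w)" by (simp add: card_mono)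
      also have "\<dots> = deg w - (deg w - 3)"
        using card_Diff_subset[OF fD D(1)] D(2) by (simp add: deg_def)
      finally show ?thesis by linarith
    qed
  qed (use b cT in \<open>auto simp: T_def\<close>)
qed

text \<open>Greedy choice among vertices that have, together with their neighbours, degree at most
  two. Each chosen vertex blocks at most five: itself, two neighbours and two vertices at distance
  two. The slack of 4 arises because only \<open>t - 1\<close> vertices have been chosen before the
  last choice.\<close>

lemma distant_set:
  assumes "4 * card leaves + 5 * t \<le> n + 4"
  obtains I where "I \<subseteq> W" "card I = t" "\<And>u. u \<in> I \<Longrightarrow> deg u \<le> 2"
    "\<And>u v. u \<in> I \<Longrightarrow> v \<in> I \<Longrightarrow> v \<notin> nb u" "\<And>w. card (nb w \<inter> I) \<le> 1"
proof -
  define S where "S = {u \<in> W. deg u \<le> 2 \<and> (\<forall>w\<in>nb u. deg w \<le> 2)}"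
  have "W - S \<subseteq> branch \<union> (\<Union>w\<in>branch. nb w)"
    using nb_sym nb_W by (fastforce simp: S_def branch_def not_le)
  then have "card (W - S) \<le> card (branch \<union> (\<Union>w\<in>branch. nb w))" by (intro card_mono) auto
  also have "\<dots> \<le> card branch + (\<Sum>w\<in>branch. deg w)"
    using card_Un_le[of branch "\<Union>w\<in>branch. nb w"] card_UN_le[of branch nb] by (simp add: deg_def)
  \<comment> \<open>Branch vertices have degree at least three, so by \<open>branch_sum\<close>
    there are no more of them than leaves.\<close>
  also have "\<dots> \<le> 4 * card leaves"
  proof -
    have "card branch * 3 \<le> (\<Sum>w\<in>branch. deg w)"
      using sum_bounded_below[of branch 3 deg] by (simp add: branch_def)
    then show ?thesis using branch_sum by linarith
  qed
  finally have cS: "n \<le> card S + 4 * card leaves"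
    using diff_card_le_card_Diff[of S W] finW cardW by (simp add: S_def)
  have "\<exists>I. I \<subseteq> S \<and> card I = s \<and> (\<forall>u\<in>I. \<forall>v\<in>I. v \<notin> nb u) \<and> (\<forall>u\<in>I. \<forall>v\<in>I. u \<noteq> v \<longrightarrow> nb u \<inter> nb v = {})"
    if "s \<le> t" for s
    using that
  proof (induction s)
    case 0
    then show ?case by (intro exI[of _ "{}"]) auto
  next
    case (Suc s)
    then obtain I where I: "I \<subseteq> S" "card I = s" "\<forall>u\<in>I. \<forall>v\<in>I. v \<notin> nb u"
      "\<forall>u\<in>I. \<forall>v\<in>I. u \<noteq> v \<longrightarrow> nb u \<inter> nb v = {}" by auto
    define F where "F u = insert u (nb u \<union> (\<Union>w\<in>nb u. nb w - {u}))" for u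
    have cF: "card (F u) \<le> 5" if "u \<in> S" for u
    proof -
      have du: "card (nb u) \<le> 2" and dw: "\<And>w. w \<in> nb u \<Longrightarrow> card (nb w) \<le> 2"
        using that by (auto simp: S_def deg_def)
      have "card (\<Union>w\<in>nb u. nb w - {u}) \<le> (\<Sum>w\<in>nb u. card (nb w - {u}))" by (rule card_UN_le) simp
      also have "\<dots> \<le> (\<Sum>w\<in>nb u. 1)"
      proof (rule sum_mono)
        fix w assume w: "w \<in> nb u"
        then have "card (nb w - {u}) = card (nb w) - 1" using nb_sym by (simp add: card_Diff_singleton)
        then show "card (nb w - {u}) \<le> 1" using dw[OF w] by simp
      qed
      finally have "card (\<Union>w\<in>nb u. nb w - {u}) \<le> 2" using du by simp
      then have "card (nb u \<union> (\<Union>w\<in>nb u. nb w - {u})) \<le> 4"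
        using card_Un_le[of "nb u" "\<Union>w\<in>nb u. nb w - {u}"] du by linarith
      then show ?thesis unfolding F_def by (simp add: card_insert_if)
    qed
    have fI: "finite I" using I(1) finW finite_subset by (fastforce simp: S_def)
    have "card (\<Union>u\<in>I. F u) \<le> (\<Sum>u\<in>I. card (F u))" by (rule card_UN_le[OF fI])
    also have "\<dots> \<le> (\<Sum>u\<in>I. 5)" by (rule sum_mono) (use cF I(1) in auto)
    finally have "card (\<Union>u\<in>I. F u) \<le> 5 * s" using I(2) by simp
    then have "card (\<Union>u\<in>I. F u) < card S" using cS assms Suc.prems by linarith
    moreover have "finite (\<Union>u\<in>I. F u)" using fI by (auto simp: F_def)
    ultimately obtain x where x: "x \<in> S" "x \<notin> (\<Union>u\<in>I. F u)"
      by (metis card_mono leD subsetI)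
    have xI: "x \<notin> I" using x(2) by (auto simp: F_def)
    have xn: "u \<notin> nb x" "x \<notin> nb u" "nb u \<inter> nb x = {}" if "u \<in> I" for u
      using x(2) that xI nb_sym by (auto simp: F_def)
    show ?case
      using I x xI xn nb_self fI by (intro exI[of _ "insert x I"]) (auto simp: Int_commute)
  qed
  from this[OF order_refl] obtain I where I: "I \<subseteq> S" "card I = t" "\<forall>u\<in>I. \<forall>v\<in>I. v \<notin> nb u"
    "\<forall>u\<in>I. \<forall>v\<in>I. u \<noteq> v \<longrightarrow> nb u \<inter> nb v = {}" by (elim exE conjE)
  show thesis
  proof (rule that[of I])
    show "card (nb w \<inter> I) \<le> 1" for w
    proof (rule card_le_Suc0_iff_eq[THEN iffD2, folded One_nat_def])
      show "\<forall>x\<in>nb w \<inter> I. \<forall>y\<in>nb w \<inter> I. x = y"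
        using I(4) nb_sym by blast
    qed simp
  qed (use I in \<open>auto simp: S_def\<close>)
qed

end

section \<open>Longest paths and the cycle of a unicyclic graph\<close>

definition embeds :: "'a set \<Rightarrow> 'a set set \<Rightarrow> 'v set \<Rightarrow> ('v \<Rightarrow> 'v \<Rightarrow> bool) \<Rightarrow> bool" where
  "embeds W E V R \<longleftrightarrow>
     (\<exists>f. inj_on f W \<and> f ` W \<subseteq> V \<and> (\<forall>u v. {u, v} \<in> E \<longrightarrow> R (f u) (f v)))"

definition cycle_list :: "('v \<Rightarrow> 'v \<Rightarrow> bool) \<Rightarrow> 'v list \<Rightarrow> bool" where
  "cycle_list R ys \<longleftrightarrow> distinct ys \<and> (\<forall>i<length ys. R (ys ! i) (ys ! (Suc i mod length ys)))"

text \<open>A neighbour of the first vertex outside a longest path could be prepended to it.\<close>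

lemma (in simple_graph) long_path:
  assumes "W \<noteq> {}"
  obtains xs where "xs \<noteq> []" "distinct xs" "set xs \<subseteq> W"
    "\<And>i. Suc i < length xs \<Longrightarrow> xs ! Suc i \<in> nb (xs ! i)" "nb (hd xs) \<subseteq> set xs"
proof -
  let ?P = "\<lambda>xs. xs \<noteq> [] \<and> distinct xs \<and> set xs \<subseteq> W \<and>
    (\<forall>i. Suc i < length xs \<longrightarrow> xs ! Suc i \<in> nb (xs ! i))"
  obtain w where w: "w \<in> W" using assms by blast
  have "?P [w]" using w by simp
  moreover have "\<forall>xs. ?P xs \<longrightarrow> length xs \<le> card W"
    using card_mono[OF finW] distinct_card by metis
  ultimately have "\<exists>xs. ?P xs \<and> (\<forall>ys. ?P ys \<longrightarrow> length ys \<le> length xs)"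
    by (intro ex_has_greatest_nat[where k = "[w]" and b = "Suc (card W)"]) (auto simp: less_Suc_eq_le)
  then obtain xs where xs: "?P xs" "\<And>ys. ?P ys \<Longrightarrow> length ys \<le> length xs" by auto
  have "nb (hd xs) \<subseteq> set xs"
  proof (rule ccontr)
    assume "\<not> nb (hd xs) \<subseteq> set xs"
    then obtain y where y: "y \<in> nb (hd xs)" "y \<notin> set xs" by blast
    have "?P (y # xs)"
      using xs(1) y nb_W nb_sym by (auto simp: nth_Cons hd_conv_nth split: nat.split)
    then show False using xs(2)[of "y # xs"] by simp
  qed
  then show thesis using that xs(1) by blast
qed

text \<open>On a path that contains all neighbours of its first vertex, the second such neighbour
  must be the last vertex: an inner one would have three neighbours. The path thus closes to a cycle
  that is closed under adjacency, and connectivity makes it everything.\<close>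

lemma (in simple_graph) regular_is_cycle:
  assumes "W \<noteq> {}" and two: "\<And>u. u \<in> W \<Longrightarrow> deg u = 2"
    and conn: "connected_graph (W, E)"
  obtains xs where "distinct xs" "set xs = W" "3 \<le> length xs"
    "\<And>u v. v \<in> nb u \<Longrightarrow> \<exists>i<length xs.
       (u = xs ! i \<and> v = xs ! (Suc i mod length xs)) \<or> (v = xs ! i \<and> u = xs ! (Suc i mod length xs))"
proof -
  obtain xs where xs: "xs \<noteq> []" "distinct xs" "set xs \<subseteq> W"
    "\<And>i. Suc i < length xs \<Longrightarrow> xs ! Suc i \<in> nb (xs ! i)" "nb (hd xs) \<subseteq> set xs"
    using long_path[OF assms(1)] by metis
  let ?l = "length xs"
  have inW: "xs ! i \<in> W" if "i < ?l" for i using that xs(3) by auto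
  have dst: "xs ! i \<noteq> xs ! j" if "i < ?l" "j < ?l" "i \<noteq> j" for i j
    using that xs(2) by (simp add: nth_eq_iff_index_eq)
  have hd: "hd xs = xs ! 0" using xs(1) by (simp add: hd_conv_nth)
  have c0: "card (nb (xs ! 0)) = 2" using two[OF inW[of 0]] xs(1) by (simp add: deg_def)
  have pair: "nb u = {a, b}" if "u \<in> W" "a \<in> nb u" "b \<in> nb u" "a \<noteq> b" for u a b
  proof -
    have "{a, b} \<subseteq> nb u" "card {a, b} = 2" using that by auto
    then show ?thesis using two[OF that(1)] card_subset_eq[of "nb u" "{a, b}"] by (simp add: deg_def)
  qed
  have "\<exists>i. 2 \<le> i \<and> i < ?l \<and> xs ! i \<in> nb (xs ! 0)"
  proof (rule ccontr)
    assume "\<not> ?thesis"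
    then have "nb (xs ! 0) \<subseteq> {xs ! 1}"
      using xs(5) hd nb_self by (fastforce simp: in_set_conv_nth numeral_2_eq_2 not_le less_Suc_eq)
    then have "card (nb (xs ! 0)) \<le> card {xs ! 1}" by (intro card_mono) auto
    then show False using c0 by simp
  qed
  then obtain i where i: "2 \<le> i" "i < ?l" "xs ! i \<in> nb (xs ! 0)" by blast
  have ilast: "Suc i = ?l"
  proof (rule ccontr)
    assume "Suc i \<noteq> ?l"
    then have s: "Suc i < ?l" using i by linarith
    have "{xs ! 0, xs ! (i - 1), xs ! Suc i} \<subseteq> nb (xs ! i)"
      using xs(4)[of "i - 1"] xs(4)[OF s] i nb_sym by auto
    moreover have "card {xs ! 0, xs ! (i - 1), xs ! Suc i} = 3"
    proof -
      have "xs ! 0 \<noteq> xs ! (i - 1)" by (rule dst) (use i s in linarith)+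
      moreover have "xs ! 0 \<noteq> xs ! Suc i" by (rule dst) (use i s in linarith)+
      moreover have "xs ! (i - 1) \<noteq> xs ! Suc i" by (rule dst) (use i s in linarith)+
      ultimately show ?thesis by simp
    qed
    ultimately have "3 \<le> card (nb (xs ! i))" by (metis card_mono finite_nb)
    then show False using two[OF inW[OF i(2)]] by (simp add: deg_def)
  qed
  have succ: "xs ! (Suc j mod ?l) \<in> nb (xs ! j)" if "j < ?l" for j
  proof (cases "Suc j = ?l")
    case True
    then have "j = i" using ilast by simp
    then show ?thesis using i(3) ilast nb_sym[of "xs ! i" "xs ! 0"] by simp
  next
    case False
    then show ?thesis using xs(4)[of j] that by simp
  qed
  have nbx: "nb (xs ! j) = {xs ! (Suc j mod ?l), xs ! ((j + ?l - 1) mod ?l)}" if j: "j < ?l" for j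
  proof (rule pair[OF inW[OF j] succ[OF j]])
    let ?p = "(j + ?l - 1) mod ?l"
    have p: "?p = (if j = 0 then ?l - 1 else j - 1)"
      using j by (auto simp: mod_if)
    have sp: "Suc ?p mod ?l = j" unfolding p using j by auto
    have pl: "?p < ?l" unfolding p using j by auto
    show "xs ! ?p \<in> nb (xs ! j)"
      using succ[OF pl] unfolding sp using nb_sym by blast
    show "xs ! (Suc j mod ?l) \<noteq> xs ! ?p"
    proof (rule dst[OF _ pl])
      show "Suc j mod ?l < ?l" using j by (intro mod_less_divisor) linarith
      show "Suc j mod ?l \<noteq> ?p" unfolding p using j i by (auto simp: mod_if)
    qed
  qed
  have closed: "v \<in> set xs" if "u \<in> set xs" "v \<in> nb u" for u v
  proof -
    obtain j where j: "j < ?l" "u = xs ! j" using \<open>u \<in> set xs\<close> by (metis in_set_conv_nth)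
    have "Suc j mod ?l < ?l" "(j + ?l - 1) mod ?l < ?l" using j(1) by (auto intro!: mod_less_divisor)
    then show ?thesis using \<open>v \<in> nb u\<close> nbx[OF j(1)] j(2) nth_mem by auto
  qed
  have "set xs = W"
  proof
    show "W \<subseteq> set xs"
    proof
      fix w assume "w \<in> W"
      then have "(xs ! 0, w) \<in> {(x, y). {x, y} \<in> E}\<^sup>*"
        using conn inW[of 0] xs(1) by (simp add: connected_graph_def)
      then show "w \<in> set xs"
        by (induction rule: rtrancl_induct) (use xs(1) closed in \<open>auto simp: nb_def\<close>)
    qed
  qed (rule xs(3))
  show thesis
  proof (rule that[OF xs(2) \<open>set xs = W\<close>])
    show "3 \<le> ?l" using i by linarith
    fix u v assume uv: "v \<in> nb u"
    then obtain j where j: "j < ?l" "u = xs ! j"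
      using nb_in_W \<open>set xs = W\<close> by (metis in_set_conv_nth)
    let ?p = "(j + ?l - 1) mod ?l"
    have "?p < ?l" using j(1) by (intro mod_less_divisor) linarith
    moreover have "Suc ?p mod ?l = j" using j(1) by (cases j) (auto simp: mod_if)
    ultimately show "\<exists>i<?l. (u = xs ! i \<and> v = xs ! (Suc i mod ?l)) \<or>
        (v = xs ! i \<and> u = xs ! (Suc i mod ?l))"
      using uv nbx[OF j(1)] j by auto
  qed
qed

text \<open>Stripping leaves reduces to the cycle; a leaf is put back greedily, which needs
  only minimum degree n - 1.\<close>
lemma cycle_core:
  fixes W :: "'a set"
  assumes "unicyclic_graph W E n"
  shows "\<exists>k\<ge>3. k + card (unicyclic_graph.leaves W E) \<le> n \<and>
    (\<forall>(V :: 'v set) R ys. finite V \<longrightarrow> (\<forall>x y. R x y \<longrightarrow> R y x) \<longrightarrow>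
      (\<forall>x\<in>V. n - 1 \<le> card {y \<in> V. R x y \<and> y \<noteq> x}) \<longrightarrow>
      cycle_list R ys \<longrightarrow> set ys \<subseteq> V \<longrightarrow> length ys = k \<longrightarrow> embeds W E V R)"
  using assms
proof (induction n arbitrary: W E rule: less_induct)
  case (less n)
  interpret unicyclic_graph W E n by (rule less.prems)
  show ?case
  proof (cases "leaves = {}")
    case True
    have "2 \<le> deg u" if "u \<in> W" for u
      using deg_pos[OF that] True that by (fastforce simp: leaves_def)
    moreover have "(\<Sum>u\<in>W. deg u) = (\<Sum>u\<in>W. 2)" using handshake cardW cardE by simp
    ultimately have two: "deg u = 2" if "u \<in> W" for u
      using sum_mono_inv[of "\<lambda>_. 2" W deg] finW that by (metis (no_types, lifting))
    have "W \<noteq> {}" using cardW npos by auto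
    then obtain xs where xs: "distinct xs" "set xs = W" "3 \<le> length xs"
      "\<And>u v. v \<in> nb u \<Longrightarrow> \<exists>i<length xs. (u = xs ! i \<and> v = xs ! (Suc i mod length xs)) \<or>
         (v = xs ! i \<and> u = xs ! (Suc i mod length xs))"
      using regular_is_cycle[OF _ two conn] by metis
    have len: "length xs = n" using distinct_card[OF xs(1)] xs(2) cardW by simp
    have "embeds W E V R" if R: "\<forall>x y. R x y \<longrightarrow> R y x" and ys: "cycle_list R ys" "set ys \<subseteq> V" "length ys = n"
      for V :: "'v set" and R ys
    proof -
      define g where "g u = (THE i. i < n \<and> xs ! i = u)" for u
      have g: "g (xs ! i) = i" if "i < n" for i
        unfolding g_def using that xs(1) len by (intro the_equality) (auto simp: nth_eq_iff_index_eq)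
      have ex: "\<exists>i<n. u = xs ! i" if "u \<in> W" for u
        using that xs(2) len by (metis in_set_conv_nth)
      have "inj_on (\<lambda>u. ys ! g u) W"
      proof (rule inj_onI)
        fix u v assume uv: "u \<in> W" "v \<in> W" "ys ! g u = ys ! g v"
        obtain i j where ij: "i < n" "u = xs ! i" "j < n" "v = xs ! j" using ex uv(1,2) by metis
        then show "u = v" using uv(3) g ys by (simp add: cycle_list_def nth_eq_iff_index_eq)
      qed
      moreover have "(\<lambda>u. ys ! g u) ` W \<subseteq> V" using ex g ys by fastforce
      moreover have "R (ys ! g u) (ys ! g v)" if "{u, v} \<in> E" for u v
      proof -
        have "v \<in> nb u" using that by (simp add: nb_def)
        then obtain i where i: "i < n" "(u = xs ! i \<and> v = xs ! (Suc i mod n)) \<or>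
            (v = xs ! i \<and> u = xs ! (Suc i mod n))" using xs(4) len by metis
        have "g (xs ! (Suc i mod n)) = Suc i mod n" using npos by (intro g) simp
        moreover have "R (ys ! i) (ys ! (Suc i mod n))" using ys i(1) by (simp add: cycle_list_def)
        ultimately show ?thesis using i(2) g[OF i(1)] R by auto
      qed
      ultimately show ?thesis unfolding embeds_def by (intro exI[of _ "\<lambda>u. ys ! g u"]) blast
    qed
    then show ?thesis using n_ge_3 True by (intro exI[of _ n]) auto
  next
    case False
    then obtain v where v: "v \<in> W" "deg v = 1" by (auto simp: leaves_def)
    then obtain p where p: "nb v = {p}" by (auto simp: deg_def card_1_singleton_iff)
    have pW: "p \<in> W" "p \<noteq> v" using p nb_W nb_self by blast+
    let ?W = "W - {v}" and ?E = "E - {{v, p}}"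
    have vpE: "{v, p} \<in> E" using p by (auto simp: nb_def)
    have only: "e \<in> ?E \<Longrightarrow> v \<notin> e" for e
    proof
      assume e: "e \<in> ?E" "v \<in> e"
      then obtain a b where "e = {a, b}" using E_edge by (metis DiffD1)
      then obtain c where c: "e = {v, c}" using e(2) by auto
      then have "c \<in> nb v" using e(1) by (simp add: nb_def)
      then show False using p c e(1) by simp
    qed
    have gr': "is_graph (?W, ?E)"
      unfolding is_graph_def
    proof (intro conjI ballI)
      fix e assume e: "e \<in> snd (?W, ?E)"
      then obtain a b where ab: "e = {a, b}" "a \<noteq> b" "a \<in> W" "b \<in> W" using E_edge by (metis DiffD1 snd_conv)
      then show "\<exists>u w. e = {u, w} \<and> u \<noteq> w \<and> u \<in> fst (?W, ?E) \<and> w \<in> fst (?W, ?E)"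
        using only[of e] e by auto
    qed (use finW in simp)
    have conn': "connected_graph (?W, ?E)"
      unfolding connected_graph_def fst_conv snd_conv
    proof (intro ballI)
      fix u w assume uw: "u \<in> ?W" "w \<in> ?W"
      \<comment> \<open>A walk that visits the leaf \<open>v\<close> is rerouted by letting its only
        neighbour \<open>p\<close> stand in for it.\<close>
      have "(u, if x = v then p else x) \<in> {(x, y). {x, y} \<in> ?E}\<^sup>*"
        if "(u, x) \<in> {(x, y). {x, y} \<in> E}\<^sup>*" for x
        using that
      proof (induction rule: rtrancl_induct)
        case base
        then show ?case using uw by auto
      next
        case (step y z)
        have yz: "z \<in> nb y" using step by (simp add: nb_def)
        consider "y = v" | "z = v" "y \<noteq> v" | "y \<noteq> v" "z \<noteq> v" by blast
        then show ?case
        proof cases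
          case 1
          then show ?thesis using step.IH yz p pW by auto
        next
          case 2
          then show ?thesis using step.IH yz p nb_sym[of z y] by auto
        next
          case 3
          then have "{y, z} \<in> ?E" using step.hyps by (auto simp: doubleton_eq_iff)
          then show ?thesis using 3 step.IH by (auto intro: rtrancl_into_rtrancl)
        qed
      qed
      from this[OF reach[of u w]] uw show "(u, w) \<in> {(x, y). {x, y} \<in> ?E}\<^sup>*" by auto
    qed
    have u': "unicyclic_graph ?W ?E (n - 1)"
      using gr' conn' cardW cardE v(1) vpE finW finite_E n_ge_3
      by (unfold_locales) (auto simp: card_Diff_singleton)
    interpret sub: unicyclic_graph ?W ?E "n - 1" by (rule u')
    obtain k where k: "3 \<le> k" "k + card sub.leaves \<le> n - 1"
      "\<And>(V :: 'v set) R ys. finite V \<Longrightarrow> (\<forall>x y. R x y \<longrightarrow> R y x) \<Longrightarrow>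
        (\<forall>x\<in>V. n - 1 - 1 \<le> card {y \<in> V. R x y \<and> y \<noteq> x}) \<Longrightarrow>
        cycle_list R ys \<Longrightarrow> set ys \<subseteq> V \<Longrightarrow> length ys = k \<Longrightarrow> embeds ?W ?E V R"
      using less.IH[OF _ u'] n_ge_3 by (auto simp: numeral_3_eq_3)
    have "leaves \<subseteq> insert v sub.leaves"
    proof
      fix u assume u: "u \<in> leaves"
      show "u \<in> insert v sub.leaves"
      proof (cases "u = v")
        case False
        then have uW: "u \<in> ?W" "deg u = 1" using u by (auto simp: leaves_def)
        have "sub.nb u \<subseteq> nb u" by (auto simp: sub.nb_def nb_def)
        then have "sub.deg u \<le> deg u" unfolding sub.deg_def deg_def by (intro card_mono) auto
        then show ?thesis using uW sub.deg_pos[OF uW(1)] by (simp add: sub.leaves_def)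
      qed simp
    qed
    then have "card leaves \<le> card (insert v sub.leaves)" by (intro card_mono) auto
    also have "\<dots> \<le> Suc (card sub.leaves)" by (simp add: card_insert_if)
    finally have kl: "k + card leaves \<le> n" using k(2) n_ge_3 by linarith
    have "embeds W E V R" if V: "finite V" and R: "\<forall>x y. R x y \<longrightarrow> R y x"
      and d: "\<forall>x\<in>V. n - 1 \<le> card {y \<in> V. R x y \<and> y \<noteq> x}"
      and ys: "cycle_list R ys" "set ys \<subseteq> V" "length ys = k" for V :: "'v set" and R ys
    proof -
      have "\<forall>x\<in>V. n - 1 - 1 \<le> card {y \<in> V. R x y \<and> y \<noteq> x}" using d by fastforce
      then obtain f where f: "inj_on f ?W" "f ` ?W \<subseteq> V" "\<And>a b. {a, b} \<in> ?E \<Longrightarrow> R (f a) (f b)"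
        using k(3)[OF V R _ ys] by (auto simp: embeds_def)
      have "f p \<in> V" using f(2) pW by auto
      \<comment> \<open>The other images are only \<open>n - 2\<close> in number, so one of the
        \<open>n - 1\<close> neighbours of \<open>f p\<close> is free for the leaf
        \<open>v\<close>.\<close>
      then have "n - 1 \<le> card {y \<in> V. R (f p) y \<and> y \<noteq> f p}" using d by blast
      moreover have "card (f ` (?W - {p})) = n - 2"
        using card_image[OF inj_on_subset[OF f(1)]] pW v(1) finW cardW
        by (simp add: card_Diff_singleton Diff_subset)
      moreover have "card {y \<in> V. R (f p) y \<and> y \<noteq> f p} \<le> card (f ` (?W - {p}))"
        if "{y \<in> V. R (f p) y \<and> y \<noteq> f p} \<subseteq> f ` (?W - {p})"
        by (rule card_mono[OF _ that]) (use finW in simp)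
      ultimately have "\<not> {y \<in> V. R (f p) y \<and> y \<noteq> f p} \<subseteq> f ` (?W - {p})"
        using n_ge_3 by linarith
      then obtain y where "y \<in> V" "R (f p) y" "y \<noteq> f p" "y \<notin> f ` (?W - {p})" by auto
      then have y: "y \<in> V" "R (f p) y" "y \<notin> f ` ?W" by auto
      define h where "h = f(v := y)"
      have "inj_on h W"
        unfolding h_def using f(1) y(3) v(1) by (auto simp: inj_on_def)
      moreover have "h ` W \<subseteq> V" unfolding h_def using f(2) y(1) by auto
      moreover have "R (h a) (h b)" if "{a, b} \<in> E" for a b
      proof (cases "{a, b} = {v, p}")
        case True
        then show ?thesis using y(2) R pW by (auto simp: h_def doubleton_eq_iff)
      next
        case False
        then have e: "{a, b} \<in> ?E" using that by simp
        then have "a \<noteq> v" "b \<noteq> v" using only[OF e] by auto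
        then show ?thesis using f(3)[OF e] by (simp add: h_def)
      qed
      ultimately show ?thesis unfolding embeds_def by blast
    qed
    then show ?thesis using k(1) kl by (intro exI[of _ k]) auto
  qed
qed

section \<open>Embedding around a red clique\<close>

locale counterexample = unicyclic_graph W E n + host V R m
  for W :: "'a set" and E n and V :: "'v set" and R m +
  assumes no_embedding: "\<not> embeds W E V R"
    and cardV: "card V = 2 * n - 1"
    and m18: "18 \<le> m" and nm: "m * m + 1 \<le> n + m"
begin

lemma finite_sub [simp]: "A \<subseteq> V \<Longrightarrow> finite A" and finite_subW: "I \<subseteq> W \<Longrightarrow> finite I"
  using finV finW finite_subset by auto

definition nbs :: "'a set \<Rightarrow> 'a set" where "nbs S = (\<Union>u\<in>S. nb u)"

lemma finite_nbs: "finite (nbs S)"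
  by (rule finite_subset[OF _ finW]) (use nb_W in \<open>auto simp: nbs_def\<close>)

text \<open>Inside the red clique every pair is an edge, so only edges that meet \<open>S\<close>
  need care. Once \<open>S\<close> and its neighbours have images, the rest fills \<open>A\<close>
  in any injective way. Every embedding around a clique below goes through this lemma.\<close>

lemma place_outside:
  assumes A: "clique R A" "A \<subseteq> V" and S: "S \<subseteq> W" "n \<le> card A + card S"
    and f: "inj_on f (S \<union> nbs S)" "f ` S \<subseteq> V - A" "f ` (nbs S - S) \<subseteq> A"
    and red: "\<And>u v. u \<in> S \<Longrightarrow> v \<in> nb u \<Longrightarrow> R (f u) (f v)"
  shows False
proof -
  have fS: "finite S" using S(1) finW finite_subset by blast
  have "card (W - S) \<le> card A" using S card_Diff_subset[OF fS S(1)] cardW by linarith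
  moreover have "nbs S - S \<subseteq> W - S" using nb_W by (auto simp: nbs_def)
  moreover have "inj_on f (nbs S - S)" using f(1) by (rule inj_on_subset) blast
  ultimately obtain h where h: "inj_on h (W - S)" "h ` (W - S) \<subseteq> A" "\<forall>x\<in>nbs S - S. h x = f x"
    using inj_extension[of "W - S" A "nbs S - S" f] f(3) A(2) finW by auto
  define g where "g u = (if u \<in> S then f u else h u)" for u
  have gn: "g v = f v" if "v \<in> nbs S" for v using h(3) that by (simp add: g_def)
  have "inj_on g W"
  proof (rule inj_onI)
    fix u v assume uv: "u \<in> W" "v \<in> W" "g u = g v"
    have ff: "f a \<noteq> h b" if "a \<in> S" "b \<in> W - S" for a b using that f(2) h(2) by blast
    consider "u \<in> S" "v \<in> S" | "u \<in> S" "v \<notin> S" | "u \<notin> S" "v \<in> S" | "u \<notin> S" "v \<notin> S" by blast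
    then show "u = v"
    proof cases
      case 1
      then show ?thesis using uv(3) inj_onD[OF f(1), of u v] by (simp add: g_def)
    next
      case 2
      then show ?thesis using uv ff[of u v] by (simp add: g_def)
    next
      case 3
      then show ?thesis using uv ff[of v u] by (simp add: g_def)
    next
      case 4
      then show ?thesis using uv inj_onD[OF h(1), of u v] by (simp add: g_def)
    qed
  qed
  moreover have "g ` W \<subseteq> V" using f(2) h(2) A(2) by (auto simp: g_def)
  moreover have "R (g u) (g v)" if e: "{u, v} \<in> E" for u v
  proof -
    have vu: "v \<in> nb u" "u \<in> nb v" using e by (auto simp: nb_def insert_commute)
    consider "u \<in> S" | "v \<in> S" | "u \<notin> S" "v \<notin> S" by blast
    then show ?thesis
    proof cases
      case 1
      then have "v \<in> nbs S" using vu by (auto simp: nbs_def)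
      then show ?thesis using red[OF 1 vu(1)] gn 1 by (simp add: g_def)
    next
      case 2
      then have "u \<in> nbs S" using vu by (auto simp: nbs_def)
      then show ?thesis using R_sym[OF red[OF 2 vu(2)]] gn 2 by (simp add: g_def)
    next
      case 3
      then have uvW: "u \<in> W - S" "v \<in> W - S" "u \<noteq> v" using edge_W[OF e] by auto
      then have "h u \<noteq> h v" using inj_onD[OF h(1)] by blast
      then show ?thesis using A(1) h(2) uvW 3 unfolding clique_def g_def by (simp add: image_subset_iff)
    qed
  qed
  ultimately show False using no_embedding unfolding embeds_def by blast
qed

lemma no_big_clique:
  assumes "clique R A" "A \<subseteq> V" shows "card A < n"
  using place_outside[OF assms, of "{}" undefined] by (force simp: nbs_def)

text \<open>Only the neighbours of \<open>I\<close> are constrained: each needs an image in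
  \<open>B\<close> that is red to the images of all its neighbours in \<open>I\<close>. With
  \<open>card (nbs I)\<close> candidates for each of them a greedy choice succeeds.\<close>

lemma place_independent:
  assumes A: "clique R A" "A \<subseteq> V" "B \<subseteq> A" and I: "I \<subseteq> W" "n \<le> card A + card I"
    and indep: "\<And>u v. u \<in> I \<Longrightarrow> v \<in> I \<Longrightarrow> v \<notin> nb u"
    and f: "inj_on f I" "f ` I \<subseteq> V - A"
    and room: "\<And>w. w \<in> nbs I \<Longrightarrow> card (nbs I) \<le> card {a \<in> B. \<forall>u\<in>nb w \<inter> I. R (f u) a}"
  shows False
proof -
  have fB: "finite B" using finite_sub[of B] A(2,3) by blast
  have "\<exists>g. inj_on g (nbs I) \<and> (\<forall>w\<in>nbs I. g w \<in> {a \<in> B. \<forall>u\<in>nb w \<inter> I. R (f u) a})"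
    by (rule greedy_transversal[OF finite_nbs], rule conjI, simp add: fB, erule room)
  then obtain g where g: "inj_on g (nbs I)" "\<forall>w\<in>nbs I. g w \<in> {a \<in> B. \<forall>u\<in>nb w \<inter> I. R (f u) a}"
    by (elim exE conjE)
  have disj: "I \<inter> nbs I = {}" using indep by (auto simp: nbs_def)
  define h where "h u = (if u \<in> I then f u else g u)" for u
  show False
  proof (rule place_outside[OF A(1,2) I, of h])
    show "inj_on h (I \<union> nbs I)"
    proof (rule inj_onI)
      fix u v assume uv: "u \<in> I \<union> nbs I" "v \<in> I \<union> nbs I" "h u = h v"
      have fg: "f a \<noteq> g b" if "a \<in> I" "b \<in> nbs I" for a b
      proof -
        have "f a \<in> V - A" "g b \<in> B" using f(2) g(2) that by auto
        then show ?thesis using A(3) by auto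
      qed
      show "u = v"
        using uv fg[of u v] fg[of v u] inj_onD[OF f(1), of u v] inj_onD[OF g(1), of u v] disj
        by (auto simp: h_def split: if_splits)
    qed
    show "h ` I \<subseteq> V - A" using f(2) by (auto simp: h_def)
    show "h ` (nbs I - I) \<subseteq> A" using g(2) A(3) by (auto simp: h_def)
    fix u v assume uv: "u \<in> I" "v \<in> nb u"
    then have "v \<in> nbs I" "v \<notin> I" "u \<in> nb v" using indep nb_sym by (auto simp: nbs_def)
    then show "R (h u) (h v)" using g(2) uv(1) by (auto simp: h_def)
  qed
qed

lemma card_nbs_le:
  assumes "finite I" "\<And>u. u \<in> I \<Longrightarrow> deg u \<le> k"
  shows "card (nbs I) \<le> k * card I"
proof -
  have "card (nbs I) \<le> (\<Sum>u\<in>I. card (nb u))" unfolding nbs_def by (rule card_UN_le[OF assms(1)])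
  also have "\<dots> \<le> (\<Sum>u\<in>I. k)" by (rule sum_mono) (use assms(2) in \<open>simp add: deg_def\<close>)
  finally show ?thesis by (simp add: mult.commute)
qed

text \<open>A neighbour of \<open>I\<close> has at most \<open>k\<close> neighbours in
  \<open>I\<close> and so loses at most \<open>k * a\<close> candidates in \<open>B\<close>. The
  term \<open>2 * card I\<close> bounds \<open>card (nbs I)\<close>.\<close>

lemma place_sparse:
  assumes A: "clique R A" "A \<subseteq> V" "B \<subseteq> A" and I: "I \<subseteq> W" "n \<le> card A + card I"
    and deg2: "\<And>u. u \<in> I \<Longrightarrow> deg u \<le> 2"
    and indep: "\<And>u v. u \<in> I \<Longrightarrow> v \<in> I \<Longrightarrow> v \<notin> nb u"
    and cap: "\<And>w. card (nb w \<inter> I) \<le> k"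
    and X: "X \<subseteq> V - A" "card I \<le> card X" "\<And>x. x \<in> X \<Longrightarrow> card (bn x \<inter> B) \<le> a"
    and room: "k * a + 2 * card I \<le> card B"
  shows False
proof -
  have fI: "finite I" using I(1) by (rule finite_subW)
  have fX: "finite X" using finite_sub[of X] X(1) by blast
  have fB: "finite B" using finite_sub[of B] A(2,3) by blast
  obtain f where f: "f ` I \<subseteq> X" "inj_on f I" using card_le_inj[OF fI fX X(2)] by blast
  show False
  proof (rule place_independent[OF A I indep f(2)])
    show "f ` I \<subseteq> V - A" using f(1) X(1) by blast
    fix w assume "w \<in> nbs I"
    let ?S = "{a \<in> B. \<forall>u\<in>nb w \<inter> I. R (f u) a}"
    have "B - ?S \<subseteq> (\<Union>u\<in>nb w \<inter> I. bn (f u) \<inter> B)"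
    proof
      fix b assume b: "b \<in> B - ?S"
      then obtain u where u: "u \<in> nb w \<inter> I" "\<not> R (f u) b" by blast
      have "f u \<in> V - A" using u(1) f(1) X(1) by blast
      then have "b \<in> bn (f u)" using b u A by (auto simp: mem_bn blue_def)
      then show "b \<in> (\<Union>u\<in>nb w \<inter> I. bn (f u) \<inter> B)" using u b by blast
    qed
    then have "card (B - ?S) \<le> card (\<Union>u\<in>nb w \<inter> I. bn (f u) \<inter> B)"
      by (rule card_mono[rotated]) (use fB fI in auto)
    also have "\<dots> \<le> (\<Sum>u\<in>nb w \<inter> I. card (bn (f u) \<inter> B))" by (rule card_UN_le) simp
    also have "\<dots> \<le> (\<Sum>u\<in>nb w \<inter> I. a)" by (rule sum_mono) (use f(1) X(3) in auto)
    also have "\<dots> \<le> k * a" using cap[of w] by simp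
    finally have "card B \<le> card ?S + k * a"
      using card_Diff_subset[of ?S B] fB by simp
    then show "card (nbs I) \<le> card ?S" using room card_nbs_le[OF fI deg2] by linarith
  qed blast
qed

text \<open>The \<open>n - card A\<close> vertices that do not fit into \<open>A\<close> are sent to
  \<open>A' - A\<close>. They are taken from \<open>sparse_independent_set\<close>, large enough by
  \<open>lv\<close>; its cap of three neighbours is the factor 3 in \<open>room\<close>.\<close>

lemma near_clique_absurd:
  assumes A: "clique R A" "A \<subseteq> A'" "A' \<subseteq> V" "B \<subseteq> A"
    and big: "n \<le> card A'"
    and a: "\<And>x. x \<in> A' \<Longrightarrow> card (bn x \<inter> B) \<le> a"
    and room: "3 * a + 2 * (n - card A) \<le> card B"
    and lv: "2 * (n - card A) + card leaves + 1 \<le> n"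
  shows False
proof -
  obtain J where J: "J \<subseteq> W" "\<And>u. u \<in> J \<Longrightarrow> deg u \<le> 2" "\<And>u v. u \<in> J \<Longrightarrow> v \<in> J \<Longrightarrow> v \<notin> nb u"
    "\<And>w. card (nb w \<inter> J) \<le> 3" "n \<le> 2 * card J + card leaves + 1"
    using sparse_independent_set by metis
  have "n - card A \<le> card J" using J(5) lv by linarith
  then obtain I where I: "I \<subseteq> J" "card I = n - card A" using obtain_subset_with_card_n by metis
  have AV: "A \<subseteq> V" using A by blast
  show False
  proof (rule place_sparse[OF A(1) AV A(4)])
    show "I \<subseteq> W" using I J by blast
    show "n \<le> card A + card I" using I by simp
    show "deg u \<le> 2" if "u \<in> I" for u using that I J by blast
    show "v \<notin> nb u" if "u \<in> I" "v \<in> I" for u v using that I J by blast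
    show "card (nb w \<inter> I) \<le> 3" for w
      using J(4)[of w] card_mono[of "nb w \<inter> J" "nb w \<inter> I"] I(1) by fastforce
    show "A' - A \<subseteq> V - A" using A by blast
    show "card I \<le> card (A' - A)"
      using I(2) big card_Diff_subset[OF finite_sub[OF AV] A(2)] by linarith
    show "card (bn x \<inter> B) \<le> a" if "x \<in> A' - A" for x using that a by blast
    show "3 * a + 2 * card I \<le> card B" using room I by simp
  qed
qed

end

section \<open>Small blue degrees\<close>

lemma cycle_list_successively:
  assumes "distinct ys" "successively R ys" "ys \<noteq> []" "R (last ys) (hd ys)"
  shows "cycle_list R ys"
  unfolding cycle_list_def
proof (intro conjI allI impI)
  fix i assume i: "i < length ys"
  show "R (ys ! i) (ys ! (Suc i mod length ys))"
  proof (cases "Suc i = length ys")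
    case True
    then have "ys ! i = last ys" using assms(3) by (metis diff_Suc_1 last_conv_nth)
    then show ?thesis using assms(3,4) True by (simp add: hd_conv_nth)
  next
    case False
    then show ?thesis using i assms(2) by (simp add: successively_conv_nth)
  qed
qed (rule assms(1))

lemma clique_successively:
  assumes "clique R A" "set xs \<subseteq> A" "distinct xs"
  shows "successively R xs"
  unfolding successively_conv_nth
proof (intro allI impI)
  fix i assume i: "Suc i < length xs"
  then have "xs ! i \<noteq> xs ! Suc i" using assms(3) by (simp add: nth_eq_iff_index_eq)
  moreover have "xs ! i \<in> A" "xs ! Suc i \<in> A" using i assms(2) by (auto simp: subset_iff)
  ultimately show "R (xs ! i) (xs ! Suc i)" using assms(1) by (simp add: clique_def)
qed

lemma subset_list:
  assumes "finite S" "l \<le> card S"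
  obtains xs where "distinct xs" "set xs \<subseteq> S" "length xs = l"
proof -
  obtain T where T: "T \<subseteq> S" "card T = l" "finite T" using assms obtain_subset_with_card_n by metis
  obtain xs where "set xs = T" "distinct xs" using finite_distinct_list[OF T(3)] by blast
  then show thesis using that[of xs] T distinct_card[of xs] by simp
qed

lemma card_Int_ge:
  assumes "finite A" "S \<subseteq> A" "T \<subseteq> A"
  shows "card S + card T \<le> card (S \<inter> T) + card A"
proof -
  have "finite S" "finite T" using assms finite_subset by auto
  then have "card S + card T = card (S \<union> T) + card (S \<inter> T)" by (rule card_Un_Int)
  moreover have "card (S \<union> T) \<le> card A" using assms by (intro card_mono) auto
  ultimately show ?thesis by linarith
qed

context host
begin

lemma clique_not_blue: "clique R A \<Longrightarrow> x \<in> A \<Longrightarrow> bn x \<inter> A = {}"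
  by (auto simp: clique_def mem_bn blue_def)

lemma red_double_count:
  assumes "finite A" "finite Y"
  shows "(\<Sum>a\<in>A. card (rn a \<inter> Y)) = (\<Sum>y\<in>Y. card (rn y \<inter> A))"
proof -
  have ind: "card (rn a \<inter> S) = (\<Sum>y\<in>S. if R a y then 1 else 0)" if "finite S" for a S
    by (simp add: sum.If_cases[OF that] rn_def Int_commute)
  have sym: "R a y = R y a" for a y using R_sym by blast
  show ?thesis unfolding ind[OF assms(1)] ind[OF assms(2)]
    by (subst sum.swap) (simp only: sym)
qed

text \<open>Without a fan at \<open>b\<close>, fewer than \<open>m\<close> edges of \<open>N\<close>
  have both ends in \<open>bn b\<close>. Every other edge has an end that is red to
  \<open>b\<close>, and different edges give different ends.\<close>

lemma red_to_matching:
  assumes N: "matching blue N" "verts N \<subseteq> V" and b: "b \<in> V" "b \<notin> verts N"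
  shows "card N < m + card (rn b \<inter> verts N)"
proof -
  let ?N = "{p \<in> N. fst p \<in> bn b \<and> snd p \<in> bn b}"
  have fN: "finite N" using N(1) by (simp add: matching_def)
  have "matching blue ?N" by (rule matching_subset[OF N(1)]) blast
  moreover have "verts ?N \<subseteq> bn b" by (auto simp: verts_def)
  ultimately have c: "card ?N < m" using no_blue_matching[OF b(1)] by blast
  define h where "h p = (if fst p \<in> rn b then fst p else snd p)" for p
  have "x \<in> rn b" if "x \<in> verts N" "x \<notin> bn b" for x
    using that b N(2) by (auto simp: mem_rn mem_bn blue_def)
  then have "h ` (N - ?N) \<subseteq> rn b \<inter> verts N"
    by (auto simp: h_def verts_def)
  moreover have "inj_on h (N - ?N)"
  proof (rule inj_onI)
    fix p q assume pq: "p \<in> N - ?N" "q \<in> N - ?N" "h p = h q"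
    have inj: "inj_on fst N" "inj_on snd N" "fst ` N \<inter> snd ` N = {}"
      using N(1) by (auto simp: matching_def)
    have fs: "fst p \<noteq> snd q" "fst q \<noteq> snd p" using inj(3) pq(1,2) by auto
    show "p = q"
      using pq fs inj_onD[OF inj(1), of p q] inj_onD[OF inj(2), of p q]
      by (auto simp: h_def split: if_splits)
  qed
  ultimately have "card (N - ?N) \<le> card (rn b \<inter> verts N)"
    by (intro card_inj_on_le[of h]) auto
  then show ?thesis using c card_Diff_subset[of ?N N] fN by simp
qed

end

context counterexample
begin

text \<open>For m at least 18 the tangent of m^2 - m + 1 at m = 18 is sharp enough to make most numerical
  side conditions linear.\<close>
lemma n_bounds: "17 * m + 1 \<le> n" "35 * m \<le> n + 323"
proof -
  obtain d where d: "m = 18 + d" using m18 le_Suc_ex by blast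
  have "m * m = 324 + 36 * d + d * d" unfolding d by (simp add: algebra_simps)
  then show "17 * m + 1 \<le> n" "35 * m \<le> n + 323" using nm d by linarith+
qed

lemma cardV': "card V + 1 = 2 * n"
  using cardV npos by linarith

lemma red_degree: "x \<in> V \<Longrightarrow> card (rn x) + card (bn x) + 2 = 2 * n"
  using degree_sum[of x] cardV npos by linarith

text \<open>A red path outside the clique A that leaves A and comes back closes up to cycles of all
  suitable lengths. If there is no such cycle of length k, long paths never come back, which makes
  a set of about n - 2m vertices completely blue to A.\<close>
lemma some_large_blue_degree:
  assumes small: "\<And>x. x \<in> V \<Longrightarrow> card (bn x) \<le> n - 1"
  shows False
proof -
  obtain k where k: "3 \<le> k" "k + card leaves \<le> n" and
    kc: "\<forall>(V :: 'v set) R ys. finite V \<longrightarrow> (\<forall>x y. R x y \<longrightarrow> R y x) \<longrightarrow>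
      (\<forall>x\<in>V. n - 1 \<le> card {y \<in> V. R x y \<and> y \<noteq> x}) \<longrightarrow>
      cycle_list R ys \<longrightarrow> set ys \<subseteq> V \<longrightarrow> length ys = k \<longrightarrow> embeds W E V R"
    using cycle_core[OF unicyclic_graph_axioms, where ?'v = 'v] by (elim exE conjE)
  have rdeg: "n - 1 \<le> card (rn x)" if "x \<in> V" for x
    using red_degree[OF that] small[OF that] by linarith
  have "{y \<in> V. R x y \<and> y \<noteq> x} = rn x" for x
    using R_V R_irrefl by (auto simp: mem_rn)
  then have "\<forall>x\<in>V. n - 1 \<le> card {y \<in> V. R x y \<and> y \<noteq> x}" using rdeg by simp
  then have noC: False if "cycle_list R ys" "set ys \<subseteq> V" "length ys = k" for ys
    using kc finV R_sym that no_embedding by blast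
  have Vne: "V \<noteq> {}" using cardV npos by auto
  define D where "D = Max ((\<lambda>x. card (bn x)) ` V)"
  have D: "card (bn x) \<le> D" if "x \<in> V" for x using that finV by (simp add: D_def)
  have "D \<in> (\<lambda>x. card (bn x)) ` V" unfolding D_def using Vne finV by (intro Max_in) auto
  then obtain v where v: "v \<in> V" "card (bn v) = D" by auto
  \<comment> \<open>For small \<open>D\<close> a red triangle suffices; it exists because two
    vertices with few blue neighbours have a common red neighbour.\<close>
  obtain A where A: "clique R A" "A \<subseteq> V" "3 \<le> card A" "D + 2 \<le> card A + 2 * m"
  proof (cases "2 * m + 1 \<le> D")
    case True
    obtain C where "C \<subseteq> bn v" "card (bn v) \<le> card C + 2 * (m - 1)" "clique R C"
      using red_clique[OF v(1) subset_refl] by metis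
    then show thesis using that[of C] bn_V[of v] v(2) True m18 by auto
  next
    case False
    obtain y where y: "y \<in> rn v" using rdeg[OF v(1)] n_ge_3 by fastforce
    then have yV: "y \<in> V" using rn_V by blast
    have "card (rn v) + card (rn y) \<le> card (rn v \<inter> rn y) + card V"
      using card_Int_ge[OF finV rn_V rn_V] .
    then have "0 < card (rn v \<inter> rn y)"
      using red_degree[OF v(1)] red_degree[OF yV] D[OF v(1)] D[OF yV] False cardV' n_bounds(1) m18 by linarith
    then have "rn v \<inter> rn y \<noteq> {}" by auto
    then obtain z where z: "R v z" "R y z" by (auto simp: mem_rn)
    have vy: "R v y" using y by (simp add: mem_rn)
    have "v \<noteq> y" "v \<noteq> z" "y \<noteq> z" using vy z R_irrefl by metis+
    then have "card {v, y, z} = 3" by simp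
    moreover have "clique R {v, y, z}" using vy z R_sym by (auto simp: clique_def)
    ultimately show thesis using that[of "{v, y, z}"] v yV z R_V False by auto
  qed
  let ?q = "card A"
  have fA: "finite A" using A(2) by simp
  have qk: "?q < k"
  proof (rule ccontr)
    assume "\<not> ?q < k"
    then obtain xs where xs: "distinct xs" "set xs \<subseteq> A" "length xs = k"
      using subset_list[OF fA, of k] by auto
    have "xs \<noteq> []" using xs k by auto
    moreover have "last xs \<noteq> hd xs" using xs k
      by (cases xs) (auto simp: last_conv_nth nth_Cons' hd_conv_nth nth_eq_iff_index_eq)
    ultimately have "R (last xs) (hd xs)" using A(1) xs(2) by (simp add: clique_def subset_iff)
    then have "cycle_list R xs" using xs clique_successively[OF A(1)] \<open>xs \<noteq> []\<close> by (intro cycle_list_successively) auto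
    then show False using noC xs A(2) by blast
  qed
  define path where "path a ps \<longleftrightarrow> distinct ps \<and> set ps \<subseteq> V - A \<and> successively R ps \<and> ps \<noteq> [] \<and>
    R a (hd ps)" for a ps
  \<comment> \<open>A second contact \<open>a'\<close> with the clique would close the cycle
    \<open>a\<close>, \<open>ps\<close>, \<open>a'\<close> and \<open>k - length ps - 2\<close>
    further vertices of \<open>A\<close>. The two length bounds ensure that this number makes sense
    and that so many vertices are left.\<close>
  have no_return: "rn (last ps) \<inter> (A - {a}) = {}"
    if ps: "path a ps" "k - ?q \<le> length ps" "length ps + 2 \<le> k" and a: "a \<in> A" for a ps
  proof (rule ccontr)
    assume "\<not> ?thesis"
    then obtain a' where "a' \<in> rn (last ps)" "a' \<in> A" "a' \<noteq> a" by blast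
    then have a': "R (last ps) a'" "a' \<in> A" "a' \<noteq> a" by (simp_all add: mem_rn)
    have "card (A - {a, a'}) = ?q - 2" using a a' fA by (simp add: card_Diff_subset)
    then have "k - length ps - 2 \<le> card (A - {a, a'})" using ps(2) by linarith
    then obtain cs where cs: "distinct cs" "set cs \<subseteq> A - {a, a'}" "length cs = k - length ps - 2"
      using subset_list[OF finite_Diff[OF fA]] by metis
    let ?ys = "a # ps @ a' # cs"
    have "distinct ?ys" using ps(1) cs a a' by (auto simp: path_def)
    moreover have "successively R ?ys"
    proof -
      have "successively R (a' # cs)"
        using cs a' by (intro clique_successively[OF A(1)]) auto
      then have "successively R (ps @ a' # cs)"
        using ps(1) a'(1) by (auto simp: successively_append_iff path_def)
      then show ?thesis using ps(1) by (cases ps) (auto simp: path_def)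
    qed
    moreover have "R (last ?ys) (hd ?ys)"
    proof -
      have "last ?ys = last (a' # cs)" by simp
      moreover have "last (a' # cs) \<in> set (a' # cs)" by (rule last_in_set) simp
      ultimately have "last ?ys \<in> A - {a}" using cs a' by auto
      then show ?thesis using A(1) a by (auto simp: clique_def)
    qed
    ultimately have "cycle_list R ?ys" by (intro cycle_list_successively) auto
    moreover have "set ?ys \<subseteq> V" using ps(1) cs a a' A(2) by (auto simp: path_def)
    moreover have "length ?ys = k" using cs(3) ps(3) by simp
    ultimately show False using noC by blast
  qed
  obtain a where a: "a \<in> A" using A(3) by fastforce
  have "\<exists>p. p \<in> rn a \<and> p \<notin> A"
  proof (rule ccontr)
    assume "\<not> ?thesis"
    then have "rn a \<subseteq> A - {a}" using not_self by blast
    then have "card (rn a) \<le> card (A - {a})" using fA by (intro card_mono) auto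
    then show False using rdeg[of a] a A(2) fA qk k by (auto simp: card_Diff_singleton)
  qed
  then obtain p where p: "R a p" "p \<notin> A" by (auto simp: mem_rn)
  have paths: "\<exists>ps. path a ps \<and> length ps = Suc i" if "Suc i \<le> k - ?q" for i
    using that
  proof (induction i)
    case 0
    show ?case using p R_V by (intro exI[of _ "[p]"]) (auto simp: path_def)
  next
    case (Suc i)
    then obtain ps where ps: "path a ps" "length ps = Suc i" by auto
    let ?l = "last ps"
    have l: "?l \<in> set ps" using ps(1) by (simp add: path_def)
    have "set ps \<subseteq> V" using ps(1) by (auto simp: path_def)
  then have lV: "?l \<in> V" using l by blast
    have "\<not> rn ?l \<subseteq> A \<union> (set ps - {?l})"
    proof
      assume "rn ?l \<subseteq> A \<union> (set ps - {?l})"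
      then have "card (rn ?l) \<le> card (A \<union> (set ps - {?l}))" using fA by (intro card_mono) auto
      also have "\<dots> \<le> ?q + card (set ps - {?l})" by (rule card_Un_le)
      also have "card (set ps - {?l}) = i"
        using l ps distinct_card[of ps] by (simp add: path_def card_Diff_singleton)
      finally show False using rdeg[OF lV] Suc.prems k qk by linarith
    qed
    then obtain w where "w \<in> rn ?l" "w \<notin> A" "w \<notin> set ps"
      using not_self(1)[of ?l] by blast
    then have w: "R ?l w" "w \<notin> A" "w \<notin> set ps" by (simp_all add: mem_rn)
    have "path a (ps @ [w])"
      using ps(1) w R_V by (auto simp: path_def successively_append_iff)
    then show ?case using ps(2) by (intro exI[of _ "ps @ [w]"]) simp
  qed
  obtain ps where ps: "path a ps" "length ps = k - ?q"
    using paths[of "k - ?q - 1"] qk by fastforce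
  let ?l = "last ps"
  have l: "?l \<in> set ps" using ps(1) by (simp add: path_def)
  have "set ps \<subseteq> V" using ps(1) by (auto simp: path_def)
  then have lV: "?l \<in> V" using l by blast
  define U where "U = rn ?l - A - set ps"
  have UV: "U \<subseteq> V" using rn_V by (auto simp: U_def)
  \<comment> \<open>A vertex of \<open>U\<close> prolongs \<open>ps\<close> to a path on
    \<open>k - card A + 1\<close> vertices; since \<open>3 \<le> card A\<close>, this length is
    still covered by \<open>no_return\<close>.\<close>
  have blueU: "w \<in> bn b" if "w \<in> U" "b \<in> A - {a}" for w b
  proof -
    have "path a (ps @ [w])"
      using ps(1) that(1) rn_V by (auto simp: path_def successively_append_iff U_def mem_rn R_V)
    then have "rn w \<inter> (A - {a}) = {}"
      using no_return[of a "ps @ [w]"] ps(2) qk A(3) a by auto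
    then have "b \<notin> rn w" using that(2) by blast
    then have "\<not> R b w" using R_sym mem_rn by blast
    then show ?thesis using that UV A(2) by (auto simp: mem_bn blue_def U_def)
  qed
  have cU: "2 * n + ?q \<le> card U + D + k + 2"
  proof -
    have "rn ?l \<inter> (A - {a}) = {}" using no_return[OF ps(1) _ _ a] ps(2) A(3) qk by linarith
    then have "rn ?l \<subseteq> insert a ((set ps - {?l}) \<union> U)" using not_self by (auto simp: U_def)
    then have "card (rn ?l) \<le> card (insert a ((set ps - {?l}) \<union> U))"
      using UV finite_sub[OF UV] by (intro card_mono) auto
    also have "\<dots> \<le> Suc (card ((set ps - {?l}) \<union> U))" by (rule card_insert_le_m1) simp_all
    also have "\<dots> \<le> Suc (card (set ps - {?l}) + card U)" using card_Un_le by simp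
    also have "card (set ps - {?l}) = k - ?q - 1"
      using l ps distinct_card[of ps] by (simp add: path_def card_Diff_singleton)
    finally show ?thesis using red_degree[OF lV] D[OF lV] qk by linarith
  qed
  let ?A = "A - {a}"
  have cA: "card ?A + 1 = ?q" using a fA A(3) by (simp add: card_Diff_singleton)
  have "card ?A \<noteq> 0" using A(3) cA by linarith
  then have "?A \<noteq> {}" by (metis card.empty)
  then obtain b where b: "b \<in> ?A" by blast
  have Ub: "U \<subseteq> bn b" using blueU[OF _ b] by blast
  have bV: "b \<in> V" using b A(2) by blast
  obtain B where B: "B \<subseteq> U" "card U \<le> card B + 2 * (m - 1)" "clique R B"
    using red_clique[OF bV Ub] by metis
  have "card U \<le> D" using card_mono[OF finite_bn Ub] D[OF bV] by linarith
  then have q: "n + 2 \<le> ?q + 4 * m" using cU A(4) k by linarith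
  have cB: "n + 2 \<le> card B + 4 * m" using cU A(4) k B(2) m18 by linarith
  \<comment> \<open>\<open>B\<close> and \<open>A - {a}\<close> are completely blue to each other,
    so \<open>m\<close> blue neighbours of \<open>x\<close> in both would give a fan at
    \<open>x\<close>.\<close>
  have split: "card (bn x \<inter> ?A) \<le> m - 1 \<or> card (bn x \<inter> B) \<le> m - 1" if x: "x \<in> V" for x
  proof (rule ccontr)
    assume c: "\<not> ?thesis"
    have "bn y \<inter> (bn x \<inter> B) = bn x \<inter> B" if "y \<in> bn x \<inter> ?A" for y
      using that blueU B(1) by blast
    moreover have "(bn x \<inter> ?A) \<inter> (bn x \<inter> B) = {}" using B(1) by (auto simp: U_def)
    moreover have "m \<le> card (bn x \<inter> ?A)" "m \<le> card (bn x \<inter> B)" using c by linarith+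
    ultimately show False
      using no_blue_bipartite[OF x, of "bn x \<inter> ?A" "bn x \<inter> B"] by simp
  qed
  let ?A' = "{x \<in> V. card (bn x \<inter> ?A) \<le> m - 1}" and ?B' = "{x \<in> V. card (bn x \<inter> B) \<le> m - 1}"
  have "card V \<le> card (?A' \<union> ?B')" using split finV by (intro card_mono) auto
  also have "\<dots> \<le> card ?A' + card ?B'" by (rule card_Un_le)
  finally consider "n \<le> card ?A'" | "n \<le> card ?B'" using cardV by linarith
  \<comment> \<open>Leaves are few here: \<open>?q < k\<close> and
    \<open>k + card leaves \<le> n\<close> give \<open>card leaves < n - ?q\<close>, which is at
    most \<open>4 * m - 2\<close>.\<close>
  then show False
  proof cases
    case 1
    have cl: "clique R ?A" using A(1) by (rule clique_subset) blast
    show False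
      by (rule near_clique_absurd[OF cl _ _ subset_refl 1, of "m - 1"])
        (use clique_not_blue[OF cl] A(2) q cA k qk n_bounds in auto)
  next
    case 2
    show False
      by (rule near_clique_absurd[OF B(3) _ _ subset_refl 2, of "m - 1"])
        (use clique_not_blue[OF B(3)] B(1) UV cB q k qk n_bounds in auto)
  qed
qed

end

section \<open>Large blue degrees and many leaf parents\<close>

context unicyclic_graph
begin

lemma leaf_nb: assumes "v \<in> leaves" "p \<in> nb v" shows "nb v = {p}"
  using assms by (auto simp: leaves_def deg_def card_1_singleton_iff)

text \<open>Two adjacent leaves would form a component with two vertices.\<close>

lemma leaf_parent_not_leaf: assumes v: "v \<in> leaves" "p \<in> nb v" shows "p \<notin> leaves"
proof
  assume p: "p \<in> leaves"
  have vp: "nb v = {p}" "nb p = {v}" using leaf_nb v p nb_sym by blast+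
  have "x \<in> {v, p}" if "(v, x) \<in> {(x, y). {x, y} \<in> E}\<^sup>*" for x
    using that
  proof (induction rule: rtrancl_induct)
    case (step y z)
    then have "z \<in> nb y" by (simp add: nb_def)
    then show ?case using step.IH vp by auto
  qed simp
  then have "W \<subseteq> {v, p}" using reach v(1) by (auto simp: leaves_def)
  then have "card W \<le> card {v, p}" by (rule card_mono[rotated]) simp
  then show False using cardW n_ge_3 card_insert_le_m1[of 2 "{p}" v] by simp
qed

lemma leaves_W: "leaves \<subseteq> W" by (auto simp: leaves_def)

lemma disjoint_leaf_sets: "p \<noteq> q \<Longrightarrow> (nb p \<inter> leaves) \<inter> (nb q \<inter> leaves) = {}"
  using leaf_nb nb_sym by blast

end

section \<open>Distributing outside vertices over hubs\<close>

context host
begin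

lemma blue_double_count:
  assumes "finite A" "finite Y"
  shows "(\<Sum>a\<in>A. card (bn a \<inter> Y)) = (\<Sum>y\<in>Y. card (bn y \<inter> A))"
proof -
  have ind: "card (bn a \<inter> S) = (\<Sum>y\<in>S. if blue a y then 1 else 0)" if "finite S" for a S
    by (simp add: sum.If_cases[OF that] bn_def Int_commute)
  have sym: "blue a y = blue y a" for a y using blue_sym by blast
  show ?thesis unfolding ind[OF assms(1)] ind[OF assms(2)]
    by (subst sum.swap) (simp only: sym)
qed

text \<open>A hub, placed at a vertex of B with few blue neighbours in X, either uses its full capacity
  or leaves at most a quarter of X uncovered, and the latter happens at most e times.\<close>
lemma assign_to_hubs:
  assumes "finite H" "B \<subseteq> V" "X \<subseteq> V" "X \<inter> B = {}"
    and "\<And>x. x \<in> X \<Longrightarrow> card (bn x \<inter> B) \<le> \<alpha>" and "\<And>w. w \<in> H \<Longrightarrow> l w \<le> c"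
    and "card X < 4 ^ e" and "card X + e * c \<le> (\<Sum>w\<in>H. l w)" and "4 * \<alpha> + card H \<le> card B"
  shows "\<exists>a h. inj_on a H \<and> a ` H \<subseteq> B \<and> (\<forall>x\<in>X. h x \<in> H \<and> R x (a (h x))) \<and>
    (\<forall>w\<in>H. card {x \<in> X. h x = w} \<le> l w)"
  using assms
proof (induction H arbitrary: B X e rule: finite_induct)
  case empty
  have "finite X" using empty.prems(2) finV finite_subset by blast
  then have "X = {}" using empty.prems by simp
  then show ?case by simp
next
  case (insert w H)
  have fX: "finite X" and fB: "finite B" using insert.prems(1,2) finV finite_subset by blast+
  have sl: "(\<Sum>w\<in>insert w H. l w) = l w + (\<Sum>w\<in>H. l w)" using insert.hyps by simp
  have cH: "card (insert w H) = Suc (card H)" using insert.hyps by simp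
  \<comment> \<open>Averaging: \<open>X\<close> sends at most \<open>\<alpha> * card X\<close> blue
    edges to \<open>B\<close>, and \<open>4 * \<alpha> \<le> card B\<close>.\<close>
  have "\<exists>b\<in>B. 4 * card (bn b \<inter> X) \<le> card X"
  proof (rule ccontr)
    assume "\<not> (\<exists>b\<in>B. 4 * card (bn b \<inter> X) \<le> card X)"
    then have "(\<Sum>b\<in>B. card X + 1) \<le> (\<Sum>b\<in>B. 4 * card (bn b \<inter> X))"
      by (intro sum_mono) (auto simp: not_le)
    also have "\<dots> = 4 * (\<Sum>x\<in>X. card (bn x \<inter> B))"
      using blue_double_count[OF fB fX] by (simp add: sum_distrib_left[symmetric])
    also have "(\<Sum>x\<in>X. card (bn x \<inter> B)) \<le> (\<Sum>x\<in>X. \<alpha>)"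
      by (rule sum_mono) (rule insert.prems(4))
    finally have "card B * (card X + 1) \<le> 4 * \<alpha> * card X" by (simp add: algebra_simps)
    moreover have "(4 * \<alpha>) * card X \<le> card B * card X"
      by (rule mult_le_mono1) (use insert.prems(8) in linarith)
    moreover have "0 < card B" using insert.prems(8) cH by linarith
    ultimately show False by (simp add: algebra_simps)
  qed
  then obtain b where b: "b \<in> B" "4 * card (bn b \<inter> X) \<le> card X" by blast
  have bV: "b \<in> V" "b \<notin> X" using b insert.prems(1,3) by blast+
  have cX: "card X = card (rn b \<inter> X) + card (bn b \<inter> X)"
    by (rule split_card_notin[OF bV(1) insert.prems(2) bV(2)])
  have lw: "l w \<le> c" using insert.prems(5) by blast
  \<comment> \<open>If the capacity is exhausted, both sides of the capacity hypothesis drop by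
    \<open>l w\<close> and \<open>e\<close> stays. Otherwise all red neighbours of \<open>b\<close>
    are served, and lowering \<open>e\<close> by one pays for the wasted capacity, which is at most
    \<open>c\<close>.\<close>
  have "\<exists>Y e'. Y \<subseteq> rn b \<inter> X \<and> card Y \<le> l w \<and> card (X - Y) < 4 ^ e' \<and>
      card (X - Y) + e' * c \<le> (\<Sum>w\<in>H. l w)"
  proof (cases "l w \<le> card (rn b \<inter> X)")
    case True
    then obtain Y where Y: "Y \<subseteq> rn b \<inter> X" "card Y = l w" using obtain_subset_with_card_n by metis
    have "Y \<subseteq> X" using Y by blast
    then have "card (X - Y) + l w = card X"
      using Y(2) card_Diff_subset[of Y X] card_mono[OF fX, of Y] finite_subset[OF _ fX] by simp
    then show ?thesis using Y insert.prems(6,7) sl by (intro exI[of _ Y] exI[of _ e]) auto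
  next
    case False
    have "X - (rn b \<inter> X) = bn b \<inter> X"
    proof
      show "X - (rn b \<inter> X) \<subseteq> bn b \<inter> X"
        using bV insert.prems(2) by (auto simp: mem_rn mem_bn blue_def)
    qed (use rn_bn_disjoint in blast)
    then have cd: "4 * card (X - (rn b \<inter> X)) \<le> card X" "card (X - (rn b \<inter> X)) \<le> card X"
      using b(2) cX by auto
    show ?thesis
    proof (cases e)
      case 0
      then show ?thesis using cd insert.prems(6) False
        by (intro exI[of _ "rn b \<inter> X"] exI[of _ 0]) auto
    next
      case (Suc e')
      have "card (X - (rn b \<inter> X)) < 4 ^ e'" using cd insert.prems(6) Suc by simp
      moreover have "card (X - (rn b \<inter> X)) + e' * c \<le> (\<Sum>w\<in>H. l w)"
        using cd(2) insert.prems(7) Suc sl lw by simp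
      ultimately show ?thesis using False
        by (intro exI[of _ "rn b \<inter> X"] exI[of _ e']) auto
    qed
  qed
  then obtain Y e' where Y: "Y \<subseteq> rn b \<inter> X" "card Y \<le> l w" "card (X - Y) < 4 ^ e'"
    "card (X - Y) + e' * c \<le> (\<Sum>w\<in>H. l w)" by (elim exE conjE)
  have "\<exists>a h. inj_on a H \<and> a ` H \<subseteq> B - {b} \<and> (\<forall>x\<in>X - Y. h x \<in> H \<and> R x (a (h x))) \<and>
    (\<forall>w\<in>H. card {x \<in> X - Y. h x = w} \<le> l w)"
  proof (rule insert.IH[OF _ _ _ _ _ Y(3,4)])
    show "B - {b} \<subseteq> V" "X - Y \<subseteq> V" "(X - Y) \<inter> (B - {b}) = {}" using insert.prems(1,2,3) by blast+
    show "card (bn x \<inter> (B - {b})) \<le> \<alpha>" if x: "x \<in> X - Y" for x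
    proof -
      have "card (bn x \<inter> (B - {b})) \<le> card (bn x \<inter> B)" by (intro card_mono) auto
      then show ?thesis using insert.prems(4)[of x] x by simp
    qed
    show "l v \<le> c" if "v \<in> H" for v using insert.prems(5) that by blast
    show "4 * \<alpha> + card H \<le> card (B - {b})" using insert.prems(8) cH b(1) fB by (simp add: card_Diff_singleton)
  qed
  then obtain a h where ah: "inj_on a H" "a ` H \<subseteq> B - {b}" "\<forall>x\<in>X - Y. h x \<in> H \<and> R x (a (h x))"
    "\<forall>w\<in>H. card {x \<in> X - Y. h x = w} \<le> l w" by (elim exE conjE)
  let ?a = "a(w := b)" and ?h = "\<lambda>x. if x \<in> Y then w else h x"
  have "inj_on ?a (insert w H)" using ah(1,2) insert.hyps(2) by (auto simp: inj_on_def)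
  moreover have "?a ` insert w H \<subseteq> B" using ah(2) b(1) by auto
  moreover have "\<forall>x\<in>X. ?h x \<in> insert w H \<and> R x (?a (?h x))"
    using ah(3) Y(1) insert.hyps(2) R_sym by (auto simp: mem_rn)
  moreover have "\<forall>v\<in>insert w H. card {x \<in> X. ?h x = v} \<le> l v"
  proof
    fix v assume v: "v \<in> insert w H"
    show "card {x \<in> X. ?h x = v} \<le> l v"
    proof (cases "v = w")
      case True
      have "{x \<in> X. ?h x = v} \<subseteq> Y" using True ah(3) insert.hyps(2) by auto
      moreover have "finite Y" by (rule finite_subset[OF Y(1)]) simp
      ultimately have "card {x \<in> X. ?h x = v} \<le> card Y" by (intro card_mono)
      then show ?thesis using Y(2) True by simp
    next
      case False
      then have "{x \<in> X. ?h x = v} = {x \<in> X - Y. h x = v}" by auto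
      then show ?thesis using ah(4) v False by simp
    qed
  qed
  ultimately show ?case by (intro exI[of _ ?a] exI[of _ ?h] conjI)
qed

end

section \<open>Few leaves, and leaves spread over several parents\<close>

context counterexample
begin

text \<open>If \<open>t\<close> outside vertices had \<open>2 * t\<close> red neighbours in
  \<open>A\<close> each, \<open>t\<close> distant vertices of the unicyclic graph could move onto
  them, every neighbour obeying a single constraint. Otherwise at least \<open>n\<close> vertices
  are almost completely blue to \<open>A\<close>; they contain a second large clique and have few
  blue neighbours in it, which contradicts \<open>near_clique_absurd\<close>.\<close>

lemma nonleafy_absurd:
  assumes v: "v \<in> V" "n \<le> card (bn v)" and few: "card leaves + 3 \<le> 2 * m"
  shows False
proof -
  obtain A where A: "A \<subseteq> bn v" "card (bn v) \<le> card A + 2 * (m - 1)" "clique R A"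
    using red_clique[OF v(1) subset_refl] by metis
  have AV: "A \<subseteq> V" using A(1) bn_V by blast
  have fA: "finite A" using AV by simp
  define t where "t = n - card A"
  have t: "card A + t = n" "t + 2 \<le> 2 * m" "1 \<le> t"
    using no_big_clique[OF A(3) AV] A(2) v(2) m18 by (auto simp: t_def)
  define O2 where "O2 = {x \<in> V - A. 2 * t \<le> card (rn x \<inter> A)}"
  have "4 * card leaves + 5 * t \<le> n + 4" using few t(2) n_bounds m18 by linarith
  then obtain I where I: "I \<subseteq> W" "card I = t" "\<And>u. u \<in> I \<Longrightarrow> deg u \<le> 2"
    "\<And>u v. u \<in> I \<Longrightarrow> v \<in> I \<Longrightarrow> v \<notin> nb u" "\<And>w. card (nb w \<inter> I) \<le> 1"
    using distant_set by metis
  have fI: "finite I" using I(1) by (rule finite_subW)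
  have "card O2 < t"
  proof (rule ccontr)
    assume "\<not> card O2 < t"
    moreover have "finite O2" using finV by (simp add: O2_def)
    ultimately obtain f where f: "f ` I \<subseteq> O2" "inj_on f I"
      using card_le_inj[OF fI, of O2] I(2) by auto
    show False
    proof (rule place_independent[OF A(3) AV subset_refl I(1) _ I(4) f(2)])
      show "f ` I \<subseteq> V - A" using f(1) by (auto simp: O2_def)
      show "n \<le> card A + card I" using t I(2) by simp
      fix w assume "w \<in> nbs I"
      then obtain u where u: "u \<in> I" "u \<in> nb w" using nb_sym by (auto simp: nbs_def)
      have "nb w \<inter> I = {u}"
      proof -
        have "{u} \<subseteq> nb w \<inter> I" using u by blast
        then show ?thesis using I(5)[of w] card_seteq[of "nb w \<inter> I" "{u}"] by simp
      qed
      then have "{a \<in> A. \<forall>u\<in>nb w \<inter> I. R (f u) a} = rn (f u) \<inter> A" by (auto simp: mem_rn)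
      moreover have "2 * t \<le> card (rn (f u) \<inter> A)" using f(1) u(1) by (auto simp: O2_def)
      ultimately show "card (nbs I) \<le> card {a \<in> A. \<forall>u\<in>nb w \<inter> I. R (f u) a}"
        using card_nbs_le[OF fI I(3)] I(2) by simp
    qed
  qed
  define Y where "Y = V - A - O2"
  have YV: "Y \<subseteq> V" by (auto simp: Y_def)
  have cY: "n \<le> card Y"
  proof -
    have "card V = card A + card (V - A)" using card_Diff_subset[OF fA AV] card_mono[OF finV AV] by linarith
    moreover have "card (V - A) \<le> card (Y \<union> O2)" using finV by (intro card_mono) (auto simp: Y_def O2_def)
    moreover have "card (Y \<union> O2) \<le> card Y + card O2" by (rule card_Un_le)
    ultimately show ?thesis using t \<open>card O2 < t\<close> cardV' by linarith
  qed
  have redY: "card (rn y \<inter> A) + 1 \<le> 2 * t" if "y \<in> Y" for y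
    using that by (auto simp: Y_def O2_def)
  \<comment> \<open>Given \<open>2 * m - 1\<close> edges, each vertex of \<open>A\<close> is red to
    at least \<open>m\<close> of their fewer than \<open>4 * m\<close> ends, while an end has at
    most \<open>2 * t - 1\<close> red neighbours in \<open>A\<close>. This would bound
    \<open>card A\<close> by \<open>4 * (2 * t - 1)\<close>.\<close>
  have match: "card M \<le> 2 * m - 2" if M: "matching blue M" "verts M \<subseteq> Y" for M
  proof (rule ccontr)
    assume "\<not> card M \<le> 2 * m - 2"
    then have "2 * m - 1 \<le> card M" by linarith
    then obtain N where N: "N \<subseteq> M" "matching blue N" "card N = 2 * m - 1"
      by (rule matching_submatching[OF M(1)])
    have NY: "verts N \<subseteq> Y" using verts_mono[OF N(1)] M(2) by blast
    have "m \<le> card (rn a \<inter> verts N)" if a: "a \<in> A" for a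
    proof -
      have "a \<notin> verts N" using NY a by (auto simp: Y_def)
      then show ?thesis using red_to_matching[OF N(2), of a] NY YV AV a N(3) m18 by fastforce
    qed
    then have "(\<Sum>a\<in>A. m) \<le> (\<Sum>a\<in>A. card (rn a \<inter> verts N))" by (rule sum_mono)
    also have "\<dots> = (\<Sum>y\<in>verts N. card (rn y \<inter> A))"
      by (rule red_double_count[OF fA finite_verts[OF N(2)]])
    also have "\<dots> \<le> (\<Sum>y\<in>verts N. 2 * t - 1)"
      by (rule sum_mono) (use redY NY in fastforce)
    also have "\<dots> = 2 * (2 * m - 1) * (2 * t - 1)" using card_verts[OF N(2)] N(3) by simp
    also have "\<dots> \<le> 4 * m * (2 * t - 1)" by (intro mult_le_mono1) simp
    finally have "m * card A \<le> m * (4 * (2 * t - 1))" by (simp add: algebra_simps)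
    then have "card A \<le> 4 * (2 * t - 1)" using m18 by simp
    then show False using t n_bounds m18 by linarith
  qed
  obtain B where B: "B \<subseteq> Y" "card Y \<le> card B + 2 * (2 * m - 2)"
    "\<And>x y. x \<in> B \<Longrightarrow> y \<in> B \<Longrightarrow> x \<noteq> y \<Longrightarrow> \<not> blue x y"
    using matching_bound_clique[OF finite_sub[OF YV] match] by metis
  have BV: "B \<subseteq> V" using B(1) YV by blast
  have cl: "clique R B" using B(3) BV by (auto simp: clique_def blue_def subset_iff)
  have "card (bn y \<inter> B) \<le> m - 1" if y: "y \<in> Y" for y
  proof (rule ccontr)
    assume c: "\<not> ?thesis"
    have blueY: "card A + 1 \<le> card (bn z \<inter> A) + 2 * t" if z: "z \<in> Y" for z
    proof -
      have "z \<in> V" "z \<notin> A" using z by (auto simp: Y_def)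
      then show ?thesis using split_card_notin[of z A] AV redY[OF z] by simp
    qed
    \<comment> \<open>Two vertices of \<open>Y\<close> each miss at most \<open>2 * t - 1\<close>
      vertices of \<open>A\<close> in blue, so they share at least \<open>m\<close> blue neighbours
      there.\<close>
    show False
    proof (rule no_blue_bipartite[of y "bn y \<inter> B" "bn y \<inter> A"])
      show "y \<in> V" using y YV by blast
      show "(bn y \<inter> B) \<inter> (bn y \<inter> A) = {}" using B(1) by (auto simp: Y_def)
      show "m \<le> card (bn y \<inter> B)" using c by linarith
      fix z assume "z \<in> bn y \<inter> B"
      then have z: "z \<in> Y" using B(1) by blast
      have "bn z \<inter> A \<inter> (bn y \<inter> A) = bn z \<inter> (bn y \<inter> A)" by blast
      then have "card (bn z \<inter> A) + card (bn y \<inter> A) \<le> card (bn z \<inter> (bn y \<inter> A)) + card A"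
        using card_Int_ge[OF fA, of "bn z \<inter> A" "bn y \<inter> A"] by simp
      then show "m \<le> card (bn z \<inter> (bn y \<inter> A))"
        using blueY[OF z] blueY[OF y] t n_bounds m18 by linarith
    qed auto
  qed
  then show False
    by (intro near_clique_absurd[OF cl B(1) YV subset_refl cY, of "m - 1"])
      (use B(2) cY n_bounds m18 few in auto)
qed

text \<open>A clique vertex of red degree at least \<open>n - 1\<close> has at least
  \<open>n - card A\<close> red neighbours outside \<open>A\<close>, and this is the number of
  leaves to move out. With \<open>P\<close> placed on such vertices, the leaves can be placed
  greedily.\<close>

lemma leaf_attach:
  assumes A: "clique R A" "A \<subseteq> V" and P: "P \<subseteq> W" "P \<inter> leaves = {}"
    "n \<le> card A + (\<Sum>p\<in>P. card (nb p \<inter> leaves))"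
    and G: "G \<subseteq> A" "card P \<le> card G" "\<And>a. a \<in> G \<Longrightarrow> n - 1 \<le> card (rn a)"
  shows False
proof -
  have fA: "finite A" using A(2) by simp
  have fP: "finite P" using P(1) by (rule finite_subW)
  have fG: "finite G" by (rule finite_subset[OF G(1) fA])
  obtain f where f: "f ` P \<subseteq> G" "inj_on f P" using card_le_inj[OF fP fG G(2)] by blast
  have "card (\<Union>p\<in>P. nb p \<inter> leaves) = (\<Sum>p\<in>P. card (nb p \<inter> leaves))"
    by (rule card_UN_disjoint[OF fP]) (use disjoint_leaf_sets in auto)
  then have "n - card A \<le> card (\<Union>p\<in>P. nb p \<inter> leaves)" using P(3) by linarith
  then obtain L where L: "L \<subseteq> (\<Union>p\<in>P. nb p \<inter> leaves)" "card L = n - card A" "finite L"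
    using obtain_subset_with_card_n by metis
  have "\<forall>u\<in>L. \<exists>p. p \<in> P \<and> nb u = {p}"
  proof
    fix u assume "u \<in> L"
    then obtain p where p: "p \<in> P" "u \<in> nb p" "u \<in> leaves" using L(1) by blast
    then have "nb u = {p}" using leaf_nb[OF p(3)] nb_sym[of u p] by simp
    then show "\<exists>p. p \<in> P \<and> nb u = {p}" using p(1) by blast
  qed
  from bchoice[OF this] obtain q where "\<forall>u\<in>L. q u \<in> P \<and> nb u = {q u}" ..
  then have q: "q u \<in> P \<and> nb u = {q u}" if "u \<in> L" for u using that by blast
  have room: "card L \<le> card (rn (f (q u)) - A)" if u: "u \<in> L" for u
  proof -
    let ?a = "f (q u)"
    have a: "?a \<in> A" "n - 1 \<le> card (rn ?a)" using q[OF u] f(1) G(1,3) by blast+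
    have "rn ?a \<inter> A \<subseteq> A - {?a}" using not_self by blast
    then have "card (rn ?a \<inter> A) \<le> card (A - {?a})" using fA by (intro card_mono) auto
    also have "\<dots> = card A - 1" using a(1) by (simp add: card_Diff_singleton)
    finally have "card (rn ?a \<inter> A) \<le> card A - 1" .
    moreover have "card (rn ?a) = card (rn ?a \<inter> A) + card (rn ?a - A)"
      by (metis card_Int_Diff finite_rn)
    moreover have "1 \<le> card A" using a(1) fA by (metis Suc_leI card_gt_0_iff empty_iff One_nat_def)
    ultimately show ?thesis using a(2) L(2) by linarith
  qed
  obtain g where g: "inj_on g L" "\<forall>u\<in>L. g u \<in> rn (f (q u)) - A"
    using greedy_transversal[OF L(3), of "\<lambda>u. rn (f (q u)) - A"] room by auto
  have nL: "nbs L \<subseteq> P" using q by (auto simp: nbs_def)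
  have LP: "L \<inter> P = {}" using L(1) P(2) by blast
  define h where "h u = (if u \<in> L then g u else f u)" for u
  show False
  proof (rule place_outside[OF A, of L h])
    show "L \<subseteq> W" using L(1) leaves_W by blast
    show "n \<le> card A + card L" using L(2) by simp
    show "inj_on h (L \<union> nbs L)"
    proof (rule inj_onI)
      fix u v assume uv: "u \<in> L \<union> nbs L" "v \<in> L \<union> nbs L" "h u = h v"
      have gf: "g a \<noteq> f b" if "a \<in> L" "b \<in> P" for a b
      proof -
        have "g a \<notin> A" "f b \<in> A" using g(2) f(1) G(1) that by blast+
        then show ?thesis by auto
      qed
      show "u = v"
        using uv gf[of u v] gf[of v u] inj_onD[OF g(1), of u v] inj_onD[OF f(2), of u v] nL LP
        by (auto simp: h_def split: if_splits)
    qed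
    show "h ` L \<subseteq> V - A" using g(2) rn_V by (auto simp: h_def)
    show "h ` (nbs L - L) \<subseteq> A" using nL f(1) G(1) by (auto simp: h_def)
    fix u v assume uv: "u \<in> L" "v \<in> nb u"
    then have "v = q u" "v \<notin> L" using q[OF uv(1)] LP by auto
    then show "R (h u) (h v)" using g(2) uv(1) R_sym by (auto simp: h_def mem_rn)
  qed
qed

text \<open>The clique already accounts for \<open>card A - 1\<close> of the at most
  \<open>n - 2\<close> red neighbours.\<close>

lemma red_outside:
  assumes "clique R A" "A \<subseteq> V" "a \<in> A" "card (rn a) + 2 \<le> n" "n + 2 \<le> card A + 2 * m"
  shows "card (rn a - A) + 3 \<le> 2 * m"
proof -
  have "card A = card (rn a \<inter> A) + card (bn a \<inter> A) + 1"
    using split_card_in[of a A] assms by blast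
  moreover have "bn a \<inter> A = {}" using clique_not_blue assms by blast
  moreover have "card (rn a) = card (rn a \<inter> A) + card (rn a - A)"
    by (metis card_Int_Diff finite_rn)
  ultimately show ?thesis using assms(4,5) by auto
qed

text \<open>Suppose \<open>x\<close> has \<open>m\<close> blue neighbours in \<open>C\<close> and
  \<open>3 * m - 3\<close> in \<open>B\<close>. Each of the former is red to at most
  \<open>2 * m - 3\<close> of the latter, hence blue to \<open>m\<close> of them, and
  \<open>no_blue_bipartite\<close> applies.\<close>

lemma blue_to_cliques:
  assumes C: "C \<subseteq> A" "A \<subseteq> V" "B \<subseteq> V - A" "x \<in> V"
    and red: "\<And>a. a \<in> C \<Longrightarrow> card (rn a - A) + 3 \<le> 2 * m"
  shows "card (bn x \<inter> C) + 1 \<le> m \<or> card (bn x \<inter> B) + 4 \<le> 3 * m"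
proof (rule ccontr)
  assume c: "\<not> ?thesis"
  show False
  proof (rule no_blue_bipartite[OF C(4), of "bn x \<inter> C" "bn x \<inter> B"])
    show "(bn x \<inter> C) \<inter> (bn x \<inter> B) = {}" using C by blast
    show "m \<le> card (bn x \<inter> C)" using c by linarith
    fix y assume y: "y \<in> bn x \<inter> C"
    have "card (bn x \<inter> B) = card (rn y \<inter> (bn x \<inter> B)) + card (bn y \<inter> (bn x \<inter> B))"
      by (rule split_card_notin) (use y C bn_V in blast)+
    moreover have "card (rn y \<inter> (bn x \<inter> B)) \<le> card (rn y - A)"
      using C by (intro card_mono) auto
    ultimately show "m \<le> card (bn y \<inter> (bn x \<inter> B))" using red[of y] y c by auto
  qed auto
qed

text \<open>The leaves at \<open>P\<close> cover the deficit \<open>n - card A\<close>, so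
  \<open>card P\<close> clique vertices of red degree at least \<open>n - 1\<close> would allow
  \<open>leaf_attach\<close>.\<close>

lemma leafy_clique_degrees:
  assumes A: "clique R A" "A \<subseteq> V" "n + 2 \<le> card A + 2 * m"
    and P: "P \<subseteq> W" "P \<inter> leaves = {}" "2 * m \<le> (\<Sum>p\<in>P. card (nb p \<inter> leaves)) + 2"
  shows "card {a \<in> A. \<not> card (rn a) + 2 \<le> n} < card P"
proof (rule ccontr)
  assume "\<not> ?thesis"
  then show False
    by (intro leaf_attach[OF A(1,2) P(1,2), of "{a \<in> A. \<not> card (rn a) + 2 \<le> n}"])
      (use A(3) P(3) in auto)
qed

text \<open>Some vertex of the first clique has red degree at most \<open>n - 2\<close>, hence blue
  degree at least \<open>n\<close>. Its blue neighbourhood contains the second clique, and avoids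
  \<open>A\<close> because the vertex is red to the rest of \<open>A\<close>.\<close>

lemma leafy_cliques:
  assumes v: "v \<in> V" "n \<le> card (bn v)"
    and P: "P \<subseteq> W" "P \<inter> leaves = {}" "2 * m \<le> (\<Sum>p\<in>P. card (nb p \<inter> leaves)) + 2"
      "card P + 2 \<le> 2 * m"
  obtains A B where "clique R A" "A \<subseteq> V" "n + 2 \<le> card A + 2 * m"
    "clique R B" "B \<subseteq> V - A" "n + 2 \<le> card B + 2 * m"
    "card A < card {a \<in> A. card (rn a) + 2 \<le> n} + card P"
proof -
  obtain A where A: "A \<subseteq> bn v" "card (bn v) \<le> card A + 2 * (m - 1)" "clique R A"
    using red_clique[OF v(1) subset_refl] by metis
  have AV: "A \<subseteq> V" using A(1) bn_V by blast
  have fA: "finite A" using AV by simp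
  have cA: "n + 2 \<le> card A + 2 * m" using A(2) v(2) m18 by linarith
  let ?C = "{a \<in> A. card (rn a) + 2 \<le> n}"
  have "card A \<le> card (?C \<union> {a \<in> A. \<not> card (rn a) + 2 \<le> n})" using fA by (intro card_mono) auto
  also have "\<dots> \<le> card ?C + card {a \<in> A. \<not> card (rn a) + 2 \<le> n}" by (rule card_Un_le)
  finally have cC: "card A < card ?C + card P"
    using leafy_clique_degrees[OF A(3) AV cA P(1,2,3)] by linarith
  then have "card ?C \<noteq> 0" using P(4) cA n_bounds by linarith
  then have "?C \<noteq> {}" by (metis card.empty)
  then obtain a where a: "a \<in> A" "card (rn a) + 2 \<le> n" by blast
  have aV: "a \<in> V" using a AV by blast
  obtain B where B: "B \<subseteq> bn a" "card (bn a) \<le> card B + 2 * (m - 1)" "clique R B"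
    using red_clique[OF aV subset_refl] by metis
  have "bn a \<inter> A = {}" using clique_not_blue[OF A(3) a(1)] .
  then have "B \<subseteq> V - A" using B(1) bn_V by blast
  moreover have "n + 2 \<le> card B + 2 * m" using B(2) red_degree[OF aV] a(2) m18 by linarith
  ultimately show thesis using that[OF A(3) AV cA B(3)] cC by blast
qed

text \<open>\<open>assign_to_hubs\<close> chooses images in \<open>B\<close> for the leaf parents
  and gives each vertex of \<open>X\<close> a red parent without exceeding leaf counts. Then
  \<open>\<phi>\<close> selects a private leaf of that parent for each vertex of \<open>X\<close>,
  and these leaves move out of \<open>A\<close>.\<close>

lemma hubs_absurd:
  assumes A: "clique R A" "A \<subseteq> V" "B \<subseteq> A" and X: "X \<subseteq> V - A" "n \<le> card A + card X"
    and a: "\<And>x. x \<in> X \<Longrightarrow> card (bn x \<inter> B) \<le> \<alpha>"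
    and hubs: "\<And>p. p \<in> W \<Longrightarrow> card (nb p \<inter> leaves) \<le> c"
    and e: "card X < 4 ^ e" "card X + e * c \<le> card leaves"
    and room: "4 * \<alpha> + card (nbs leaves) \<le> card B"
  shows False
proof -
  let ?P = "nbs leaves" and ?l = "\<lambda>p. card (nb p \<inter> leaves)"
  have PW: "?P \<subseteq> W" using nb_W by (auto simp: nbs_def)
  have fX: "finite X" using X(1) finV by (meson Diff_subset finite_subset)
  have "leaves \<subseteq> (\<Union>p\<in>?P. nb p \<inter> leaves)"
  proof
    fix u assume u: "u \<in> leaves"
    then have "u \<in> W" using leaves_W by blast
    then have "nb u \<noteq> {}" using deg_pos[of u] by (auto simp: deg_def)
    then obtain p where "p \<in> nb u" by blast
    then show "u \<in> (\<Union>p\<in>?P. nb p \<inter> leaves)" using u nb_sym[of u p] by (auto simp: nbs_def)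
  qed
  then have "card leaves \<le> card (\<Union>p\<in>?P. nb p \<inter> leaves)" by (rule card_mono[rotated]) (simp add: finite_nbs)
  also have "\<dots> \<le> (\<Sum>p\<in>?P. ?l p)" by (rule card_UN_le[OF finite_nbs])
  finally have sl: "card leaves \<le> (\<Sum>p\<in>?P. ?l p)" .
  have "\<exists>b h. inj_on b ?P \<and> b ` ?P \<subseteq> B \<and> (\<forall>x\<in>X. h x \<in> ?P \<and> R x (b (h x))) \<and>
      (\<forall>p\<in>?P. card {x \<in> X. h x = p} \<le> ?l p)"
    by (rule assign_to_hubs[where c = c, OF finite_nbs _ _ _ a _ e(1) _ room])
      (use A X PW hubs sl e(2) in auto)
  then obtain b h where bh: "inj_on b ?P" "b ` ?P \<subseteq> B" "\<forall>x\<in>X. h x \<in> ?P \<and> R x (b (h x))"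
    "\<forall>p\<in>?P. card {x \<in> X. h x = p} \<le> ?l p" by (elim exE conjE)
  have "\<forall>p\<in>?P. \<exists>j. j ` {x \<in> X. h x = p} \<subseteq> nb p \<inter> leaves \<and> inj_on j {x \<in> X. h x = p}"
  proof
    fix p assume p: "p \<in> ?P"
    show "\<exists>j. j ` {x \<in> X. h x = p} \<subseteq> nb p \<inter> leaves \<and> inj_on j {x \<in> X. h x = p}"
      by (rule card_le_inj) (use fX bh(4) p in auto)
  qed
  from bchoice[OF this] obtain j where
    j: "\<forall>p\<in>?P. j p ` {x \<in> X. h x = p} \<subseteq> nb p \<inter> leaves \<and> inj_on (j p) {x \<in> X. h x = p}" ..
  define \<phi> where "\<phi> x = j (h x) x" for x
  have \<phi>: "\<phi> x \<in> leaves" "nb (\<phi> x) = {h x}" if x: "x \<in> X" for x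
  proof -
    have "\<phi> x \<in> nb (h x) \<inter> leaves" using j bh(3) x by (auto simp: \<phi>_def)
    then show "\<phi> x \<in> leaves" "nb (\<phi> x) = {h x}" using leaf_nb nb_sym by blast+
  qed
  have inj\<phi>: "inj_on \<phi> X"
  proof (rule inj_onI)
    fix x y assume xy: "x \<in> X" "y \<in> X" "\<phi> x = \<phi> y"
    then have "h x = h y" using \<phi>(2)[of x] \<phi>(2)[of y] by simp
    then show "x = y" using xy j bh(3) unfolding \<phi>_def by (metis (mono_tags, lifting) inj_onD mem_Collect_eq)
  qed
  define g where "g u = (if u \<in> \<phi> ` X then the_inv_into X \<phi> u else b u)" for u
  have g\<phi>: "g (\<phi> x) = x" if "x \<in> X" for x
    using that by (simp add: g_def the_inv_into_f_f[OF inj\<phi>])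
  have nL: "nbs (\<phi> ` X) \<subseteq> ?P" using \<phi> bh(3) by (auto simp: nbs_def)
  have disj: "\<phi> ` X \<inter> ?P = {}" using \<phi>(1) leaf_parent_not_leaf by (auto simp: nbs_def)
  have gp: "g p = b p" if "p \<in> ?P" for p using that disj by (auto simp: g_def)
  show False
  proof (rule place_outside[OF A(1,2), of "\<phi> ` X" g])
    show "\<phi> ` X \<subseteq> W" using \<phi>(1) leaves_W by blast
    show "n \<le> card A + card (\<phi> ` X)" using X(2) card_image[OF inj\<phi>] by simp
    show "inj_on g (\<phi> ` X \<union> nbs (\<phi> ` X))"
    proof (rule inj_onI)
      fix u v assume uv: "u \<in> \<phi> ` X \<union> nbs (\<phi> ` X)" "v \<in> \<phi> ` X \<union> nbs (\<phi> ` X)" "g u = g v"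
      have gX: "g u \<in> X" if "u \<in> \<phi> ` X" for u using that g\<phi> by auto
      have gB: "g p \<in> A" if "p \<in> ?P" for p using gp[OF that] bh(2) A(3) that by blast
      consider "u \<in> \<phi> ` X" "v \<in> \<phi> ` X" | "u \<in> \<phi> ` X" "v \<in> ?P" | "u \<in> ?P" "v \<in> \<phi> ` X" | "u \<in> ?P" "v \<in> ?P"
        using uv nL by blast
      then show "u = v"
      proof cases
        case 1
        then show ?thesis using uv(3) g\<phi> by auto
      next
        case 2
        then show ?thesis using gX[of u] gB[of v] uv(3) X(1) by auto
      next
        case 3
        then show ?thesis using gX[of v] gB[of u] uv(3) X(1) by auto
      next
        case 4
        then show ?thesis using uv(3) gp inj_onD[OF bh(1), of u v] by simp
      qed
    qed
    show "g ` (\<phi> ` X) \<subseteq> V - A" using g\<phi> X(1) by auto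
    show "g ` (nbs (\<phi> ` X) - \<phi> ` X) \<subseteq> A"
    proof
      fix z assume "z \<in> g ` (nbs (\<phi> ` X) - \<phi> ` X)"
      then obtain p where "p \<in> ?P" "z = g p" using nL by blast
      then show "z \<in> A" using gp[of p] bh(2) A(3) by auto
    qed
    fix u w assume uw: "u \<in> \<phi> ` X" "w \<in> nb u"
    then obtain x where x: "x \<in> X" "u = \<phi> x" by blast
    then have "w = h x" using \<phi>(2)[OF x(1)] uw(2) by simp
    then show "R (g u) (g w)" using bh(3) x g\<phi>[OF x(1)] gp[of w] by auto
  qed
qed

text \<open>There are three sources for the \<open>n - card A\<close> vertices sent to
  \<open>A' - A\<close>. Unless leaves abound, the sparse set of \<open>near_clique_absurd\<close>
  suffices. With many leaf parents, one leaf of each is taken, so that no vertex is adjacent to two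
  of them. With few parents, leaves are assigned by \<open>hubs_absurd\<close>.\<close>

lemma large_side_absurd:
  assumes A: "clique R A" "A \<subseteq> A'" "A' \<subseteq> V" "C \<subseteq> A" and big: "n \<le> card A'"
    and cA: "n + 2 \<le> card A + 2 * m" "card A + 3 \<le> card C + 2 * m"
    and a: "\<And>x. x \<in> A' \<Longrightarrow> card (bn x \<inter> C) + 4 \<le> 3 * m"
    and hubs: "\<And>p. p \<in> W \<Longrightarrow> card (nb p \<inter> leaves) + 3 \<le> 2 * m"
  shows False
proof (cases "card leaves + 4 * m \<le> n + 3")
  case True
  have "card (bn x \<inter> C) \<le> 3 * m - 4" if "x \<in> A'" for x using a[OF that] by linarith
  moreover have "3 * (3 * m - 4) + 2 * (n - card A) \<le> card C" using cA n_bounds m18 by linarith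
  moreover have "2 * (n - card A) + card leaves + 1 \<le> n" using cA True n_bounds m18 by linarith
  ultimately show False using near_clique_absurd[OF A big, of "3 * m - 4"] by blast
next
  case False
  have AV: "A \<subseteq> V" using A by blast
  have fA': "finite (A' - A)" using A(3) by simp
  have "n - card A \<le> card (A' - A)" using big card_Diff_subset[OF finite_sub[OF AV] A(2)] by linarith
  then obtain X where X: "X \<subseteq> A' - A" "card X = n - card A" using obtain_subset_with_card_n by metis
  have XV: "X \<subseteq> V - A" using X(1) A by blast
  have aX: "card (bn x \<inter> C) \<le> 3 * m - 4" if "x \<in> X" for x
    using a[of x] that X(1) by fastforce
  show False
  proof (cases "2 * m \<le> card (nbs leaves) + 2")
    case True
    have "\<exists>u. u \<in> leaves \<and> nb u = {p}" if p: "p \<in> nbs leaves" for p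
    proof -
      obtain u where u: "u \<in> leaves" "p \<in> nb u" using p by (auto simp: nbs_def)
      then show ?thesis using leaf_nb[OF u] by blast
    qed
    then have "\<forall>p\<in>nbs leaves. \<exists>u. u \<in> leaves \<and> nb u = {p}" by blast
    from bchoice[OF this] obtain q where q: "\<forall>p\<in>nbs leaves. q p \<in> leaves \<and> nb (q p) = {p}" ..
    have "n - card A \<le> card (nbs leaves)" using True cA by linarith
    then obtain P where P: "P \<subseteq> nbs leaves" "card P = n - card A" using obtain_subset_with_card_n by metis
    have qP: "q p \<in> leaves" "nb (q p) = {p}" if "p \<in> P" for p using q P(1) that by blast+
    have inj: "inj_on q P"
    proof (rule inj_onI)
      fix x y assume "x \<in> P" "y \<in> P" "q x = q y"
      then have "{x} = {y}" using qP(2) by metis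
      then show "x = y" by simp
    qed
    have cq: "card (q ` P) = n - card A" using card_image[OF inj] P(2) by simp
    have "card (nb w \<inter> q ` P) \<le> 1" for w
    proof -
      have "nb w \<inter> q ` P \<subseteq> {q w}"
      proof
        fix u assume "u \<in> nb w \<inter> q ` P"
        then obtain p where p: "p \<in> P" "u = q p" "w \<in> nb u" using nb_sym by blast
        then have "w = p" using qP(2)[OF p(1)] by simp
        then show "u \<in> {q w}" using p(2) by simp
      qed
      then have "card (nb w \<inter> q ` P) \<le> card {q w}" by (rule card_mono[rotated]) simp
      then show ?thesis by simp
    qed
    moreover have "q ` P \<subseteq> W" using qP(1) leaves_W by blast
    moreover have "deg u \<le> 2" if "u \<in> q ` P" for u using that qP(1) by (auto simp: leaves_def)
    moreover have "v \<notin> nb u" if "u \<in> q ` P" "v \<in> q ` P" for u v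
      using that qP(1) leaf_parent_not_leaf by blast
    moreover have "1 * (3 * m - 4) + 2 * card (q ` P) \<le> card C"
      unfolding cq using cA n_bounds m18 by linarith
    moreover have "n \<le> card A + card (q ` P)" unfolding cq by linarith
    ultimately show False
      using place_sparse[OF A(1) AV A(4), of "q ` P" 1 X "3 * m - 4"] XV aX cq X(2) by auto
  next
    case False
    have hubs': "card (nb p \<inter> leaves) \<le> 2 * m - 3" if "p \<in> W" for p using hubs[OF that] by linarith
    \<comment> \<open>A compromise: \<open>4 ^ e\<close> must exceed \<open>card X\<close>, which is
      at most \<open>2 * m - 2\<close>, while \<open>card X + e * (2 * m - 3)\<close> must not
      exceed the number of leaves, which is known to be above \<open>n + 3 - 4 * m\<close>.\<close>
    define e where "e = (m - 6) div 2"
    obtain d where d: "m = 18 + d" using m18 le_Suc_ex by blast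
    have e1: "2 * e \<le> 12 + d" "11 + d \<le> 2 * e" unfolding e_def d by linarith+
    have cX: "card X \<le> 34 + 2 * d" using X(2) cA d by linarith
    have "d < 2 ^ d" by (rule less_exp)
    then have "34 + 2 * d < 2048 * 2 ^ d" by linarith
    also have "(2048 :: nat) * 2 ^ d = 2 ^ (11 + d)" by (simp add: power_add)
    also have "\<dots> \<le> 2 ^ (2 * e)" using e1(2) by (intro power_increasing) auto
    also have "\<dots> = 4 ^ e" by (simp add: power_mult)
    finally have c4: "card X < 4 ^ e" using cX by linarith
    have "2 * (e * (2 * m - 3)) \<le> (12 + d) * (33 + 2 * d)"
    proof -
      have "2 * (e * (2 * m - 3)) = (2 * e) * (33 + 2 * d)" using d by simp
      also have "\<dots> \<le> (12 + d) * (33 + 2 * d)" using e1(1) by (rule mult_le_mono1)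
      finally show ?thesis .
    qed
    moreover have "(12 + d) * (33 + 2 * d) = 396 + 57 * d + 2 * (d * d)" by (simp add: algebra_simps)
    moreover have "m * m = 324 + 36 * d + d * d" unfolding d by (simp add: algebra_simps)
    ultimately have "card X + e * (2 * m - 3) \<le> card leaves"
      using cX nm d \<open>\<not> card leaves + 4 * m \<le> n + 3\<close> by linarith
    moreover have "4 * (3 * m - 4) + card (nbs leaves) \<le> card C"
      using False cA n_bounds m18 by linarith
    moreover have "n \<le> card A + card X" using X(2) by simp
    ultimately show False
      using hubs_absurd[OF A(1) AV A(4) XV _ aX hubs' c4] by blast
  qed
qed

text \<open>The parents of \<open>2 * m - 2\<close> leaves serve as \<open>P\<close> in
  \<open>leafy_cliques\<close>; at most \<open>2 * m - 3\<close> vertices of \<open>A\<close> can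
  then have large red degree, and \<open>?C\<close> is the rest. Every vertex has few blue
  neighbours in \<open>?C\<close> or in \<open>B\<close>, so one of these two classes has
  \<open>n\<close> vertices.\<close>

lemma dispersed_leaves_absurd:
  assumes v: "v \<in> V" "n \<le> card (bn v)" and many: "2 * m \<le> card leaves + 2"
    and hubs: "\<And>p. p \<in> W \<Longrightarrow> card (nb p \<inter> leaves) + 3 \<le> 2 * m"
  shows False
proof -
  have "2 * m - 2 \<le> card leaves" using many by linarith
  then obtain L where L: "L \<subseteq> leaves" "card L = 2 * m - 2" "finite L" using obtain_subset_with_card_n by metis
  have "deg u \<le> 1" if "u \<in> L" for u using that L(1) by (auto simp: leaves_def)
  then have cP: "card (nbs L) + 2 \<le> 2 * m" using card_nbs_le[OF L(3), of 1] L(2) m18 by simp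
  have "L \<subseteq> (\<Union>p\<in>nbs L. nb p \<inter> leaves)"
  proof
    fix u assume u: "u \<in> L"
    then have "u \<in> W" "u \<in> leaves" using L(1) leaves_W by blast+
    then have "nb u \<noteq> {}" using deg_pos[of u] by (auto simp: deg_def)
    then obtain p where "p \<in> nb u" by blast
    then show "u \<in> (\<Union>p\<in>nbs L. nb p \<inter> leaves)" using u \<open>u \<in> leaves\<close> nb_sym[of u p] by (auto simp: nbs_def)
  qed
  then have "card L \<le> card (\<Union>p\<in>nbs L. nb p \<inter> leaves)" by (rule card_mono[rotated]) (simp add: finite_nbs)
  also have "\<dots> \<le> (\<Sum>p\<in>nbs L. card (nb p \<inter> leaves))" by (rule card_UN_le[OF finite_nbs])
  finally have sP: "2 * m \<le> (\<Sum>p\<in>nbs L. card (nb p \<inter> leaves)) + 2" using L(2) by linarith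
  have PW: "nbs L \<subseteq> W" using nb_W by (auto simp: nbs_def)
  have Pl: "nbs L \<inter> leaves = {}" using L(1) leaf_parent_not_leaf by (auto simp: nbs_def)
  obtain A B where AB: "clique R A" "A \<subseteq> V" "n + 2 \<le> card A + 2 * m"
    "clique R B" "B \<subseteq> V - A" "n + 2 \<le> card B + 2 * m"
    "card A < card {a \<in> A. card (rn a) + 2 \<le> n} + card (nbs L)"
    by (rule leafy_cliques[OF v PW Pl sP cP])
  let ?C = "{a \<in> A. card (rn a) + 2 \<le> n}"
  have CA: "?C \<subseteq> A" by blast
  have BV: "B \<subseteq> V" using AB(5) by blast
  have red: "card (rn a - A) + 3 \<le> 2 * m" if "a \<in> ?C" for a
    using red_outside[OF AB(1,2) _ _ AB(3)] that by blast
  let ?A' = "{x \<in> V. card (bn x \<inter> ?C) + 4 \<le> 3 * m}" and ?B' = "{x \<in> V. card (bn x \<inter> B) + 4 \<le> 3 * m}"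
  have "x \<in> ?A' \<union> ?B'" if x: "x \<in> V" for x
    using blue_to_cliques[OF CA AB(2,5) x red] x m18 by auto
  then have "card V \<le> card (?A' \<union> ?B')" using finV by (intro card_mono) auto
  also have "\<dots> \<le> card ?A' + card ?B'" by (rule card_Un_le)
  finally consider "n \<le> card ?A'" | "n \<le> card ?B'" using cardV' by linarith
  then show False
  proof cases
    case 1
    have "A \<subseteq> ?A'"
    proof
      fix x assume x: "x \<in> A"
      then have "bn x \<inter> ?C = {}" using clique_not_blue[OF AB(1) x] by blast
      then show "x \<in> ?A'" using x AB(2) m18 by auto
    qed
    moreover have "card A + 3 \<le> card ?C + 2 * m" using AB(7) cP by linarith
    ultimately show False using large_side_absurd[OF AB(1) _ _ CA 1 AB(3) _ _ hubs] by blast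
  next
    case 2
    have "B \<subseteq> ?B'"
    proof
      fix x assume x: "x \<in> B"
      then have "bn x \<inter> B = {}" using clique_not_blue[OF AB(4) x] by blast
      then show "x \<in> ?B'" using x BV m18 by auto
    qed
    moreover have "card B + 3 \<le> card B + 2 * m" using m18 by linarith
    ultimately show False using large_side_absurd[OF AB(4) _ _ subset_refl 2 AB(6) _ _ hubs] by blast
  qed
qed

end

section \<open>A hub with many leaves\<close>

lemma sum_verts:
  assumes "matching r M"
  shows "(\<Sum>y\<in>verts M. f y) = (\<Sum>p\<in>M. f (fst p) + (f (snd p) :: nat))"
proof -
  have M: "finite M" "inj_on fst M" "inj_on snd M" "fst ` M \<inter> snd ` M = {}"
    using assms by (auto simp: matching_def)
  then have "(\<Sum>y\<in>verts M. f y) = (\<Sum>y\<in>fst ` M. f y) + (\<Sum>y\<in>snd ` M. f y)"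
    unfolding verts_def by (intro sum.union_disjoint) auto
  then show ?thesis using M by (simp add: sum.reindex sum.distrib)
qed

lemma verts_remove:
  assumes "matching r M" "p \<in> M"
  shows "verts (M - {p}) = verts M - {fst p, snd p}"
proof -
  have M: "inj_on fst M" "inj_on snd M" "fst ` M \<inter> snd ` M = {}"
    using assms(1) by (auto simp: matching_def)
  have "fst ` (M - {p}) = fst ` M - {fst p}" "snd ` (M - {p}) = snd ` M - {snd p}"
    using assms(2) by (simp_all add: inj_on_image_set_diff[OF M(1)] inj_on_image_set_diff[OF M(2)])
  moreover have "fst p \<notin> snd ` M" "snd p \<notin> fst ` M" using M(3) assms(2) by auto
  ultimately show ?thesis by (auto simp: verts_def)
qed

section \<open>Maximum blue matchings of small degree sum\<close>

context host
begin

lemma matching_swap: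
  assumes M: "matching blue M" "p \<in> M" and xy: "p = (x, y) \<or> p = (y, x)"
    and u: "u \<notin> verts M" "blue x u"
  shows "matching blue (insert (x, u) (M - {p}))" "card (insert (x, u) (M - {p})) = card M"
    "verts (insert (x, u) (M - {p})) = insert u (verts M - {y})"
proof -
  have fM: "finite M" using M(1) by (simp add: matching_def)
  have xyM: "x \<in> verts M" "y \<in> verts M" using M(2) xy by (force simp: verts_def)+
  have xney: "x \<noteq> y" using M xy by (auto simp: matching_def blue_def)
  have m': "matching blue (M - {p})" by (rule matching_subset[OF M(1)]) blast
  have v: "verts (M - {p}) = verts M - {x, y}"
    unfolding verts_remove[OF M] using xy by (elim disjE) (simp_all add: insert_commute)
  have "x \<noteq> u" using u xyM by blast
  then show "matching blue (insert (x, u) (M - {p}))"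
    using m' v u by (intro matching_insert) auto
  have "(x, u) \<notin> M" using u(1) by (force simp: verts_def)
  then show "card (insert (x, u) (M - {p})) = card M"
    using card_Suc_Diff1[OF fM M(2)] fM by simp
  show "verts (insert (x, u) (M - {p})) = insert u (verts M - {y})"
    using v xyM(1) xney by (auto simp: verts_insert)
qed

text \<open>The augmenting path is \<open>u\<close>, \<open>x\<close>, \<open>y\<close>,
  \<open>u'\<close>: a swap at \<open>x\<close> frees \<open>y\<close>, which is then matched with
  \<open>u'\<close>.\<close>

lemma matching_augment:
  assumes M: "matching blue M" "(x, y) \<in> M"
    and u: "u \<notin> verts M" "u' \<notin> verts M" "u \<noteq> u'" "blue x u" "blue y u'"
  shows "\<exists>N. matching blue N \<and> card N = Suc (card M) \<and> verts N = insert u (insert u' (verts M))"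
proof -
  let ?M = "insert (x, u) (M - {(x, y)})"
  have xyM: "x \<in> verts M" "y \<in> verts M" using M(2) by (force simp: verts_def)+
  have sw: "matching blue ?M" "card ?M = card M" "verts ?M = insert u (verts M - {y})"
    using matching_swap[OF M _ u(1,4)] by blast+
  have ne: "y \<noteq> u'" "y \<noteq> u" using u(1,2) xyM by blast+
  have n: "y \<notin> verts ?M" "u' \<notin> verts ?M" unfolding sw(3) using u ne by auto
  then have "matching blue (insert (y, u') ?M)" using matching_insert[OF sw(1) u(5) ne(1)] by blast
  moreover have "card (insert (y, u') ?M) = Suc (card M)"
  proof -
    have "(y, u') \<notin> ?M" using n(1) by (force simp: verts_def)
    moreover have "finite ?M" using sw(1) by (simp only: matching_def)
    ultimately have "card (insert (y, u') ?M) = Suc (card ?M)" by (rule card_insert_disjoint[rotated])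
    then show ?thesis by (simp only: sw(2))
  qed
  moreover have "verts (insert (y, u') ?M) = insert u (insert u' (verts M))"
    using sw(3) xyM by (auto simp: verts_insert)
  ultimately show ?thesis by blast
qed

text \<open>Gallai-style counting for a maximum matching M whose end points have least possible degree
  sum. Every edge of M sends at most m - 2 edges to the uncovered set, and an edge that meets an
  uncovered vertex of degree one has an end point of degree one.\<close>
lemma light_matching:
  assumes U: "U \<subseteq> V" "m * m + 1 \<le> card U + m" and m18: "18 \<le> m"
    and deg: "\<And>u. u \<in> U \<Longrightarrow> 1 \<le> card (bn u \<inter> U) \<and> card (bn u \<inter> U) + 1 \<le> m"
    and small: "\<And>N. matching blue N \<Longrightarrow> verts N \<subseteq> U \<Longrightarrow> card N \<le> m"
  obtains M where "matching blue M" "verts M \<subseteq> U" "card M = m"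
    "(\<Sum>y\<in>verts M. card (bn y \<inter> U) - 1) + m + 1 \<le> m * m"
proof -
  define g where "g u = card (bn u \<inter> U)" for u
  have g: "1 \<le> g u" "g u + 1 \<le> m" if "u \<in> U" for u using deg[OF that] by (auto simp: g_def)
  have fU: "finite U" using U(1) finV finite_subset by blast
  obtain M0 where M0: "matching blue M0" "verts M0 \<subseteq> U"
    "\<And>N. matching blue N \<Longrightarrow> verts N \<subseteq> U \<Longrightarrow> card N \<le> card M0"
    using max_matching[OF fU, of blue] by blast
  define \<nu> where "\<nu> = card M0"
  let ?P = "\<lambda>M. matching blue M \<and> verts M \<subseteq> U \<and> card M = \<nu>"
  have "\<exists>M. ?P M \<and> (\<forall>N. ?P N \<longrightarrow> (\<Sum>y\<in>verts M. g y) \<le> (\<Sum>y\<in>verts N. g y))"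
    by (rule ex_has_least_nat[of ?P M0]) (use M0 \<nu>_def in simp)
  then obtain M where M: "matching blue M" "verts M \<subseteq> U" "card M = \<nu>"
    and least: "\<And>N. matching blue N \<Longrightarrow> verts N \<subseteq> U \<Longrightarrow> card N = \<nu> \<Longrightarrow>
      (\<Sum>y\<in>verts M. g y) \<le> (\<Sum>y\<in>verts N. g y)" by auto
  have max: "card N \<le> card M" if "matching blue N" "verts N \<subseteq> U" for N
    using M0(3)[OF that] M(3) \<nu>_def by simp
  have fM: "finite M" using M(1) by (simp add: matching_def)
  have fv: "finite (verts M)" by (rule finite_verts[OF M(1)])
  define F where "F = U - verts M"
  have fF: "finite F" using fU by (simp add: F_def)
  have inM: "fst p \<in> verts M" "snd p \<in> verts M" "fst p \<in> U" "snd p \<in> U" "blue (fst p) (snd p)"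
    if "p \<in> M" for p using that M by (auto simp: verts_def matching_def)
  have bnF: "bn u \<inter> U = bn u \<inter> verts M" if u: "u \<in> F" for u
  proof -
    have "v \<in> verts M" if "v \<in> bn u \<inter> U" for v
    proof (rule ccontr)
      assume "v \<notin> verts M"
      then show False
        using matching_free_rest[OF M(1,2) max, of u v] u that not_self by (auto simp: F_def mem_bn)
    qed
    then show ?thesis using M(2) by blast
  qed
  define N where "N p = (bn (fst p) \<union> bn (snd p)) \<inter> F" for p
  have fN: "finite (N p)" for p using fF by (simp add: N_def)
  define e where "e p = card (bn (fst p) \<inter> F) + card (bn (snd p) \<inter> F)" for p
  have Ne: "card (N p) \<le> e p" for p
    unfolding N_def e_def Int_Un_distrib2 by (rule card_Un_le)
  have T: "(\<Sum>u\<in>F. g u) = (\<Sum>p\<in>M. e p)"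
  proof -
    have "(\<Sum>u\<in>F. g u) = (\<Sum>u\<in>F. card (bn u \<inter> verts M))"
      by (rule sum.cong) (simp_all add: g_def bnF)
    also have "\<dots> = (\<Sum>y\<in>verts M. card (bn y \<inter> F))" by (rule blue_double_count[OF fF fv])
    finally show ?thesis by (simp add: sum_verts[OF M(1)] e_def)
  qed
  \<comment> \<open>Exchanging \<open>y\<close> for \<open>u\<close> gives another maximum matching,
    whose degree sum cannot be smaller.\<close>
  have swap: "g y \<le> g u" if p: "p \<in> M" "p = (x, y) \<or> p = (y, x)" "u \<in> F" "blue x u" for p x y u
  proof -
    have u: "u \<notin> verts M" "u \<in> U" using p(3) by (auto simp: F_def)
    have y: "y \<in> verts M" using inM[OF p(1)] p(2) by auto
    let ?M = "insert (x, u) (M - {p})"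
    have sw: "matching blue ?M" "card ?M = card M" "verts ?M = insert u (verts M - {y})"
      using matching_swap[OF M(1) p(1,2) u(1) p(4)] by blast+
    then have "(\<Sum>y\<in>verts M. g y) \<le> (\<Sum>y\<in>insert u (verts M - {y}). g y)"
      using least[of ?M] M(2,3) u(2) by auto
    also have "\<dots> = g u + (\<Sum>y\<in>verts M - {y}. g y)" using fv u(1) by simp
    finally show ?thesis using sum.remove[OF fv y, of g] by linarith
  qed
  \<comment> \<open>If both ends see \<open>F\<close>, they see only one common vertex there, since
    otherwise the matching could be augmented. If only one does, its partner already takes one of
    its at most \<open>m - 1\<close> neighbours in \<open>U\<close>.\<close>
  have em: "e p + 2 \<le> m" if p: "p \<in> M" for p
  proof (cases "bn (fst p) \<inter> F = {} \<or> bn (snd p) \<inter> F = {}")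
    case True
    have "card (bn x \<inter> F) + 2 \<le> m" if x: "(x = fst p \<and> y = snd p) \<or> (x = snd p \<and> y = fst p)" for x y
    proof -
      have "y \<in> bn x \<inter> U" "y \<notin> F" "x \<in> U" using inM[OF p] x blue_sym by (auto simp: mem_bn F_def)
      then have "insert y (bn x \<inter> F) \<subseteq> bn x \<inter> U" "y \<notin> bn x \<inter> F" by (auto simp: F_def)
      then have "card (insert y (bn x \<inter> F)) \<le> g x" unfolding g_def by (intro card_mono) auto
      then show ?thesis using g(2)[OF \<open>x \<in> U\<close>] \<open>y \<notin> bn x \<inter> F\<close> by simp
    qed
    from this[of "fst p" "snd p"] this[of "snd p" "fst p"] show ?thesis using True by (auto simp: e_def)
  next
    case False
    then obtain a b where ab: "a \<in> bn (fst p) \<inter> F" "b \<in> bn (snd p) \<inter> F" by blast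
    have same: "u = u'" if u: "u \<in> bn (fst p) \<inter> F" "u' \<in> bn (snd p) \<inter> F" for u u'
    proof (rule ccontr)
      assume "u \<noteq> u'"
      then obtain N' where N': "matching blue N'" "card N' = Suc (card M)"
        "verts N' = insert u (insert u' (verts M))"
        using matching_augment[OF M(1), of "fst p" "snd p" u u'] p u by (auto simp: F_def mem_bn)
      have "verts N' \<subseteq> U" using N'(3) M(2) u by (auto simp: F_def)
      then show False using max[OF N'(1)] N'(2) by simp
    qed
    have "bn (fst p) \<inter> F \<subseteq> {b}" "bn (snd p) \<inter> F \<subseteq> {a}" using same ab by blast+
    then have "card (bn (fst p) \<inter> F) \<le> card {b}" "card (bn (snd p) \<inter> F) \<le> card {a}"
      by (intro card_mono; simp)+
    then show ?thesis using m18 by (simp add: e_def)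
  qed
  have cF: "card U = 2 * \<nu> + card F"
    using card_Diff_subset[OF fv M(2)] card_mono[OF fU M(2)] card_verts[OF M(1)] M(3) by (simp add: F_def)
  have F1: "card F \<le> (\<Sum>u\<in>F. g u)"
  proof -
    have "(\<Sum>u\<in>F. 1) \<le> (\<Sum>u\<in>F. g u)" by (rule sum_mono) (use g(1) in \<open>auto simp: F_def\<close>)
    then show ?thesis by simp
  qed
  have em': "(\<Sum>p\<in>M. e p) \<le> \<nu> * (m - 2)"
    using sum_bounded_above[of M e "m - 2"] em M(3) by fastforce
  obtain d where d: "m = 18 + d" using m18 le_Suc_ex by blast
  have mm: "m * m = 324 + 36 * d + d * d" unfolding d by (simp add: algebra_simps)
  \<comment> \<open>Every uncovered vertex has a neighbour, so
    \<open>card F \<le> \<nu> * (m - 2)\<close> and \<open>card U \<le> \<nu> * m\<close>; with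
    \<open>\<nu> < m\<close> this is at most \<open>m * m - m\<close>, below the assumed size of
    \<open>U\<close>.\<close>
  have \<nu>: "\<nu> = m"
  proof (rule ccontr)
    assume "\<nu> \<noteq> m"
    then have "\<nu> \<le> m - 1" using small[OF M(1,2)] M(3) by linarith
    then have "\<nu> * m \<le> (m - 1) * m" by (rule mult_le_mono1)
    moreover have "card U \<le> 2 * \<nu> + \<nu> * (m - 2)" using cF F1 T em' by linarith
    moreover have "2 * \<nu> + \<nu> * (m - 2) = \<nu> * m" using d by (simp add: algebra_simps)
    moreover have "(m - 1) * m = 306 + 35 * d + d * d" using d by (simp add: algebra_simps)
    ultimately show False using U(2) mm d by linarith
  qed
  have F0: "271 + 33 * d + d * d \<le> card F" using cF U(2) mm d \<nu> by linarith
  have Tm: "(\<Sum>u\<in>F. g u) \<le> 288 + 34 * d + d * d"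
  proof -
    have "\<nu> * (m - 2) = 288 + 34 * d + d * d" using \<nu> d by (simp add: algebra_simps)
    then show ?thesis using T em' by simp
  qed
  define w where "w p = (g (fst p) - 1) + (g (snd p) - 1)" for p
  define G where "G = {p \<in> M. \<exists>u\<in>N p. g u = 1}"
  define B where "B = M - G"
  have fG: "finite G" "finite B" using fM by (simp_all add: G_def B_def)
  have GB: "card G + card B = m" using card_Diff_subset[OF fG(1), of M] card_mono[OF fM, of G] M(3) \<nu>
    by (auto simp: G_def B_def)
  have light: "w p \<le> g u - 1 + (m - 2)" if p: "p \<in> M" "u \<in> N p" for p u
  proof -
    have "blue (fst p) u \<or> blue (snd p) u" "u \<in> F" using p(2) by (auto simp: N_def mem_bn)
    then have "g (snd p) \<le> g u \<or> g (fst p) \<le> g u"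
      using swap[OF p(1), of "fst p" "snd p" u] swap[OF p(1), of "snd p" "fst p" u] by auto
    then show ?thesis using g(2)[of "fst p"] g(2)[of "snd p"] inM[OF p(1)] by (auto simp: w_def)
  qed
  have wG: "w p \<le> m - 2" if "p \<in> G" for p using that light by (fastforce simp: G_def)
  have wM: "w p \<le> 2 * (m - 2)" if "p \<in> M" for p
    using g(2)[of "fst p"] g(2)[of "snd p"] inM[OF that] by (auto simp: w_def)
  have NG: "card (\<Union>p\<in>G. N p) \<le> card G * (m - 2)"
  proof -
    have "card (\<Union>p\<in>G. N p) \<le> (\<Sum>p\<in>G. card (N p))" by (rule card_UN_le[OF fG(1)])
    also have "\<dots> \<le> (\<Sum>p\<in>G. m - 2)"
    proof (rule sum_mono)
      fix p assume "p \<in> G"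
      then show "card (N p) \<le> m - 2" using em[of p] Ne[of p] by (auto simp: G_def)
    qed
    finally show ?thesis by simp
  qed
  have covered: "\<exists>p\<in>M. u \<in> N p" if u: "u \<in> F" for u
  proof -
    have "bn u \<inter> verts M \<noteq> {}" using g(1)[of u] u bnF[OF u] by (auto simp: g_def F_def)
    then obtain y where y: "y \<in> verts M" "u \<in> bn y" using bn_sym by blast
    then obtain p where "p \<in> M" "y = fst p \<or> y = snd p" by (auto simp: verts_def)
    then show ?thesis using y(2) u by (auto simp: N_def)
  qed
  \<comment> \<open>Uncovered vertices of degree one are all neighbours of edges in
    \<open>G\<close>; the others count at least twice in the degree sum.\<close>
  have low: "2 * card F \<le> card (\<Union>p\<in>G. N p) + (\<Sum>u\<in>F. g u)"
  proof -
    let ?F1 = "{u \<in> F. g u = 1}"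
    have "?F1 \<subseteq> (\<Union>p\<in>G. N p)"
    proof
      fix u assume u: "u \<in> ?F1"
      then obtain p where p: "p \<in> M" "u \<in> N p" using covered by blast
      then have "p \<in> G" using u unfolding G_def by blast
      then show "u \<in> (\<Union>p\<in>G. N p)" using p(2) by blast
    qed
    then have "card ?F1 \<le> card (\<Union>p\<in>G. N p)" by (rule card_mono[rotated]) (use fG fN in auto)
    moreover have "(\<Sum>u\<in>F. 2) \<le> (\<Sum>u\<in>F. g u + (if g u = 1 then 1 else 0))"
    proof (rule sum_mono)
      fix u assume "u \<in> F"
      then show "2 \<le> g u + (if g u = 1 then 1 else 0)" using g(1)[of u] by (auto simp: F_def)
    qed
    moreover have "(\<Sum>u\<in>F. if g u = 1 then 1 else 0) = card ?F1"
      by (simp add: sum.If_cases[OF fF] Int_def)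
    ultimately show ?thesis by (simp add: sum.distrib)
  qed
  have cG: "m - 2 \<le> card G"
  proof (rule ccontr)
    assume "\<not> m - 2 \<le> card G"
    then have "card G \<le> 15 + d" using d by linarith
    then have "card G * (m - 2) \<le> (15 + d) * (m - 2)" by (rule mult_le_mono1)
    also have "\<dots> = 240 + 31 * d + d * d" using d by (simp add: algebra_simps)
    finally show False using NG low F0 Tm by linarith
  qed
  have wsum: "(\<Sum>p\<in>M. w p) = (\<Sum>p\<in>G. w p) + (\<Sum>p\<in>B. w p)"
    using sum.subset_diff[of G M w] fM by (simp add: G_def B_def)
  have wGs: "(\<Sum>p\<in>G. w p) \<le> card G * (m - 2)" using sum_bounded_above[of G w "m - 2"] wG by simp
  have wBs: "(\<Sum>p\<in>C. w p) \<le> card C * (2 * (m - 2))" if "C \<subseteq> B" for C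
    using sum_bounded_above[of C w "2 * (m - 2)"] wM that by (fastforce simp: B_def)
  have total: "(\<Sum>p\<in>M. w p) \<le> 305 + 35 * d + d * d"
  proof (cases "card B \<le> 1")
    case True
    have "card G * (m - 2) + card B * (2 * (m - 2)) = (card G + card B) * (m - 2) + card B * (m - 2)"
      by (simp add: algebra_simps)
    also have "\<dots> \<le> m * (m - 2) + 1 * (m - 2)" unfolding GB using True by (intro add_left_mono mult_le_mono1)
    also have "\<dots> = 304 + 35 * d + d * d" using d by (simp add: algebra_simps)
    finally show ?thesis using wsum wGs wBs[OF subset_refl] by linarith
  next
    case False
    then have B2: "card B = 2" "card G = m - 2" using cG GB m18 by linarith+
    have GG: "card G * (m - 2) = 256 + 32 * d + d * d" unfolding B2 using d by (simp add: algebra_simps)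
    \<comment> \<open>The trivial weight \<open>2 * (m - 2)\<close> for both edges of
      \<open>B\<close> would give a total of \<open>m * m - 4\<close>, which is too large. An edge
      with an uncovered neighbour of degree at most two has weight at most \<open>m - 1\<close>, and
      the total becomes the required \<open>m * m - m - 1\<close>.\<close>
    have "\<exists>p\<in>B. \<exists>u\<in>N p. g u \<le> 2"
    proof (rule ccontr)
      assume no: "\<not> ?thesis"
      let ?Fb = "F - (\<Union>p\<in>G. N p)"
      have "3 \<le> g u" if u: "u \<in> ?Fb" for u
      proof -
        obtain p where p: "p \<in> M" "u \<in> N p" using covered u by blast
        then have "p \<in> B" using u by (auto simp: B_def)
        then show ?thesis using no p(2) by force
      qed
      then have "(\<Sum>u\<in>F. 1 + (if u \<in> ?Fb then 2 else 0)) \<le> (\<Sum>u\<in>F. g u)"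
        using g(1) by (intro sum_mono) (auto simp: F_def)
      moreover have "(\<Sum>u\<in>F. if u \<in> ?Fb then 2 else 0) = 2 * card ?Fb"
      proof -
        have "F \<inter> {u. u \<in> ?Fb} = ?Fb" by blast
        then have "(\<Sum>u\<in>F. if u \<in> ?Fb then 2 else 0) = (\<Sum>u\<in>?Fb. 2 :: nat)"
          unfolding sum.If_cases[OF fF] by (simp only: sum.neutral_const add_0_right)
        then show ?thesis by (simp only: sum_constant of_nat_id mult.commute)
      qed
      ultimately have "card F + 2 * card ?Fb \<le> (\<Sum>u\<in>F. g u)" by (simp only: sum.distrib) simp
      moreover have "card F \<le> card ?Fb + card (\<Union>p\<in>G. N p)"
        using diff_card_le_card_Diff[of "\<Union>p\<in>G. N p" F] fG fN by auto
      ultimately show False using NG GG F0 Tm by linarith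
    qed
    then obtain p u where pu: "p \<in> B" "u \<in> N p" "g u \<le> 2" by blast
    have "w p \<le> m - 1" using light[of p u] pu m18 by (auto simp: B_def)
    moreover have "(\<Sum>p\<in>B. w p) = w p + (\<Sum>p\<in>B - {p}. w p)" by (rule sum.remove[OF fG(2) pu(1)])
    moreover have "(\<Sum>p\<in>B - {p}. w p) \<le> card (B - {p}) * (2 * (m - 2))" by (rule wBs) blast
    moreover have "card (B - {p}) = 1" using B2 pu(1) by (simp add: card_Diff_singleton)
    ultimately show ?thesis using wsum wGs GG d by simp
  qed
  have "(\<Sum>y\<in>verts M. card (bn y \<inter> U) - 1) = (\<Sum>p\<in>M. w p)"
    unfolding sum_verts[OF M(1)] by (simp add: w_def g_def)
  then have "(\<Sum>y\<in>verts M. card (bn y \<inter> U) - 1) + m + 1 \<le> m * m" using total mm d by linarith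
  then show thesis using that[of M] M \<nu> by blast
qed

end

section \<open>Small red degrees everywhere and the unbalanced partition\<close>

context counterexample
begin

text \<open>The numbers \<open>deg u - 1\<close> sum to \<open>n\<close> over \<open>W\<close>: here
  \<open>p\<close> contributes its degree minus one, and each non-leaf neighbour at least one
  more.\<close>

lemma nonleaf_neighbours:
  assumes p: "p \<in> W" shows "2 * card (nb p - leaves) + card (nb p \<inter> leaves) \<le> n + 1"
proof -
  let ?Y = "nb p - leaves"
  have Y: "insert p ?Y \<subseteq> W" "p \<notin> ?Y" using p nb_W nb_self by auto
  have dp: "deg p = card ?Y + card (nb p \<inter> leaves)"
    unfolding deg_def using card_Int_Diff[of "nb p" leaves] by simp
  have "(\<Sum>u\<in>W. deg u) = (\<Sum>u\<in>W. (deg u - 1) + 1)"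
  proof (rule sum.cong)
    fix u assume "u \<in> W"
    then show "deg u = deg u - 1 + 1" using deg_pos[of u] by linarith
  qed simp
  then have "(\<Sum>u\<in>W. deg u - 1) = n" unfolding sum.distrib using handshake cardE cardW by simp
  moreover have "(\<Sum>u\<in>insert p ?Y. deg u - 1) \<le> (\<Sum>u\<in>W. deg u - 1)"
    by (rule sum_mono2[OF finW Y(1)]) simp
  moreover have "(\<Sum>u\<in>insert p ?Y. deg u - 1) = deg p - 1 + (\<Sum>u\<in>?Y. deg u - 1)"
    using Y(2) by simp
  moreover have "(\<Sum>u\<in>?Y. 1) \<le> (\<Sum>u\<in>?Y. deg u - 1)"
  proof (rule sum_mono)
    fix u assume u: "u \<in> ?Y"
    then have "u \<in> W" using nb_W by blast
    then have "1 \<le> deg u" "deg u \<noteq> 1" using deg_pos u by (auto simp: leaves_def)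
    then show "1 \<le> deg u - 1" by linarith
  qed
  moreover have "(\<Sum>u\<in>?Y. 1) = card ?Y" by simp
  ultimately show ?thesis using dp deg_pos[OF p] by linarith
qed

text \<open>If \<open>x\<close> had red degree at least \<open>n - 1\<close>, the hub could be
  placed at \<open>x\<close>, with \<open>h\<close> of its leaves on red neighbours outside
  \<open>A\<close> and its remaining neighbours inside.\<close>

lemma hub_image_degree:
  assumes A: "clique R A" "A \<subseteq> V" "n + 2 \<le> card A + 2 * m"
    and p: "p \<in> W" "p \<notin> leaves" "2 * m \<le> card (nb p \<inter> leaves) + 2"
    and x: "x \<in> V" "x \<notin> A" "card (bn x \<inter> A) + 4 \<le> 3 * m"
  shows "card (rn x) + 2 \<le> n"
proof (rule ccontr)
  assume big: "\<not> card (rn x) + 2 \<le> n"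
  have fA: "finite A" using A(2) by simp
  have cAn: "card A < n" by (rule no_big_clique[OF A(1,2)])
  let ?Ax = "rn x \<inter> A"
  have cAx: "card A = card ?Ax + card (bn x \<inter> A)" by (rule split_card_notin[OF x(1) A(2) x(2)])
  have crx: "card (rn x) = card ?Ax + card (rn x - A)" using card_Int_Diff[of "rn x" A] by simp
  have dp: "deg p = card (nb p - leaves) + card (nb p \<inter> leaves)"
    unfolding deg_def using card_Int_Diff[of "nb p" leaves] by simp
  have dpn: "deg p \<le> n - 1"
  proof -
    have "nb p \<subseteq> W - {p}" using nb_W nb_self by blast
    then have "card (nb p) \<le> card (W - {p})" using finW by (intro card_mono) auto
    then show ?thesis using p(1) cardW by (simp add: deg_def card_Diff_singleton)
  qed
  \<comment> \<open>The first term leaves at most \<open>card A\<close> vertices for the clique, the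
    hub itself being outside; the second leaves at most \<open>card ?Ax\<close> neighbours of the
    hub to be placed there.\<close>
  define h where "h = max (n - 1 - card A) (deg p - card ?Ax)"
  have y: "card (nb p - leaves) \<le> card ?Ax"
    using nonleaf_neighbours[OF p(1)] cAx x(3) A(3) n_bounds m18 by linarith
  have "h \<le> card (nb p \<inter> leaves)" unfolding h_def using A(3) p(3) dp y by linarith
  then obtain L where L: "L \<subseteq> nb p \<inter> leaves" "card L = h" "finite L" using obtain_subset_with_card_n by metis
  have "h \<le> card (rn x - A)" unfolding h_def using crx big cAx dpn by linarith
  then obtain g1 where g1: "g1 ` L \<subseteq> rn x - A" "inj_on g1 L"
    using card_le_inj[OF L(3), of "rn x - A"] L(2) by auto
  have LN: "L \<subseteq> nb p" using L(1) by blast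
  have "card (nb p - L) = deg p - h" using card_Diff_subset[OF L(3) LN] L(2) by (simp add: deg_def)
  then have "card (nb p - L) \<le> card ?Ax" unfolding h_def by linarith
  then obtain g2 where g2: "g2 ` (nb p - L) \<subseteq> ?Ax" "inj_on g2 (nb p - L)"
    using card_le_inj[of "nb p - L" ?Ax] by auto
  define f where "f u = (if u = p then x else if u \<in> L then g1 u else g2 u)" for u
  have pL: "p \<notin> L" using LN nb_self by blast
  have nL: "nb u = {p}" if "u \<in> L" for u using that L(1) leaf_nb[of u p] nb_sym by blast
  have nbS: "nbs (insert p L) - insert p L \<subseteq> nb p - L" using nL by (auto simp: nbs_def)
  have all: "insert p L \<union> nbs (insert p L) \<subseteq> insert p (L \<union> (nb p - L))" using nbS by blast
  have fL: "f u \<in> rn x - A" if "u \<in> L" for u using g1(1) that pL by (auto simp: f_def)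
  have fN: "f u \<in> ?Ax" if "u \<in> nb p - L" for u
  proof -
    have "u \<noteq> p" using that nb_self by blast
    then show ?thesis using g2(1) that by (auto simp: f_def)
  qed
  have fp: "f p = x" by (simp add: f_def)
  show False
  proof (rule place_outside[OF A(1,2), of "insert p L" f])
    show "insert p L \<subseteq> W" using p(1) LN nb_W by blast
    have "card (insert p L) = Suc h" using L(2,3) pL by simp
    then show "n \<le> card A + card (insert p L)" unfolding h_def by linarith
    have "inj_on f (insert p (L \<union> (nb p - L)))"
    proof (rule inj_onI)
      fix u v assume uv: "u \<in> insert p (L \<union> (nb p - L))" "v \<in> insert p (L \<union> (nb p - L))" "f u = f v"
      have *: "f a \<noteq> x" if "a \<in> L \<union> (nb p - L)" for a
        using that fL[of a] fN[of a] not_self(1)[of x] by blast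
      have **: "f a \<noteq> f b" if "a \<in> L" "b \<in> nb p - L" for a b
        using fL[OF that(1)] fN[OF that(2)] by auto
      have l: "f a = g1 a" if "a \<in> L" for a using that pL by (auto simp: f_def)
      have n: "f a = g2 a" if "a \<in> nb p - L" for a using that nb_self by (auto simp: f_def)
      consider "u = p" | "v = p" | "u \<in> L" "v \<in> L" | "u \<in> L" "v \<in> nb p - L" | "u \<in> nb p - L" "v \<in> L"
        | "u \<in> nb p - L" "v \<in> nb p - L" using uv(1,2) by blast
      then show "u = v"
      proof cases
        case 1
        then show ?thesis using uv(2,3) * fp by auto
      next
        case 2
        then show ?thesis using uv(1,3) * fp by auto
      next
        case 3
        then show ?thesis using uv(3) l inj_onD[OF g1(2), of u v] by simp
      next
        case 4
        then show ?thesis using uv(3) ** by blast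
      next
        case 5
        then show ?thesis using uv(3) **[of v u] by simp
      next
        case 6
        then show ?thesis using uv(3) n inj_onD[OF g2(2), of u v] by simp
      qed
    qed
    then show "inj_on f (insert p L \<union> nbs (insert p L))" using all by (rule inj_on_subset)
    show "f ` insert p L \<subseteq> V - A" using fL fp x(1,2) rn_V by blast
    show "f ` (nbs (insert p L) - insert p L) \<subseteq> A" using nbS fN by blast
    fix u v assume uv: "u \<in> insert p L" "v \<in> nb u"
    show "R (f u) (f v)"
    proof (cases "u = p")
      case True
      then have "f v \<in> rn x" using uv(2) fL[of v] fN[of v] by blast
      then show ?thesis using True fp by (simp add: mem_rn)
    next
      case False
      then have "u \<in> L" "v = p" using uv nL by auto
      then have "f u \<in> rn x" using fL by blast
      then show ?thesis using \<open>v = p\<close> fp R_sym by (simp add: mem_rn)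
    qed
  qed
qed

text \<open>Vertices of \<open>S\<close> are red to almost all of \<open>A\<close>, so the red
  degree bound leaves them few red neighbours in \<open>B\<close>. Any two of them therefore share
  at least \<open>m\<close> blue neighbours in \<open>B\<close>, and \<open>m\<close> blue
  neighbours of \<open>x\<close> inside \<open>S\<close> would give a fan.\<close>

lemma inner_blue_degree:
  assumes A: "A \<subseteq> V" "n + 2 \<le> card A + 2 * m" and B: "B \<subseteq> V" "n + 2 \<le> card B + 2 * m"
    and AB: "A \<inter> B = {}" and red: "\<And>x. x \<in> V \<Longrightarrow> card (rn x) + 2 \<le> n"
    and S: "S \<subseteq> V" "S \<inter> B = {}" "\<And>y. y \<in> S \<Longrightarrow> card (bn y \<inter> A) + 1 \<le> m" and x: "x \<in> S"
  shows "card (bn x \<inter> S) + 1 \<le> m"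
proof (rule ccontr)
  assume c: "\<not> ?thesis"
  have fA: "finite A" using A(1) by simp
  have cB: "card B + card A \<le> card (bn y \<inter> B) + n + m - 2" if y: "y \<in> S" for y
  proof -
    have yV: "y \<in> V" "y \<notin> B" using y S by blast+
    have "card B = card (rn y \<inter> B) + card (bn y \<inter> B)" by (rule split_card_notin[OF yV(1) B(1) yV(2)])
    moreover have "card (A - {y}) = card (rn y \<inter> A) + card (bn y \<inter> A)" by (rule split_card[OF yV(1) A(1)])
    moreover have "card A \<le> Suc (card (A - {y}))" by (cases "y \<in> A") (simp_all add: card_Diff_singleton)
    moreover have "card (rn y \<inter> A) + card (rn y \<inter> B) \<le> card (rn y)"
    proof -
      have "card ((rn y \<inter> A) \<union> (rn y \<inter> B)) = card (rn y \<inter> A) + card (rn y \<inter> B)"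
        by (rule card_Un_disjoint) (use AB in auto)
      moreover have "card ((rn y \<inter> A) \<union> (rn y \<inter> B)) \<le> card (rn y)" by (rule card_mono) auto
      ultimately show ?thesis by simp
    qed
    ultimately show ?thesis using red[OF yV(1)] S(3)[OF y] by linarith
  qed
  have xV: "x \<in> V" using x S by blast
  show False
  proof (rule no_blue_bipartite[OF xV, of "bn x \<inter> S" "bn x \<inter> B"])
    show "bn x \<inter> S \<inter> (bn x \<inter> B) = {}" using S(2) by blast
    show "m \<le> card (bn x \<inter> S)" using c by linarith
    fix y assume y: "y \<in> bn x \<inter> S"
    have fB: "finite B" using B(1) by simp
    have "(bn y \<inter> B) \<inter> (bn x \<inter> B) = bn y \<inter> (bn x \<inter> B)" by blast
    then have "card (bn y \<inter> B) + card (bn x \<inter> B) \<le> card (bn y \<inter> (bn x \<inter> B)) + card B"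
      using card_Int_ge[OF fB, of "bn y \<inter> B" "bn x \<inter> B"] by simp
    then show "m \<le> card (bn y \<inter> (bn x \<inter> B))"
      using cB[OF x] cB[of y] y A(2) B(2) n_bounds m18 by auto
  qed auto
qed

text \<open>Every vertex b of S' sees only a few of the end points of a blue matching of S in red, so
  a matching of size m + 1, or one of size m with small degree sum, lies in the blue
  neighbourhood of some b.\<close>
lemma unbalanced_partition_absurd:
  assumes S: "S \<union> S' = V" "S \<inter> S' = {}" "n \<le> card S"
    and red: "\<And>x. x \<in> V \<Longrightarrow> card (rn x) + 2 \<le> n"
    and inner: "\<And>x. x \<in> S \<Longrightarrow> card (bn x \<inter> S) + 1 \<le> m"
  shows False
proof -
  have SV: "S \<subseteq> V" "S' \<subseteq> V" using S(1) by blast+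
  have fS': "finite S'" using SV by simp
  obtain j where j: "card S = n + j" using S(3) le_Suc_ex by blast
  have "card V = card S + card S'"
    unfolding S(1)[symmetric] by (rule card_Un_disjoint) (use SV S(2) in auto)
  then have cS': "card S' + j + 1 = n" using cardV' j by linarith
  \<comment> \<open>Since \<open>S\<close> has \<open>n + j\<close> vertices but \<open>x\<close>
    has at most \<open>n - 2\<close> red neighbours, each red edge to \<open>S'\<close> costs a blue
    one inside \<open>S\<close>, and \<open>1 + j\<close> more are missing anyway.\<close>
  have cross: "card (rn x \<inter> S') + 1 + j \<le> card (bn x \<inter> S)" if x: "x \<in> S" for x
  proof -
    have xV: "x \<in> V" using x SV by blast
    have "card S = card (rn x \<inter> S) + card (bn x \<inter> S) + 1" by (rule split_card_in[OF xV SV(1) x])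
    moreover have "card ((rn x \<inter> S) \<union> (rn x \<inter> S')) = card (rn x \<inter> S) + card (rn x \<inter> S')"
      by (rule card_Un_disjoint) (use S(2) in auto)
    moreover have "card ((rn x \<inter> S) \<union> (rn x \<inter> S')) \<le> card (rn x)" by (rule card_mono) auto
    ultimately show ?thesis using red[OF xV] j by linarith
  qed
  have count: "(\<Sum>b\<in>S'. card (rn b \<inter> verts N)) = (\<Sum>y\<in>verts N. card (rn y \<inter> S'))"
    if "matching blue N" for N
    by (rule red_double_count[OF fS' finite_verts[OF that]])
  have sees: "card N < m + card (rn b \<inter> verts N)" if N: "matching blue N" "verts N \<subseteq> S" and b: "b \<in> S'" for N b
    by (rule red_to_matching[OF N(1)]) (use N(2) b S SV in auto)
  obtain d where d: "m = 18 + d" using m18 le_Suc_ex by blast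
  have mm: "m * m = 324 + 36 * d + d * d" unfolding d by (simp add: algebra_simps)
  have "S \<noteq> {}" using S(3) npos by auto
  then obtain x0 where "x0 \<in> S" by blast
  then have "j + 2 \<le> m" using cross[of x0] inner[of x0] by linarith
  \<comment> \<open>By \<open>cross\<close> and \<open>inner\<close>, \<open>i\<close> bounds the
    red degree of a vertex of \<open>S\<close> into \<open>S'\<close>.\<close>
  then obtain i where i: "m = j + 2 + i" using le_Suc_ex by blast
  have small: "card M \<le> m" if M: "matching blue M" "verts M \<subseteq> S" for M
  proof (rule ccontr)
    assume "\<not> card M \<le> m"
    then have "Suc m \<le> card M" by linarith
    then obtain N where N: "N \<subseteq> M" "matching blue N" "card N = Suc m"
      by (rule matching_submatching[OF M(1)])
    have NS: "verts N \<subseteq> S" using verts_mono[OF N(1)] M(2) by blast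
    have "(\<Sum>b\<in>S'. 2) \<le> (\<Sum>b\<in>S'. card (rn b \<inter> verts N))"
      by (rule sum_mono) (use sees[OF N(2) NS] N(3) in fastforce)
    also have "\<dots> \<le> (\<Sum>y\<in>verts N. i)"
      unfolding count[OF N(2)]
    proof (rule sum_mono)
      fix y assume "y \<in> verts N"
      then have "y \<in> S" using NS by blast
      then show "card (rn y \<inter> S') \<le> i" using cross[of y] inner[of y] i by linarith
    qed
    also have "\<dots> = 2 * Suc m * i" using card_verts[OF N(2)] N(3) by simp
    finally have "card S' \<le> Suc m * i" by simp
    moreover have "Suc m * i + Suc m * j = Suc m * (16 + d)"
      using i d by (simp add: distrib_left[symmetric])
    moreover have "Suc m * (16 + d) = 304 + 35 * d + d * d" using d by (simp add: algebra_simps)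
    moreover have "j \<le> Suc m * j" by simp
    ultimately show False using cS' nm mm d by linarith
  qed
  obtain M where M: "matching blue M" "verts M \<subseteq> S" "card M = m"
    "(\<Sum>y\<in>verts M. card (bn y \<inter> S) - 1) + m + 1 \<le> m * m"
  proof (rule light_matching[OF SV(1) _ m18 _ small])
    show "m * m + 1 \<le> card S + m" using nm S(3) by linarith
    show "1 \<le> card (bn u \<inter> S) \<and> card (bn u \<inter> S) + 1 \<le> m" if "u \<in> S" for u
      using cross[OF that] inner[OF that] by linarith
  qed auto
  have "(\<Sum>b\<in>S'. 1) \<le> (\<Sum>b\<in>S'. card (rn b \<inter> verts M))"
    by (rule sum_mono) (use sees[OF M(1,2)] M(3) in fastforce)
  then have "card S' \<le> (\<Sum>y\<in>verts M. card (rn y \<inter> S'))" using count[OF M(1)] by simp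
  moreover have "(\<Sum>y\<in>verts M. card (rn y \<inter> S') + j) \<le> (\<Sum>y\<in>verts M. card (bn y \<inter> S) - 1)"
  proof (rule sum_mono)
    fix y assume "y \<in> verts M"
    then have "y \<in> S" using M(2) by blast
    then show "card (rn y \<inter> S') + j \<le> card (bn y \<inter> S) - 1" using cross[of y] by linarith
  qed
  moreover have "(\<Sum>y\<in>verts M. card (rn y \<inter> S') + j) = (\<Sum>y\<in>verts M. card (rn y \<inter> S')) + 2 * m * j"
    using card_verts[OF M(1)] M(3) by (simp add: sum.distrib)
  \<comment> \<open>So far \<open>card S' + 2 * m * j \<le> m * m - m - 1\<close>, whereas
    \<open>card S' = n - 1 - j\<close>; this would force \<open>n \<le> m * m - m\<close>.\<close>
  moreover have "j \<le> 2 * m * j" using m18 by simp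
  ultimately show False using M(4) cS' nm by linarith
qed

text \<open>For a single hub \<open>leafy_clique_degrees\<close> forbids even one vertex of red
  degree \<open>n - 1\<close> in either clique, and \<open>hub_image_degree\<close> extends this to
  all of \<open>V\<close>. The vertices then split according to the clique to which they are nearly
  red, and one part has at least \<open>n\<close> of them.\<close>

lemma concentrated_leaves_absurd:
  assumes v: "v \<in> V" "n \<le> card (bn v)"
    and p: "p \<in> W" "2 * m \<le> card (nb p \<inter> leaves) + 2"
  shows False
proof -
  have "nb p \<inter> leaves \<noteq> {}" using p(2) m18 by auto
  then obtain u where "u \<in> leaves" "p \<in> nb u" using nb_sym by blast
  then have pl: "p \<notin> leaves" by (rule leaf_parent_not_leaf)
  have P: "{p} \<subseteq> W" "{p} \<inter> leaves = {}" "2 * m \<le> (\<Sum>p\<in>{p}. card (nb p \<inter> leaves)) + 2"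
    "card {p} + 2 \<le> 2 * m" using p pl m18 by auto
  obtain A B where AB: "clique R A" "A \<subseteq> V" "n + 2 \<le> card A + 2 * m"
    "clique R B" "B \<subseteq> V - A" "n + 2 \<le> card B + 2 * m"
    "card A < card {a \<in> A. card (rn a) + 2 \<le> n} + card {p}"
    by (rule leafy_cliques[OF v P])
  have BV: "B \<subseteq> V" "A \<subseteq> V - B" "A \<inter> B = {}" using AB(2,5) by blast+
  have low: "card (rn c) + 2 \<le> n" if C: "clique R C" "C \<subseteq> V" "n + 2 \<le> card C + 2 * m" and c: "c \<in> C" for C c
  proof (rule ccontr)
    assume "\<not> ?thesis"
    then have "c \<in> {a \<in> C. \<not> card (rn a) + 2 \<le> n}" using c by blast
    moreover have "finite {a \<in> C. \<not> card (rn a) + 2 \<le> n}" using C(2) by simp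
    ultimately have "1 \<le> card {a \<in> C. \<not> card (rn a) + 2 \<le> n}" by (metis Suc_leI card_gt_0_iff empty_iff One_nat_def)
    then show False using leafy_clique_degrees[OF C P(1,2,3)] by simp
  qed
  have rA: "card (rn a - A) + 3 \<le> 2 * m" if "a \<in> A" for a
    by (rule red_outside[OF AB(1,2) that low[OF AB(1,2,3) that] AB(3)])
  have rB: "card (rn b - B) + 3 \<le> 2 * m" if "b \<in> B" for b
    by (rule red_outside[OF AB(4) BV(1) that low[OF AB(4) BV(1) AB(6) that] AB(6)])
  have cls: "card (bn x \<inter> A) + 1 \<le> m \<or> card (bn x \<inter> B) + 4 \<le> 3 * m"
    "card (bn x \<inter> B) + 1 \<le> m \<or> card (bn x \<inter> A) + 4 \<le> 3 * m" if "x \<in> V" for x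
    using blue_to_cliques[OF subset_refl AB(2,5) that rA] blue_to_cliques[OF subset_refl BV(1,2) that rB] by blast+
  have red: "card (rn x) + 2 \<le> n" if x: "x \<in> V" for x
  proof -
    consider "x \<in> A" | "x \<in> B" | "x \<notin> A" "card (bn x \<inter> A) + 4 \<le> 3 * m" | "x \<notin> B" "card (bn x \<inter> B) + 4 \<le> 3 * m"
      using cls[OF x] m18 by fastforce
    then show ?thesis
    proof cases
      case 1
      then show ?thesis using low AB(1,2,3) by blast
    next
      case 2
      then show ?thesis using low AB(4,6) BV(1) by blast
    next
      case 3
      then show ?thesis using hub_image_degree[OF AB(1,2,3) p(1) pl p(2) x] by blast
    next
      case 4
      then show ?thesis using hub_image_degree[OF AB(4) BV(1) AB(6) p(1) pl p(2) x] by blast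
    qed
  qed
  let ?A' = "{x \<in> V. card (bn x \<inter> A) + 1 \<le> m}" and ?B' = "{x \<in> V. card (bn x \<inter> B) + 1 \<le> m}"
  \<comment> \<open>A small red degree forces many blue neighbours in the two cliques together. So
    no vertex has few in both: this separates the two classes and sharpens the bound
    \<open>3 * m - 4\<close> from \<open>cls\<close> to \<open>m - 1\<close>.\<close>
  have sum: "n + 5 \<le> card (bn x \<inter> A) + card (bn x \<inter> B) + 4 * m" if x: "x \<in> V" for x
  proof -
    have "card (A \<union> B) = card A + card B" by (rule card_Un_disjoint) (use AB(2) BV in auto)
    moreover have "card ((A \<union> B) - {x}) = card (rn x \<inter> (A \<union> B)) + card (bn x \<inter> (A \<union> B))"
      by (rule split_card[OF x]) (use AB(2) BV in blast)
    moreover have "card (A \<union> B) \<le> Suc (card ((A \<union> B) - {x}))"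
      by (cases "x \<in> A \<union> B") (simp_all add: card_Diff_singleton)
    moreover have "card (rn x \<inter> (A \<union> B)) \<le> card (rn x)" by (rule card_mono) auto
    moreover have "card (bn x \<inter> (A \<union> B)) \<le> card (bn x \<inter> A) + card (bn x \<inter> B)"
      unfolding Int_Un_distrib by (rule card_Un_le)
    ultimately show ?thesis using red[OF x] AB(3,6) by linarith
  qed
  have un: "?A' \<union> ?B' = V"
  proof -
    have "x \<in> ?A' \<union> ?B'" if x: "x \<in> V" for x using cls[OF x] sum[OF x] n_bounds x by auto
    then show ?thesis by blast
  qed
  have disj: "?A' \<inter> ?B' = {}"
  proof -
    have False if "x \<in> ?A'" "x \<in> ?B'" for x using that sum[of x] n_bounds by auto
    then show ?thesis by blast
  qed
  have AA: "A \<subseteq> ?A'"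
  proof
    fix x assume "x \<in> A"
    then show "x \<in> ?A'" using clique_not_blue[OF AB(1)] AB(2) m18 by auto
  qed
  have BB: "B \<subseteq> ?B'"
  proof
    fix x assume "x \<in> B"
    then show "x \<in> ?B'" using clique_not_blue[OF AB(4)] BV(1) m18 by auto
  qed
  have "card (?A' \<union> ?B') = card ?A' + card ?B'"
    by (rule card_Un_disjoint[OF _ _ disj]) (use finV in simp_all)
  then have "card V = card ?A' + card ?B'" by (simp only: un)
  then consider "n \<le> card ?A'" | "n \<le> card ?B'" using cardV' by linarith
  then show False
  proof cases
    case 1
    have "card (bn x \<inter> ?A') + 1 \<le> m" if "x \<in> ?A'" for x
      by (rule inner_blue_degree[OF AB(2,3) BV(1) AB(6) BV(3) red _ _ _ that]) (use BB disj in blast)+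
    then show False using unbalanced_partition_absurd[OF un disj 1 red] by blast
  next
    case 2
    have BA: "B \<inter> A = {}" using BV(3) by blast
    have un': "?B' \<union> ?A' = V" and disj': "?B' \<inter> ?A' = {}" using un disj by blast+
    have "card (bn x \<inter> ?B') + 1 \<le> m" if "x \<in> ?B'" for x
      by (rule inner_blue_degree[OF BV(1) AB(6) AB(2,3) BA red _ _ _ that]) (use AA disj in blast)+
    then show False using unbalanced_partition_absurd[OF un' disj' 2 red] by blast
  qed
qed

lemma contradiction: False
proof -
  have "\<exists>v\<in>V. \<not> card (bn v) \<le> n - 1" using some_large_blue_degree by blast
  then obtain v where v: "v \<in> V" "n \<le> card (bn v)" by auto
  show False
  proof (cases "card leaves + 3 \<le> 2 * m")
    case True
    then show ?thesis using nonleafy_absurd[OF v] by blast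
  next
    case False
    then have many: "2 * m \<le> card leaves + 2" by linarith
    show ?thesis
    proof (cases "\<exists>p\<in>W. 2 * m \<le> card (nb p \<inter> leaves) + 2")
      case True
      then show ?thesis using concentrated_leaves_absurd[OF v] by blast
    next
      case False
      have "card (nb p \<inter> leaves) + 3 \<le> 2 * m" if "p \<in> W" for p using False that by force
      then show ?thesis using dispersed_leaves_absurd[OF v many] by blast
    qed
  qed
qed

end

section \<open>The Ramsey number\<close>

lemma contains_fanI:
  fixes V :: "'v set"
  assumes M: "matching r M" "card M = m" and x: "x \<in> V" "x \<notin> verts M" and V: "verts M \<subseteq> V"
    and spoke: "\<And>y. y \<in> verts M \<Longrightarrow> {x, y} \<in> F" and edge: "\<And>y z. r y z \<Longrightarrow> {y, z} \<in> F"
  shows "contains_subgraph (fan m) (V, F)"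
proof -
  have M': "finite M" "inj_on fst M" "inj_on snd M" "fst ` M \<inter> snd ` M = {}"
    "\<And>p. p \<in> M \<Longrightarrow> r (fst p) (snd p)"
    using M(1) by (auto simp: matching_def)
  obtain h where h: "bij_betw h {0..<m} M" using ex_bij_betw_nat_finite[OF M'(1)] M(2) by auto
  \<comment> \<open>The fan vertices \<open>2 * i - 1\<close> and \<open>2 * i\<close> go to the
    ends of the matching edge with index \<open>i - 1\<close>: \<open>k\<close> recovers the edge
    and the parity selects the end.\<close>
  define k where "k i = (i - 1) div 2" for i :: nat
  define f where "f i = (if i = 0 then x else if odd i then fst (h (k i)) else snd (h (k i)))" for i :: nat
  have hM: "h i \<in> M" if "i < m" for i using h that by (auto simp: bij_betw_def)
  have hinj: "i = j" if "h i = h j" "i < m" "j < m" for i j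
    using h that by (auto simp: bij_betw_def inj_on_def)
  have k: "k i < m" if "1 \<le> i" "i \<le> 2 * m" for i using that unfolding k_def by presburger
  have fv: "f i \<in> verts M" if "1 \<le> i" "i \<le> 2 * m" for i
    using hM[OF k[OF that]] that by (auto simp: f_def verts_def)
  have fs: "fst (h i) \<noteq> snd (h j)" if "i < m" "j < m" for i j
    using M'(4) hM[OF that(1)] hM[OF that(2)] by auto
  have inj: "inj_on f {0..2 * m}"
  proof (rule inj_onI)
    fix i j assume ij: "i \<in> {0..2 * m}" "j \<in> {0..2 * m}" "f i = f j"
    show "i = j"
    proof (cases "i = 0 \<or> j = 0")
      case True
      have "f l \<noteq> x" if "1 \<le> l" "l \<le> 2 * m" for l using fv[OF that] x(2) by auto
      moreover have "f 0 = x" by (simp add: f_def)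
      ultimately show ?thesis using True ij by (metis One_nat_def Suc_leI atLeastAtMost_iff gr0I)
    next
      case False
      then have ki: "k i < m" "k j < m" using k ij(1,2) by auto
      have par: "odd i = odd j"
        using ij(3) False fs[OF ki] fs[OF ki(2,1)] by (auto simp: f_def split: if_splits)
      then have "h (k i) = h (k j)"
        using ij(3) False inj_onD[OF M'(2) _ hM[OF ki(1)] hM[OF ki(2)]]
          inj_onD[OF M'(3) _ hM[OF ki(1)] hM[OF ki(2)]] by (auto simp: f_def split: if_splits)
      then have "k i = k j" using hinj ki by blast
      then show ?thesis using par False unfolding k_def by presburger
    qed
  qed
  have sub: "f ` {0..2 * m} \<subseteq> V"
  proof
    fix y assume "y \<in> f ` {0..2 * m}"
    then obtain i where i: "i \<le> 2 * m" "y = f i" by auto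
    show "y \<in> V"
    proof (cases "i = 0")
      case True
      then show ?thesis using i x(1) by (simp add: f_def)
    next
      case False
      then show ?thesis using fv[of i] i V by auto
    qed
  qed
  have f0: "f 0 = x" by (simp add: f_def)
  have edges: "f ` e \<in> F" if e: "e \<in> snd (fan m)" for e
  proof -
    have "(\<exists>i. e = {0, i} \<and> 1 \<le> i \<and> i \<le> 2 * m) \<or> (\<exists>i. e = {2 * i - 1, 2 * i} \<and> 1 \<le> i \<and> i \<le> m)"
      using e by (auto simp: fan_def)
    then show ?thesis
    proof (elim disjE exE conjE)
      fix i assume i: "e = {0, i}" "1 \<le> i" "i \<le> 2 * m"
      then show ?thesis using spoke[OF fv[OF i(2,3)]] f0 by simp
    next
      fix i assume i: "e = {2 * i - 1, 2 * i}" "1 \<le> i" "i \<le> m"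
      have ks: "k (2 * i - 1) = i - 1" "k (2 * i) = i - 1" using i(2) unfolding k_def by presburger+
      have "odd (2 * i - 1)" "2 * i - 1 \<noteq> 0" "2 * i \<noteq> 0" using i(2) by auto
      then have "f (2 * i - 1) = fst (h (i - 1))" "f (2 * i) = snd (h (i - 1))"
        unfolding f_def ks by simp_all
      moreover have "h (i - 1) \<in> M" using i by (intro hM) linarith
      ultimately show ?thesis using edge[OF M'(5)] i(1) by simp
    qed
  qed
  show ?thesis unfolding contains_subgraph_def
    using inj sub edges by (intro exI[of _ f]) (simp add: fan_def)
qed

lemma ramsey_upper:
  fixes G :: "'a graph"
  assumes m: "18 \<le> m" "m^2 - m + 1 \<le> n" and G: "unicyclic G n"
  shows "ramsey_prop G (fan m) (2 * n - 1)"
  unfolding ramsey_prop_def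
proof (intro allI impI)
  fix F :: "nat set set"
  let ?V = "{0..<2 * n - 1}"
  assume F: "is_graph (?V, F)"
  obtain W E where WE: "G = (W, E)" by fastforce
  define R where "R x y \<longleftrightarrow> {x, y} \<in> F" for x y
  have FV: "x \<in> ?V \<and> y \<in> ?V \<and> x \<noteq> y" if "R x y" for x y
    using F that unfolding is_graph_def R_def by (fastforce simp: doubleton_eq_iff)
  show "contains_subgraph G (?V, F) \<or> contains_subgraph (fan m) (complement (?V, F))"
  proof (rule ccontr)
    assume no: "\<not> ?thesis"
    have u: "unicyclic_graph W E n"
      using G m(2) unfolding WE by unfold_locales (auto simp: unicyclic_def)
    interpret u: unicyclic_graph W E n by (rule u)
    have h: "host ?V R m"
    proof
      fix x M
      let ?r = "\<lambda>y z. y \<in> ?V \<and> z \<in> ?V \<and> y \<noteq> z \<and> \<not> R y z"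
      assume M: "x \<in> ?V" "matching ?r M" "verts M \<subseteq> {y \<in> ?V. y \<noteq> x \<and> \<not> R x y}"
      show "card M < m"
      proof (rule ccontr)
        assume "\<not> card M < m"
        then have "m \<le> card M" by linarith
        then obtain N where N: "N \<subseteq> M" "matching ?r N" "card N = m"
          by (rule matching_submatching[OF M(2)])
        have NV: "verts N \<subseteq> {y \<in> ?V. y \<noteq> x \<and> \<not> R x y}" using verts_mono[OF N(1)] M(3) by blast
        define F' where "F' = {{u, v} |u v. u \<in> ?V \<and> v \<in> ?V \<and> u \<noteq> v} - F"
        have F': "{y, z} \<in> F'" if "y \<in> ?V" "z \<in> ?V" "y \<noteq> z" "\<not> R y z" for y z
          using that unfolding F'_def R_def by blast
        have "contains_subgraph (fan m) (?V, F')"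
          by (rule contains_fanI[OF N(2,3) M(1)]) (use NV F' M(1) in blast)+
        then show False using no by (simp add: complement_def F'_def)
      qed
    qed (use FV FV[of x x for x] in \<open>auto simp: R_def insert_commute\<close>)
    have "\<not> embeds W E ?V R"
    proof
      assume "embeds W E ?V R"
      then obtain f where f: "inj_on f W" "f ` W \<subseteq> ?V" "\<And>u v. {u, v} \<in> E \<Longrightarrow> R (f u) (f v)"
        by (auto simp: embeds_def)
      have "f ` e \<in> F" if e: "e \<in> E" for e
      proof -
        obtain a b where "e = {a, b}" using u.E_edge[OF e] by blast
        then show ?thesis using f(3)[of a b] e by (simp add: R_def)
      qed
      then have "contains_subgraph G (?V, F)"
        using f(1,2) unfolding WE contains_subgraph_def by (intro exI[of _ f]) simp
      then show False using no by blast
    qed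
    moreover have "m * m + 1 \<le> n + m" using m(2) by (simp add: power2_eq_square)
    ultimately have "counterexample W E n ?V R m"
      using u h m(1) by (intro counterexample.intro counterexample_axioms.intro) auto
    then show False by (rule counterexample.contradiction)
  qed
qed

text \<open>Two disjoint red cliques with at most \<open>n - 1\<close> vertices each: a connected
  graph on \<open>n\<close> vertices fits into neither, and the complement is bipartite and so has
  no triangle.\<close>

lemma ramsey_lower:
  fixes G :: "'a graph"
  assumes m: "1 \<le> m" and G: "unicyclic G n" and N: "0 < n" "N < 2 * n - 1"
  shows "\<not> ramsey_prop G (fan m) N"
proof -
  obtain W E where WE: "G = (W, E)" by fastforce
  define side where "side x \<longleftrightarrow> x < n - 1" for x
  define F where "F = {{u, v} |u v. u \<in> {0..<N} \<and> v \<in> {0..<N} \<and> u \<noteq> v \<and> side u = side v}"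
  have Fs: "side x = side y" if "{x, y} \<in> F" for x y
    using that by (auto simp: F_def doubleton_eq_iff)
  have "is_graph ({0..<N}, F)" by (auto simp: is_graph_def F_def)
  moreover have "\<not> contains_subgraph G ({0..<N}, F)"
  proof
    assume "contains_subgraph G ({0..<N}, F)"
    then obtain f where f: "inj_on f W" "f ` W \<subseteq> {0..<N}" "\<And>e. e \<in> E \<Longrightarrow> f ` e \<in> F"
      by (auto simp: contains_subgraph_def WE)
    have W: "finite W" "card W = n" "connected_graph (W, E)"
      using G by (auto simp: unicyclic_def WE is_graph_def)
    then obtain r where r: "r \<in> W" using N(1) by fastforce
    have same: "side (f w) = side (f r)" if "w \<in> W" for w
    proof -
      have "(r, w) \<in> {(x, y). {x, y} \<in> E}\<^sup>*" using W(3) r that by (simp add: connected_graph_def)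
      then show ?thesis
      proof (induction rule: rtrancl_induct)
        case (step y z)
        then have "{f y, f z} \<in> F" using f(3)[of "{y, z}"] by simp
        then show ?case using Fs step.IH by blast
      qed simp
    qed
    have "f ` W \<subseteq> (if side (f r) then {0..<n - 1} else {n - 1..<N})"
    proof
      fix y assume "y \<in> f ` W"
      then obtain w where w: "w \<in> W" "y = f w" by blast
      moreover have "f w < N" using f(2) w(1) by auto
      ultimately show "y \<in> (if side (f r) then {0..<n - 1} else {n - 1..<N})"
        using same[OF w(1)] by (auto simp: side_def)
    qed
    then have "card (f ` W) \<le> card (if side (f r) then {0..<n - 1} else {n - 1..<N})"
      by (intro card_mono) auto
    also have "\<dots> \<le> n - 1" using N by auto
    finally show False using card_image[OF f(1)] W(2) N(1) by simp
  qed
  moreover have "\<not> contains_subgraph (fan m) (complement ({0..<N}, F))"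
  proof
    assume "contains_subgraph (fan m) (complement ({0..<N}, F))"
    then obtain f where f: "\<And>e. e \<in> snd (fan m) \<Longrightarrow> f ` e \<in> snd (complement ({0..<N}, F))"
      by (auto simp: contains_subgraph_def)
    have "{0, 1} \<in> snd (fan m)" "{0, 2} \<in> snd (fan m)" "{1, 2} \<in> snd (fan m)"
      using m by (auto simp: fan_def intro: exI[of _ 1] exI[of _ 2])
    then have "{f 0, f 1} \<in> snd (complement ({0..<N}, F))" "{f 0, f 2} \<in> snd (complement ({0..<N}, F))"
      "{f 1, f 2} \<in> snd (complement ({0..<N}, F))"
      using f[of "{0, 1}"] f[of "{0, 2}"] f[of "{1, 2}"] by simp_all
    moreover have "side x \<noteq> side y" if "{x, y} \<in> snd (complement ({0..<N}, F))" for x y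
    proof -
      have "x \<in> {0..<N} \<and> y \<in> {0..<N} \<and> x \<noteq> y" "{x, y} \<notin> F"
        using that by (auto simp: complement_def doubleton_eq_iff)
      then show ?thesis by (auto simp: F_def)
    qed
    ultimately show False by blast
  qed
  ultimately show ?thesis by (auto simp: ramsey_prop_def)
qed

theorem theorem5:
  fixes m n :: nat and G :: "'a graph"
  assumes "18 \<le> m" and "m^2 - m + 1 \<le> n" and "unicyclic G n"
  shows "ramsey_number G (fan m) = 2 * n - 1"
  unfolding ramsey_number_def
proof (rule Least_equality)
  show "0 < 2 * n - 1 \<and> ramsey_prop G (fan m) (2 * n - 1)"
    using assms(2) ramsey_upper[OF assms] by simp
  show "2 * n - 1 \<le> N" if "0 < N \<and> ramsey_prop G (fan m) N" for N
  proof (rule ccontr)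
    assume "\<not> 2 * n - 1 \<le> N"
    then show False using ramsey_lower[of m G n N] assms that by simp
  qed
qed

end
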